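(* Let $n\in\mathbb{N}_0$. Any extension $0\to L(n)\to T\to L(n+2)\to 0$ of $\mathcal{D}$-modules is either trivial (split) or else isomorphic, as an extension, to $\mathcal{E}(b)$ for a unique $b\in\Bbbk^\times$. Hence $T$ is isomorphic either to $L(n)\oplus L(n+2)$ or to $T(n,1)$, and $$\dim\operatorname{Ext}^1_{\mathcal{D}}(L(n),L(n+2))=1.$$
   Context: $\Bbbk$ is an algebraically closed field of characteristic $0$; $\mathbb{N}_0=\{0,1,2,\dots\}$. $\mathcal{D}$ (the double of the Jordan plane) is the $\Bbbk$-algebra presented by generators $u, v, \xi, g, g^{-1}, x, y$ and relations $g g^{-1}=g^{-1}g=1$, $\xi g=g\xi$, $gx=xg$, $gy=yg+xg$, $\xi y=y\xi-2y$, $\xi x=x\xi-2x$, $ug=gu$, $vg=gv+gu$, $v\xi=\xi v-2v$, $u\xi=\xi u-2u$, $yx=xy-\tfrac12x^2$, $vu=uv-\tfrac12u^2$, $ux=xu$, $vx=xv+(1-g)+xu$, $uy=yu+(1-g)$, $vy=yv+\tfrac12 g\xi+yu$. Modules are left modules. For $n\in\mathbb{N}_0$, $L(n)$ is the simple $\mathcal{D}$-module with basis $z_{n,0},\dots,z_{n,n}$ and action $\xi\cdot z_{n,i}=(n-2i)z_{n,i}$, $v\cdot z_{n,i}=\tfrac{i(n-i+1)}2z_{n,i-1}$, $y\cdot z_{n,i}=z_{n,i+1}$, $x\cdot z_{n,i}=0$, $u\cdot z_{n,i}=0$, $g\cdot z_{n,i}=z_{n,i}$, where $z_{n,-1}=z_{n,n+1}=0$.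 $T(n,1)$ is the $\mathcal{D}$-module presented by one generator $z$ with defining relations $g\cdot z=z$, $\xi\cdot z=(n+2)z$, $u\cdot z=0$, $v\cdot z=0$, $x^2\cdot z=0$, $y^{n+3}\cdot z=0$, $y^{n+1}x\cdot z=0$. It has basis $\{\mathtt{z}(i,j):=y^ix^j\cdot z: j\in\{0,1\},\ 0\le i\le n+2-2j\}$. For $b\in\Bbbk^\times$, $\mathcal{E}(b)$ is the exact sequence $0\to L(n)\xrightarrow{\iota_b}T(n,1)\xrightarrow{\pi}L(n+2)\to0$ with $\iota_b(z_{n,i})=b\,\mathtt{z}(i,1)$ and $\pi(\mathtt{z}(i,1))=0$ for $0\le i\le n$, and $\pi(\mathtt{z}(k,0))=z_{n+2,k}$ for $0\le k\le n+2$. An extension of $L(n)$ by $L(m)$ is a short exact sequence $0\to L(n)\to T\to L(m)\to0$ of $\mathcal{D}$-modules; two extensions are isomorphic if there is an isomorphism of the middle terms compatible with the identity maps of $L(n)$ and $L(m)$. $\operatorname{Ext}^1_{\mathcal{D}}(L(n),L(m))$ denotes the vector space of classes of such extensions (so $L(n)$ is the submodule and $L(m)$ the quotient). *)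

theory Defs
  imports
    "HOL-Library.Poly_Mapping"
    "HOL-Algebra.QuotRing"
    "Jordan_Normal_Form.VS_Connect"
begin

section \<open>Left modules over a noncommutative ring\<close>

text \<open>The locale \<open>module\<close> of HOL-Algebra requires a commutative ring, so the same axioms are
  restated here over an arbitrary ring. Modules reuse the library record; its fields \<open>mult\<close> and
  \<open>one\<close> play no role.\<close>

locale left_module = R?: ring R + M?: abelian_group M
  for R :: "('d, 'r) ring_scheme" (structure) and M :: "('d, 'm, 's) module_scheme" (structure) +
  assumes smult_closed:
      "\<lbrakk>a \<in> carrier R; x \<in> carrier M\<rbrakk> \<Longrightarrow> a \<odot>\<^bsub>M\<^esub> x \<in> carrier M"
    and smult_l_distr:
      "\<lbrakk>a \<in> carrier R; b \<in> carrier R; x \<in> carrier M\<rbrakk> \<Longrightarrow>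
        (a \<oplus>\<^bsub>R\<^esub> b) \<odot>\<^bsub>M\<^esub> x = a \<odot>\<^bsub>M\<^esub> x \<oplus>\<^bsub>M\<^esub> b \<odot>\<^bsub>M\<^esub> x"
    and smult_r_distr:
      "\<lbrakk>a \<in> carrier R; x \<in> carrier M; y \<in> carrier M\<rbrakk> \<Longrightarrow>
        a \<odot>\<^bsub>M\<^esub> (x \<oplus>\<^bsub>M\<^esub> y) = a \<odot>\<^bsub>M\<^esub> x \<oplus>\<^bsub>M\<^esub> a \<odot>\<^bsub>M\<^esub> y"
    and smult_assoc1:
      "\<lbrakk>a \<in> carrier R; b \<in> carrier R; x \<in> carrier M\<rbrakk> \<Longrightarrow>
        (a \<otimes>\<^bsub>R\<^esub> b) \<odot>\<^bsub>M\<^esub> x = a \<odot>\<^bsub>M\<^esub> (b \<odot>\<^bsub>M\<^esub> x)"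
    and smult_one: "x \<in> carrier M \<Longrightarrow> \<one>\<^bsub>R\<^esub> \<odot>\<^bsub>M\<^esub> x = x"

definition lmod_hom ::
    "'d ring \<Rightarrow> ('d, 'm) module \<Rightarrow> ('d, 'n) module \<Rightarrow> ('m \<Rightarrow> 'n) set" where
  "lmod_hom R M N = {h. h \<in> carrier M \<rightarrow> carrier N \<and>
     (\<forall>x\<in>carrier M. \<forall>y\<in>carrier M. h (x \<oplus>\<^bsub>M\<^esub> y) = h x \<oplus>\<^bsub>N\<^esub> h y) \<and>
     (\<forall>a\<in>carrier R. \<forall>x\<in>carrier M. h (a \<odot>\<^bsub>M\<^esub> x) = a \<odot>\<^bsub>N\<^esub> h x)}"

definition lmod_iso ::
    "'d ring \<Rightarrow> ('d, 'm) module \<Rightarrow> ('d, 'n) module \<Rightarrow> ('m \<Rightarrow> 'n) set" where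
  "lmod_iso R M N = {h. h \<in> lmod_hom R M N \<and> bij_betw h (carrier M) (carrier N)}"

definition lmod_isomorphic :: "'d ring \<Rightarrow> ('d, 'm) module \<Rightarrow> ('d, 'n) module \<Rightarrow> bool" where
  "lmod_isomorphic R M N \<longleftrightarrow> lmod_iso R M N \<noteq> {}"

definition lmod_sum :: "('d, 'm) module \<Rightarrow> ('d, 'n) module \<Rightarrow> ('d, 'm \<times> 'n) module" where
  "lmod_sum M N = \<lparr>carrier = carrier M \<times> carrier N, mult = undefined, one = undefined,
     zero = (\<zero>\<^bsub>M\<^esub>, \<zero>\<^bsub>N\<^esub>),
     add = (\<lambda>(x, y) (x', y'). (x \<oplus>\<^bsub>M\<^esub> x', y \<oplus>\<^bsub>N\<^esub> y')),
     smult = (\<lambda>a (x, y). (a \<odot>\<^bsub>M\<^esub> x, a \<odot>\<^bsub>N\<^esub> y))\<rparr>"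

definition lmod_quot :: "('d, 'm) module \<Rightarrow> 'm set \<Rightarrow> ('d, 'm set) module" where
  "lmod_quot M K = \<lparr>carrier = a_rcosets\<^bsub>M\<^esub> K, mult = undefined, one = undefined,
     zero = K, add = set_add M, smult = (\<lambda>a X. \<Union>x\<in>X. K +>\<^bsub>M\<^esub> (a \<odot>\<^bsub>M\<^esub> x))\<rparr>"

definition lmod_self :: "'d ring \<Rightarrow> ('d, 'd) module" where
  "lmod_self R = \<lparr>carrier = carrier R, mult = mult R, one = one R, zero = zero R, add = add R,
     smult = mult R\<rparr>"

text \<open>The locale \<open>Module.submodule\<close> of HOL-Algebra does not require commutativity of the ring.\<close>

definition lmod_span :: "'d ring \<Rightarrow> ('d, 'm) module \<Rightarrow> 'm set \<Rightarrow> 'm set" where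
  "lmod_span R M S = \<Inter>{K. Module.submodule K R M \<and> S \<subseteq> K}"

text \<open>The left module with one generator and defining relations \<open>s \<cdot> z = 0\<close> for \<open>s \<in> S\<close>,
  together with its generator.\<close>

definition cyclic_pres :: "'d ring \<Rightarrow> 'd set \<Rightarrow> ('d, 'd set) module" where
  "cyclic_pres R S = lmod_quot (lmod_self R) (lmod_span R (lmod_self R) S)"

definition cyclic_pres_gen :: "'d ring \<Rightarrow> 'd set \<Rightarrow> 'd set" where
  "cyclic_pres_gen R S = lmod_span R (lmod_self R) S +>\<^bsub>lmod_self R\<^esub> \<one>\<^bsub>R\<^esub>"


section \<open>Extensions and the first Ext group\<close>

record ('d, 'n, 'm, 't) extn =
  mid :: "('d, 't) module"
  inc :: "'n \<Rightarrow> 't"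
  prj :: "'t \<Rightarrow> 'm"

definition extension ::
    "'d ring \<Rightarrow> ('d, 'n) module \<Rightarrow> ('d, 'm) module \<Rightarrow> ('d, 'n, 'm, 't) extn \<Rightarrow> bool" where
  "extension R N M e \<longleftrightarrow>
     left_module R N \<and> left_module R M \<and> left_module R (mid e) \<and>
     inc e \<in> lmod_hom R N (mid e) \<and> prj e \<in> lmod_hom R (mid e) M \<and>
     inj_on (inc e) (carrier N) \<and>
     inc e ` carrier N = {t \<in> carrier (mid e). prj e t = \<zero>\<^bsub>M\<^esub>} \<and>
     prj e ` carrier (mid e) = carrier M"

definition ext_iso ::
    "'d ring \<Rightarrow> ('d, 'n) module \<Rightarrow> ('d, 'm) module \<Rightarrow>
      ('d, 'n, 'm, 't) extn \<Rightarrow> ('d, 'n, 'm, 's) extn \<Rightarrow> bool" where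
  "ext_iso R N M e e' \<longleftrightarrow> extension R N M e \<and> extension R N M e' \<and>
     (\<exists>\<phi>\<in>lmod_iso R (mid e) (mid e').
        (\<forall>a\<in>carrier N. \<phi> (inc e a) = inc e' a) \<and>
        (\<forall>t\<in>carrier (mid e). prj e' (\<phi> t) = prj e t))"

definition ext_split ::
    "'d ring \<Rightarrow> ('d, 'n) module \<Rightarrow> ('d, 'm) module \<Rightarrow> ('d, 'n, 'm, 't) extn \<Rightarrow> bool" where
  "ext_split R N M e \<longleftrightarrow> extension R N M e \<and>
     (\<exists>s\<in>lmod_hom R M (mid e). \<forall>m\<in>carrier M. prj e (s m) = m)"

definition ext_trivial ::
    "('d, 'n) module \<Rightarrow> ('d, 'm) module \<Rightarrow> ('d, 'n, 'm, 'n \<times> 'm) extn" where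
  "ext_trivial N M = \<lparr>mid = lmod_sum N M, inc = (\<lambda>a. (a, \<zero>\<^bsub>M\<^esub>)), prj = snd\<rparr>"

definition ext_sum ::
    "('d, 'n, 'm, 't) extn \<Rightarrow> ('d, 'n, 'm, 's) extn \<Rightarrow> ('d, 'n \<times> 'n, 'm \<times> 'm, 't \<times> 's) extn" where
  "ext_sum e e' = \<lparr>mid = lmod_sum (mid e) (mid e'),
     inc = map_prod (inc e) (inc e'), prj = map_prod (prj e) (prj e')\<rparr>"

text \<open>Pullback of an extension along \<open>h : M' \<rightarrow> M\<close>.\<close>

definition ext_pullback ::
    "('d, 'm1) module \<Rightarrow> ('m1 \<Rightarrow> 'm) \<Rightarrow> ('d, 'n, 'm, 't) extn \<Rightarrow> ('d, 'n, 'm1, 't \<times> 'm1) extn" where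
  "ext_pullback M' h e =
     \<lparr>mid = (lmod_sum (mid e) M')
        \<lparr>carrier := {(t, m). t \<in> carrier (mid e) \<and> m \<in> carrier M' \<and> prj e t = h m}\<rparr>,
      inc = (\<lambda>a. (inc e a, \<zero>\<^bsub>M'\<^esub>)), prj = snd\<rparr>"

text \<open>Pushout of an extension along \<open>h : N \<rightarrow> N'\<close>: the middle term is the quotient of
  \<open>N' \<oplus> T\<close> by the submodule of all \<open>(h a, - inc a)\<close>. The projection is constant on each
  coset, which makes \<open>the_elem\<close> meaningful.\<close>

definition ext_pushout ::
    "('d, 'n) module \<Rightarrow> ('d, 'n1) module \<Rightarrow> ('n \<Rightarrow> 'n1) \<Rightarrow> ('d, 'n, 'm, 't) extn \<Rightarrow>
      ('d, 'n1, 'm, ('n1 \<times> 't) set) extn" where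
  "ext_pushout N N' h e =
     (let S = lmod_sum N' (mid e);
          K = (\<lambda>a. (h a, \<ominus>\<^bsub>mid e\<^esub> (inc e a))) ` carrier N
      in \<lparr>mid = lmod_quot S K,
          inc = (\<lambda>a. K +>\<^bsub>S\<^esub> (a, \<zero>\<^bsub>mid e\<^esub>)),
          prj = (\<lambda>X. the_elem ((\<lambda>(a, t). prj e t) ` X))\<rparr>)"

text \<open>The Baer sum: push out along the codiagonal of \<open>N\<close> the pullback along the diagonal
  of \<open>M\<close> of the direct sum.\<close>

definition baer_sum ::
    "('d, 'n) module \<Rightarrow> ('d, 'm) module \<Rightarrow> ('d, 'n, 'm, 't) extn \<Rightarrow> ('d, 'n, 'm, 's) extn \<Rightarrow>
      ('d, 'n, 'm, ('n \<times> ('t \<times> 's) \<times> 'm) set) extn" where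
  "baer_sum N M e e' =
     ext_pushout (lmod_sum N N) N (\<lambda>(a, b). a \<oplus>\<^bsub>N\<^esub> b)
       (ext_pullback M (\<lambda>m. (m, m)) (ext_sum e e'))"

text \<open>The class of an extension, represented by those of its members whose middle term has its
  elements in \<open>'n \<times> 'm\<close>. Every extension is isomorphic to such a one, because the middle term
  of an extension of \<open>N\<close> by \<open>M\<close> is in bijection with \<open>carrier N \<times> carrier M\<close>.\<close>

definition ext_class ::
    "'d ring \<Rightarrow> ('d, 'n) module \<Rightarrow> ('d, 'm) module \<Rightarrow> ('d, 'n, 'm, 't) extn \<Rightarrow>
      ('d, 'n, 'm, 'n \<times> 'm) extn set" where
  "ext_class R N M e = {e'. ext_iso R N M e e'}"

text \<open>\<open>Ext\<^sup>1\<close> of modules over a \<open>'k\<close>-algebra \<open>R\<close> with structure map \<open>\<eta> : 'k \<rightarrow> R\<close>, with the submodule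
  \<open>N\<close> as first argument and the quotient \<open>M\<close> as second. Addition is the Baer sum, and \<open>c\<close>
  acts by pushout along multiplication by \<open>c\<close> on \<open>N\<close>.\<close>

definition Ext1 ::
    "'d ring \<Rightarrow> ('k \<Rightarrow> 'd) \<Rightarrow> ('d, 'n) module \<Rightarrow> ('d, 'm) module \<Rightarrow>
      ('k, ('d, 'n, 'm, 'n \<times> 'm) extn set) module" where
  "Ext1 R \<eta> N M =
     \<lparr>carrier = ext_class R N M ` {e :: ('d, 'n, 'm, 'n \<times> 'm) extn. extension R N M e},
      mult = undefined, one = undefined,
      zero = ext_class R N M (ext_trivial N M),
      add = (\<lambda>C C'. \<Union>e\<in>C. \<Union>e'\<in>C'. ext_class R N M (baer_sum N M e e')),
      smult = (\<lambda>c C. \<Union>e\<in>C. ext_class R N M (ext_pushout N N (\<lambda>a. \<eta> c \<odot>\<^bsub>N\<^esub> a) e))\<rparr>"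


section \<open>The double of the Jordan plane\<close>

datatype dgen = Du | Dv | Dxi | Dg | Dginv | Dx | Dy

text \<open>Words under concatenation, written additively, so that \<open>dword \<Rightarrow>\<^sub>0 'k\<close> with the convolution
  product of \<open>Poly_Mapping\<close> is the free associative algebra on \<open>dgen\<close>.\<close>

datatype dword = Word (letters: "dgen list")

instantiation dword :: monoid_add
begin

definition zero_dword :: dword where "zero_dword = Word []"

definition plus_dword :: "dword \<Rightarrow> dword \<Rightarrow> dword" where
  "plus_dword w w' = Word (letters w @ letters w')"

instance
  by standard (simp_all add: zero_dword_def plus_dword_def)

end

type_synonym 'k free_alg = "dword \<Rightarrow>\<^sub>0 'k"

definition gen :: "dgen \<Rightarrow> 'k::field free_alg" where
  "gen a = Poly_Mapping.single (Word [a]) 1"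

definition scal :: "'k::field \<Rightarrow> 'k free_alg" where
  "scal c = Poly_Mapping.single 0 c"

definition double_rels :: "'k::field free_alg set" where
  "double_rels =
     (let u = gen Du; v = gen Dv; \<xi> = gen Dxi; g = gen Dg; g' = gen Dginv; x = gen Dx; y = gen Dy
      in {g * g' - 1,
          g' * g - 1,
          \<xi> * g - g * \<xi>,
          g * x - x * g,
          g * y - (y * g + x * g),
          \<xi> * y - (y * \<xi> - 2 * y),
          \<xi> * x - (x * \<xi> - 2 * x),
          u * g - g * u,
          v * g - (g * v + g * u),
          v * \<xi> - (\<xi> * v - 2 * v),
          u * \<xi> - (\<xi> * u - 2 * u),
          y * x - (x * y - scal (1/2) * x^2),
          v * u - (u * v - scal (1/2) * u^2),
          u * x - x * u,
          v * x - (x * v + (1 - g) + x * u),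
          u * y - (y * u + (1 - g)),
          v * y - (y * v + scal (1/2) * g * \<xi> + y * u)})"

definition double_ideal :: "'k::field free_alg set" where
  "double_ideal = genideal class_ring double_rels"

type_synonym 'k double = "'k free_alg set"

definition jordan_double :: "'k::field double ring" where
  "jordan_double = class_ring Quot double_ideal"

text \<open>The image of a noncommutative polynomial in the double.\<close>

definition dbl :: "'k::field free_alg \<Rightarrow> 'k double" where
  "dbl p = double_ideal +>\<^bsub>class_ring\<^esub> p"


section \<open>The modules and the family of extensions\<close>

text \<open>An element of \<open>L(n)\<close> is its coordinate function with respect to \<open>z\<^sub>n\<^sub>,\<^sub>0, \<dots>, z\<^sub>n\<^sub>,\<^sub>n\<close>.
  The vector \<open>zL n i\<close> vanishes for \<open>i > n\<close>.\<close>

definition zL :: "nat \<Rightarrow> nat \<Rightarrow> (nat \<Rightarrow> 'k::field)" where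
  "zL n i = (\<lambda>j. if j = i \<and> i \<le> n then 1 else 0)"

text \<open>The action of a generator on \<open>zL n i\<close> for \<open>i \<le> n\<close>. In the clause for \<open>Dv\<close> the truncated
  index \<open>i - 1\<close> at \<open>i = 0\<close> is harmless because the coefficient is \<open>0\<close>.\<close>

fun L_gen :: "nat \<Rightarrow> dgen \<Rightarrow> nat \<Rightarrow> (nat \<Rightarrow> 'k::field)" where
  "L_gen n Dxi i = (\<lambda>j. (of_nat n - 2 * of_nat i) * zL n i j)"
| "L_gen n Dv i = (\<lambda>j. of_nat (i * (n - i + 1)) / 2 * zL n (i - 1) j)"
| "L_gen n Dy i = zL n (i + 1)"
| "L_gen n Dx i = (\<lambda>j. 0)"
| "L_gen n Du i = (\<lambda>j. 0)"
| "L_gen n Dg i = zL n i"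
| "L_gen n Dginv i = zL n i"

definition L_op :: "nat \<Rightarrow> dgen \<Rightarrow> (nat \<Rightarrow> 'k::field) \<Rightarrow> (nat \<Rightarrow> 'k)" where
  "L_op n a f = (\<lambda>j. \<Sum>i\<le>n. f i * L_gen n a i j)"

text \<open>The action of the free algebra determined by the action \<open>\<rho>\<close> of the generators.\<close>

definition free_act ::
    "(dgen \<Rightarrow> (nat \<Rightarrow> 'k::field) \<Rightarrow> (nat \<Rightarrow> 'k)) \<Rightarrow> 'k free_alg \<Rightarrow> (nat \<Rightarrow> 'k) \<Rightarrow> (nat \<Rightarrow> 'k)" where
  "free_act \<rho> p f =
     (\<lambda>j. \<Sum>w\<in>Poly_Mapping.keys p. Poly_Mapping.lookup p w * foldr \<rho> (letters w) f j)"

text \<open>The double acts through representatives; the choice is immaterial because the operators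
  \<open>L_op n\<close> satisfy the defining relations.\<close>

definition L :: "nat \<Rightarrow> ('k::field double, nat \<Rightarrow> 'k) module" where
  "L n = \<lparr>carrier = {f. \<forall>i>n. f i = 0}, mult = undefined, one = undefined,
     zero = (\<lambda>_. 0), add = (\<lambda>f f' j. f j + f' j),
     smult = (\<lambda>d f. free_act (L_op n) (SOME p. p \<in> d) f)\<rparr>"

definition T1_rels :: "nat \<Rightarrow> 'k::field double set" where
  "T1_rels n = dbl ` {gen Dg - 1, gen Dxi - of_nat (n + 2), gen Du, gen Dv,
     gen Dx ^ 2, gen Dy ^ (n + 3), gen Dy ^ (n + 1) * gen Dx}"

definition T1 :: "nat \<Rightarrow> ('k::field double, 'k double set) module" where
  "T1 n = cyclic_pres jordan_double (T1_rels n)"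

text \<open>\<open>zT n i j = y\<^sup>i x\<^sup>j \<cdot> z\<close>\<close>

definition zT :: "nat \<Rightarrow> nat \<Rightarrow> nat \<Rightarrow> 'k::field double set" where
  "zT n i j = dbl (gen Dy ^ i * gen Dx ^ j) \<odot>\<^bsub>T1 n\<^esub> cyclic_pres_gen jordan_double (T1_rels n)"

text \<open>The maps of \<open>\<E>(b)\<close> are the linear ones with the prescribed values on bases:
  \<open>z\<^sub>n\<^sub>,\<^sub>i \<mapsto> b zT n i 1\<close>, respectively \<open>zT n i 1 \<mapsto> 0\<close> and \<open>zT n k 0 \<mapsto> z\<^sub>n\<^sub>+\<^sub>2\<^sub>,\<^sub>k\<close>.\<close>

definition iota :: "nat \<Rightarrow> 'k::field \<Rightarrow> (nat \<Rightarrow> 'k) \<Rightarrow> 'k double set" where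
  "iota n b f = (\<Oplus>\<^bsub>T1 n\<^esub>i\<in>{..n}. dbl (scal (f i * b)) \<odot>\<^bsub>T1 n\<^esub> zT n i 1)"

definition proj :: "nat \<Rightarrow> 'k::field double set \<Rightarrow> (nat \<Rightarrow> 'k)" where
  "proj n t = (THE w. \<exists>a c.
     t = (\<Oplus>\<^bsub>T1 n\<^esub>k\<in>{..n + 2}. dbl (scal (a k)) \<odot>\<^bsub>T1 n\<^esub> zT n k 0) \<oplus>\<^bsub>T1 n\<^esub>
         (\<Oplus>\<^bsub>T1 n\<^esub>i\<in>{..n}. dbl (scal (c i)) \<odot>\<^bsub>T1 n\<^esub> zT n i 1) \<and>
     w = (\<lambda>j. \<Sum>k\<le>n + 2. a k * zL (n + 2) k j))"

definition E_ext ::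
    "nat \<Rightarrow> 'k::field \<Rightarrow> ('k double, nat \<Rightarrow> 'k, nat \<Rightarrow> 'k, 'k double set) extn" where
  "E_ext n b = \<lparr>mid = T1 n, inc = iota n b, prj = proj n\<rparr>"

end

theory Submission
  imports Defs "HOL-Library.Function_Algebras" "HOL-Library.Product_Plus"
begin

text \<open>
  Fix \<open>n\<close>. The element \<open>\<xi>\<close> acts on \<open>L n\<close> and on \<open>L (n + 2)\<close> with one-dimensional eigenspaces, and all its
  eigenvalues (the weights) on an extension \<open>T\<close> lie among \<open>n + 2, n, \<dots>, - n - 2\<close>. As \<open>n + 2\<close> is not an eigenvalue on
  the submodule \<open>L n\<close>, the highest weight vector \<open>z\<^sub>n\<^sub>+\<^sub>2\<^sub>,\<^sub>0\<close> of the quotient has exactly one lift \<open>t\<close> of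
  weight \<open>n + 2\<close> to \<open>T\<close> (\<open>top_vector_exists\<close>, \<open>top_vector_unique\<close>). The vector \<open>x \<cdot> t\<close> has weight \<open>n\<close> and
  lies in the submodule, because \<open>x\<close> kills \<open>L (n + 2)\<close>; hence it is \<open>c\<close> times the image of \<open>z\<^sub>n\<^sub>,\<^sub>0\<close> for a
  unique scalar \<open>c\<close>. This scalar, expressed by the predicate \<open>ext_inv n e c\<close>, classifies everything.

  The scalar determines the extension. Comparing weights shows that \<open>t\<close> satisfies the defining
  relations of \<open>T(n,1)\<close> (\<open>top_vector_rels\<close>), so \<open>t\<close> is the image of the generator under a homomorphism
  from \<open>T(n,1)\<close>. On the other side, \<open>T(n,1)\<close> is isomorphic to an explicit module \<open>Xmod n 1\<close> on pairs of
  coordinate functions: the relations hold there (\<open>X_rels\<close>), which gives a surjection from \<open>T(n,1)\<close>,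
  and \<open>T(n,1)\<close> is spanned by the vectors \<open>y\<^sup>i x\<^sup>j \<cdot> z\<close> with \<open>j \<le> 1\<close> and \<open>i \<le> n + 2 - 2 j\<close> (\<open>spanT_all\<close>),
  which makes it injective (\<open>T1_map_iso\<close>). Rescaling the submodule by \<open>c\<close> turns \<open>Xmod n 1\<close> into \<open>Xmod n c\<close>,
  and the short five lemma identifies every extension of invariant \<open>c\<close> with \<open>Xmod n c\<close> (\<open>iso_X_ext\<close>).

  The invariant is \<open>0\<close> for the split extension and \<open>1 / b\<close> for \<open>\<E>(b)\<close>, since there \<open>x \<cdot> z\<close> is the image
  of \<open>z\<^sub>n\<^sub>,\<^sub>0 / b\<close>. This gives the classification of extensions. The middle terms \<open>T(n,1)\<close> and
  \<open>L(n) \<oplus> L(n + 2)\<close> are told apart by the action of \<open>x\<close>, which is zero on the second module only. Finally,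
  each scalar is the invariant of some extension, the invariant of a Baer sum is the sum of the
  invariants (\<open>ext_add\<close>), and a pushout along a scalar multiplies it by that scalar (\<open>ext_scale\<close>); so
  the invariant is a linear isomorphism from \<open>Ext\<^sup>1\<close> to the field (\<open>Ext1_L\<close>).
\<close>

section \<open>Left modules over a ring\<close>

context left_module
begin

lemma smult_zero [simp]:
  assumes "a \<in> carrier R" shows "a \<odot>\<^bsub>M\<^esub> \<zero>\<^bsub>M\<^esub> = \<zero>\<^bsub>M\<^esub>"
proof -
  have "a \<odot>\<^bsub>M\<^esub> \<zero>\<^bsub>M\<^esub> = a \<odot>\<^bsub>M\<^esub> \<zero>\<^bsub>M\<^esub> \<oplus>\<^bsub>M\<^esub> a \<odot>\<^bsub>M\<^esub> \<zero>\<^bsub>M\<^esub>"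
    using smult_r_distr[OF assms, of "\<zero>\<^bsub>M\<^esub>" "\<zero>\<^bsub>M\<^esub>"] by simp
  then show ?thesis using smult_closed[OF assms, of "\<zero>\<^bsub>M\<^esub>"] M.add.l_cancel_one' M.zero_closed by metis
qed

lemma zero_smult [simp]:
  assumes "x \<in> carrier M" shows "\<zero>\<^bsub>R\<^esub> \<odot>\<^bsub>M\<^esub> x = \<zero>\<^bsub>M\<^esub>"
proof -
  have "\<zero>\<^bsub>R\<^esub> \<odot>\<^bsub>M\<^esub> x = \<zero>\<^bsub>R\<^esub> \<odot>\<^bsub>M\<^esub> x \<oplus>\<^bsub>M\<^esub> \<zero>\<^bsub>R\<^esub> \<odot>\<^bsub>M\<^esub> x"
    using smult_l_distr[of "\<zero>\<^bsub>R\<^esub>" "\<zero>\<^bsub>R\<^esub>" x] assms by simp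
  then show ?thesis using smult_closed[OF _ assms, of "\<zero>\<^bsub>R\<^esub>"] M.add.l_cancel_one' R.zero_closed by metis
qed

lemma smult_neg:
  assumes "a \<in> carrier R" "x \<in> carrier M" shows "a \<odot>\<^bsub>M\<^esub> (\<ominus>\<^bsub>M\<^esub> x) = \<ominus>\<^bsub>M\<^esub> (a \<odot>\<^bsub>M\<^esub> x)"
proof -
  have "a \<odot>\<^bsub>M\<^esub> (\<ominus>\<^bsub>M\<^esub> x) \<oplus>\<^bsub>M\<^esub> a \<odot>\<^bsub>M\<^esub> x = \<zero>\<^bsub>M\<^esub>"
    using smult_r_distr[OF assms(1), of "\<ominus>\<^bsub>M\<^esub> x" x] assms by (simp add: M.l_neg)
  then show ?thesis using assms smult_closed M.minus_equality by force
qed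

text \<open>Closure under additive inverses follows from closure under the scalar \<open>\<ominus> \<one>\<close>.\<close>

lemma submoduleI:
  assumes "H \<subseteq> carrier M" "\<zero>\<^bsub>M\<^esub> \<in> H"
    and "\<And>x y. \<lbrakk>x \<in> H; y \<in> H\<rbrakk> \<Longrightarrow> x \<oplus>\<^bsub>M\<^esub> y \<in> H"
    and sm: "\<And>a x. \<lbrakk>a \<in> carrier R; x \<in> H\<rbrakk> \<Longrightarrow> a \<odot>\<^bsub>M\<^esub> x \<in> H"
  shows "Module.submodule H R M"
proof -
  have "\<ominus>\<^bsub>M\<^esub> x \<in> H" if "x \<in> H" for x
  proof -
    have x: "x \<in> carrier M" using that assms by auto
    have "(\<ominus>\<^bsub>R\<^esub> \<one>\<^bsub>R\<^esub>) \<odot>\<^bsub>M\<^esub> x \<oplus>\<^bsub>M\<^esub> x = \<zero>\<^bsub>M\<^esub>"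
      using smult_l_distr[of "\<ominus>\<^bsub>R\<^esub> \<one>\<^bsub>R\<^esub>" "\<one>\<^bsub>R\<^esub>" x] x by (simp add: R.l_neg smult_one)
    then have "\<ominus>\<^bsub>M\<^esub> x = (\<ominus>\<^bsub>R\<^esub> \<one>\<^bsub>R\<^esub>) \<odot>\<^bsub>M\<^esub> x"
      using x smult_closed[of "\<ominus>\<^bsub>R\<^esub> \<one>\<^bsub>R\<^esub>" x] M.minus_equality by force
    then show ?thesis using sm[of "\<ominus>\<^bsub>R\<^esub> \<one>\<^bsub>R\<^esub>" x] that by simp
  qed
  then show ?thesis
    using assms
    by (auto simp: Module.submodule_def submodule_axioms_def subgroup_def a_inv_def[symmetric])
qed

end

subsection \<open>Homomorphisms\<close>

lemma lmod_homI:
  assumes "\<And>x. x \<in> carrier M \<Longrightarrow> h x \<in> carrier N"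
    and "\<And>x y. \<lbrakk>x \<in> carrier M; y \<in> carrier M\<rbrakk> \<Longrightarrow> h (x \<oplus>\<^bsub>M\<^esub> y) = h x \<oplus>\<^bsub>N\<^esub> h y"
    and "\<And>a x. \<lbrakk>a \<in> carrier R; x \<in> carrier M\<rbrakk> \<Longrightarrow> h (a \<odot>\<^bsub>M\<^esub> x) = a \<odot>\<^bsub>N\<^esub> h x"
  shows "h \<in> lmod_hom R M N"
  using assms by (auto simp: lmod_hom_def)

lemma lmod_homD:
  assumes "h \<in> lmod_hom R M N"
  shows "x \<in> carrier M \<Longrightarrow> h x \<in> carrier N"
    and "\<lbrakk>x \<in> carrier M; y \<in> carrier M\<rbrakk> \<Longrightarrow> h (x \<oplus>\<^bsub>M\<^esub> y) = h x \<oplus>\<^bsub>N\<^esub> h y"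
    and "\<lbrakk>a \<in> carrier R; x \<in> carrier M\<rbrakk> \<Longrightarrow> h (a \<odot>\<^bsub>M\<^esub> x) = a \<odot>\<^bsub>N\<^esub> h x"
  using assms by (auto simp: lmod_hom_def)

lemma lmod_hom_zero:
  assumes "h \<in> lmod_hom R M N" "left_module R M" "left_module R N"
  shows "h \<zero>\<^bsub>M\<^esub> = \<zero>\<^bsub>N\<^esub>"
proof -
  interpret M: left_module R M by fact
  interpret N: left_module R N by fact
  have "h \<zero>\<^bsub>M\<^esub> = h (\<zero>\<^bsub>R\<^esub> \<odot>\<^bsub>M\<^esub> \<zero>\<^bsub>M\<^esub>)" by simp
  also have "\<dots> = \<zero>\<^bsub>R\<^esub> \<odot>\<^bsub>N\<^esub> h \<zero>\<^bsub>M\<^esub>" using lmod_homD[OF assms(1)] by blast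
  finally show ?thesis using lmod_homD(1)[OF assms(1)] by simp
qed

lemma lmod_hom_neg:
  assumes "h \<in> lmod_hom R M N" "left_module R M" "left_module R N" "x \<in> carrier M"
  shows "h (\<ominus>\<^bsub>M\<^esub> x) = \<ominus>\<^bsub>N\<^esub> h x"
proof -
  interpret M: left_module R M by fact
  interpret N: left_module R N by fact
  have "h (\<ominus>\<^bsub>M\<^esub> x) \<oplus>\<^bsub>N\<^esub> h x = h (\<ominus>\<^bsub>M\<^esub> x \<oplus>\<^bsub>M\<^esub> x)" using lmod_homD(2)[OF assms(1)] assms(4) by simp
  also have "\<dots> = \<zero>\<^bsub>N\<^esub>" using assms lmod_hom_zero by (simp add: M.l_neg)
  finally show ?thesis
    using lmod_homD(1)[OF assms(1)] assms(4) N.minus_equality by force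
qed

lemma lmod_hom_minus:
  assumes "h \<in> lmod_hom R M N" "left_module R M" "left_module R N" "x \<in> carrier M" "y \<in> carrier M"
  shows "h (x \<ominus>\<^bsub>M\<^esub> y) = h x \<ominus>\<^bsub>N\<^esub> h y"
proof -
  interpret M: left_module R M by fact
  show ?thesis using assms lmod_homD(2)[OF assms(1)] lmod_hom_neg[OF assms(1-3)]
    by (simp add: a_minus_def)
qed

lemma lmod_hom_comp:
  assumes "h \<in> lmod_hom R M N" "k \<in> lmod_hom R N P"
  shows "(\<lambda>x. k (h x)) \<in> lmod_hom R M P"
  using lmod_homD[OF assms(1)] lmod_homD[OF assms(2)] by (intro lmod_homI) auto

lemma lmod_iso_inv:
  assumes "h \<in> lmod_iso R M N" "left_module R M"
  shows "inv_into (carrier M) h \<in> lmod_iso R N M"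
proof -
  interpret M: left_module R M by fact
  let ?k = "inv_into (carrier M) h"
  have hom: "h \<in> lmod_hom R M N" and bij: "bij_betw h (carrier M) (carrier N)"
    using assms(1) by (auto simp: lmod_iso_def)
  have inj: "inj_on h (carrier M)" and im: "h ` carrier M = carrier N"
    using bij by (auto simp: bij_betw_def)
  have kc: "?k x \<in> carrier M" if "x \<in> carrier N" for x using that im inv_into_into by metis
  have hk: "h (?k x) = x" if "x \<in> carrier N" for x using that im f_inv_into_f by metis
  have "?k \<in> lmod_hom R N M"
  proof (rule lmod_homI)
    fix x y assume xy: "x \<in> carrier N" "y \<in> carrier N"
    have "h (?k x \<oplus>\<^bsub>M\<^esub> ?k y) = x \<oplus>\<^bsub>N\<^esub> y" using xy lmod_homD(2)[OF hom] kc hk by simp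
    then show "?k (x \<oplus>\<^bsub>N\<^esub> y) = ?k x \<oplus>\<^bsub>M\<^esub> ?k y"
      using inv_into_f_f[OF inj, of "?k x \<oplus>\<^bsub>M\<^esub> ?k y"] kc xy by simp
  next
    fix a x assume ax: "a \<in> carrier R" "x \<in> carrier N"
    have "h (a \<odot>\<^bsub>M\<^esub> ?k x) = a \<odot>\<^bsub>N\<^esub> x" using ax lmod_homD(3)[OF hom] kc hk by simp
    then show "?k (a \<odot>\<^bsub>N\<^esub> x) = a \<odot>\<^bsub>M\<^esub> ?k x"
      using inv_into_f_f[OF inj, of "a \<odot>\<^bsub>M\<^esub> ?k x"] kc ax M.smult_closed by simp
  qed (rule kc)
  then show ?thesis using bij_betw_inv_into[OF bij] by (simp add: lmod_iso_def)
qed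

subsection \<open>Direct sums\<close>

lemma lmod_sum_simps [simp]:
  "carrier (lmod_sum M N) = carrier M \<times> carrier N"
  "\<zero>\<^bsub>lmod_sum M N\<^esub> = (\<zero>\<^bsub>M\<^esub>, \<zero>\<^bsub>N\<^esub>)"
  "(x, y) \<oplus>\<^bsub>lmod_sum M N\<^esub> (x', y') = (x \<oplus>\<^bsub>M\<^esub> x', y \<oplus>\<^bsub>N\<^esub> y')"
  "a \<odot>\<^bsub>lmod_sum M N\<^esub> (x, y) = (a \<odot>\<^bsub>M\<^esub> x, a \<odot>\<^bsub>N\<^esub> y)"
  by (simp_all add: lmod_sum_def)

lemma lmod_sum_left_module:
  assumes "left_module R M" "left_module R N"
  shows "left_module R (lmod_sum M N)"
proof -
  interpret M: left_module R M by fact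
  interpret N: left_module R N by fact
  show ?thesis
  proof (intro left_module.intro abelian_groupI left_module_axioms.intro)
    show "ring R" by (rule M.R.ring_axioms)
    fix x assume x: "x \<in> carrier (lmod_sum M N)"
    then obtain x1 x2 where x12: "x = (x1, x2)" "x1 \<in> carrier M" "x2 \<in> carrier N" by auto
    show "\<exists>y\<in>carrier (lmod_sum M N). y \<oplus>\<^bsub>lmod_sum M N\<^esub> x = \<zero>\<^bsub>lmod_sum M N\<^esub>"
      using x12 by (intro bexI[of _ "(\<ominus>\<^bsub>M\<^esub> x1, \<ominus>\<^bsub>N\<^esub> x2)"]) (auto simp: M.l_neg N.l_neg)
  qed (auto simp: M.a_ac N.a_ac M.smult_closed N.smult_closed M.smult_l_distr N.smult_l_distr
        M.smult_r_distr N.smult_r_distr M.smult_assoc1 N.smult_assoc1 M.smult_one N.smult_one)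
qed

lemma lmod_sum_neg:
  assumes "left_module R M" "left_module R N" "x \<in> carrier M" "y \<in> carrier N"
  shows "\<ominus>\<^bsub>lmod_sum M N\<^esub> (x, y) = (\<ominus>\<^bsub>M\<^esub> x, \<ominus>\<^bsub>N\<^esub> y)"
proof -
  interpret M: left_module R M by fact
  interpret N: left_module R N by fact
  interpret S: left_module R "lmod_sum M N" using assms lmod_sum_left_module by blast
  show ?thesis using assms S.minus_equality[of "(\<ominus>\<^bsub>M\<^esub> x, \<ominus>\<^bsub>N\<^esub> y)" "(x, y)"]
    by (simp add: M.l_neg N.l_neg)
qed

subsection \<open>Quotients\<close>

locale lmod_subm = left_module R M for R :: "'d ring" (structure) and M :: "('d, 'm) module" (structure) +
  fixes K assumes sub: "Module.submodule K R M"
begin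

sublocale K: abelian_subgroup K M
  using sub abelian_subgroupI3[OF additive_subgroupI] M.abelian_group_axioms
  by (auto simp: Module.submodule_def)

lemma K_smult: "\<lbrakk>a \<in> carrier R; k \<in> K\<rbrakk> \<Longrightarrow> a \<odot>\<^bsub>M\<^esub> k \<in> K"
  using sub by (auto simp: Module.submodule_def submodule_axioms_def)

lemma coset_eq_iff:
  assumes "x \<in> carrier M" "y \<in> carrier M"
  shows "K +>\<^bsub>M\<^esub> x = K +>\<^bsub>M\<^esub> y \<longleftrightarrow> x \<ominus>\<^bsub>M\<^esub> y \<in> K"
  using assms K.a_rcos_module[of y x] K.a_rcos_self[of x] K.a_repr_independence'[of x y]
  by (auto simp: a_minus_def)

lemma coset_smult:
  assumes "a \<in> carrier R" "x \<in> carrier M"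
  shows "a \<odot>\<^bsub>lmod_quot M K\<^esub> (K +>\<^bsub>M\<^esub> x) = K +>\<^bsub>M\<^esub> (a \<odot>\<^bsub>M\<^esub> x)"
proof -
  have "K +>\<^bsub>M\<^esub> (a \<odot>\<^bsub>M\<^esub> x') = K +>\<^bsub>M\<^esub> (a \<odot>\<^bsub>M\<^esub> x)" if "x' \<in> K +>\<^bsub>M\<^esub> x" for x'
  proof -
    have x': "x' \<in> carrier M" using that assms K.a_elemrcos_carrier by blast
    have "x' \<ominus>\<^bsub>M\<^esub> x \<in> K" using that assms K.a_rcos_module_imp by (auto simp: a_minus_def)
    then have "a \<odot>\<^bsub>M\<^esub> (x' \<ominus>\<^bsub>M\<^esub> x) \<in> K" using K_smult assms by blast
    also have "a \<odot>\<^bsub>M\<^esub> (x' \<ominus>\<^bsub>M\<^esub> x) = a \<odot>\<^bsub>M\<^esub> x' \<ominus>\<^bsub>M\<^esub> a \<odot>\<^bsub>M\<^esub> x"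
      using assms x' by (simp add: a_minus_def smult_r_distr smult_neg)
    finally show ?thesis using coset_eq_iff smult_closed assms x' by blast
  qed
  then have "(\<Union>x'\<in>K +>\<^bsub>M\<^esub> x. K +>\<^bsub>M\<^esub> (a \<odot>\<^bsub>M\<^esub> x')) = K +>\<^bsub>M\<^esub> (a \<odot>\<^bsub>M\<^esub> x)"
    using K.a_rcos_self[OF assms(2)] by blast
  then show ?thesis by (simp add: lmod_quot_def)
qed

lemma coset_add:
  assumes "x \<in> carrier M" "y \<in> carrier M"
  shows "(K +>\<^bsub>M\<^esub> x) \<oplus>\<^bsub>lmod_quot M K\<^esub> (K +>\<^bsub>M\<^esub> y) = K +>\<^bsub>M\<^esub> (x \<oplus>\<^bsub>M\<^esub> y)"
  using K.a_rcos_sum assms by (simp add: lmod_quot_def)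

lemma quot_carrier: "carrier (lmod_quot M K) = (\<lambda>x. K +>\<^bsub>M\<^esub> x) ` carrier M"
  by (auto simp: lmod_quot_def A_RCOSETS_def' a_r_coset_def')

lemma quot_zero: "\<zero>\<^bsub>lmod_quot M K\<^esub> = K +>\<^bsub>M\<^esub> \<zero>\<^bsub>M\<^esub>"
  by (simp add: lmod_quot_def K.a_subset)

lemma coset_closed: "x \<in> carrier M \<Longrightarrow> K +>\<^bsub>M\<^esub> x \<in> carrier (lmod_quot M K)"
  by (auto simp: quot_carrier)

lemma quot_abelian_group: "abelian_group (lmod_quot M K)"
proof (intro abelian_groupI)
  fix X Y assume "X \<in> carrier (lmod_quot M K)" "Y \<in> carrier (lmod_quot M K)"
  then obtain x y where xy: "x \<in> carrier M" "X = K +>\<^bsub>M\<^esub> x" "y \<in> carrier M" "Y = K +>\<^bsub>M\<^esub> y"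
    by (auto simp: quot_carrier)
  then show "X \<oplus>\<^bsub>lmod_quot M K\<^esub> Y \<in> carrier (lmod_quot M K)"
    "X \<oplus>\<^bsub>lmod_quot M K\<^esub> Y = Y \<oplus>\<^bsub>lmod_quot M K\<^esub> X"
    by (simp_all add: coset_add coset_closed M.a_comm)
  fix Z assume "Z \<in> carrier (lmod_quot M K)"
  then obtain z where "z \<in> carrier M" "Z = K +>\<^bsub>M\<^esub> z" by (auto simp: quot_carrier)
  with xy show "X \<oplus>\<^bsub>lmod_quot M K\<^esub> Y \<oplus>\<^bsub>lmod_quot M K\<^esub> Z = X \<oplus>\<^bsub>lmod_quot M K\<^esub> (Y \<oplus>\<^bsub>lmod_quot M K\<^esub> Z)"
    by (simp add: coset_add M.a_assoc)
next
  show "\<zero>\<^bsub>lmod_quot M K\<^esub> \<in> carrier (lmod_quot M K)"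
    unfolding quot_zero by (rule coset_closed) simp
next
  fix X assume "X \<in> carrier (lmod_quot M K)"
  then obtain x where x: "x \<in> carrier M" "X = K +>\<^bsub>M\<^esub> x" by (auto simp: quot_carrier)
  then show "\<zero>\<^bsub>lmod_quot M K\<^esub> \<oplus>\<^bsub>lmod_quot M K\<^esub> X = X"
    unfolding quot_zero by (simp only: coset_add M.zero_closed M.l_zero)
  show "\<exists>Y\<in>carrier (lmod_quot M K). Y \<oplus>\<^bsub>lmod_quot M K\<^esub> X = \<zero>\<^bsub>lmod_quot M K\<^esub>"
    unfolding quot_zero using x
    by (intro bexI[of _ "K +>\<^bsub>M\<^esub> (\<ominus>\<^bsub>M\<^esub> x)"]) (simp_all only: coset_add coset_closed M.l_neg M.a_inv_closed)
qed

lemma quot_left_module: "left_module R (lmod_quot M K)"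
proof (intro left_module.intro left_module_axioms.intro)
  show "ring R" by (rule R.ring_axioms)
  show "abelian_group (lmod_quot M K)" by (rule quot_abelian_group)
next
  fix a X assume "a \<in> carrier R" "X \<in> carrier (lmod_quot M K)"
  then show "a \<odot>\<^bsub>lmod_quot M K\<^esub> X \<in> carrier (lmod_quot M K)"
    by (auto simp: quot_carrier coset_smult smult_closed)
next
  fix a b X assume "a \<in> carrier R" "b \<in> carrier R" "X \<in> carrier (lmod_quot M K)"
  then show "(a \<oplus>\<^bsub>R\<^esub> b) \<odot>\<^bsub>lmod_quot M K\<^esub> X = a \<odot>\<^bsub>lmod_quot M K\<^esub> X \<oplus>\<^bsub>lmod_quot M K\<^esub> b \<odot>\<^bsub>lmod_quot M K\<^esub> X"
    by (clarsimp simp: quot_carrier coset_smult coset_add smult_closed smult_l_distr)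
next
  fix a X Y assume "a \<in> carrier R" "X \<in> carrier (lmod_quot M K)" "Y \<in> carrier (lmod_quot M K)"
  then show "a \<odot>\<^bsub>lmod_quot M K\<^esub> (X \<oplus>\<^bsub>lmod_quot M K\<^esub> Y) = a \<odot>\<^bsub>lmod_quot M K\<^esub> X \<oplus>\<^bsub>lmod_quot M K\<^esub> a \<odot>\<^bsub>lmod_quot M K\<^esub> Y"
    by (clarsimp simp: quot_carrier coset_smult coset_add smult_closed smult_r_distr)
next
  fix a b X assume "a \<in> carrier R" "b \<in> carrier R" "X \<in> carrier (lmod_quot M K)"
  then show "(a \<otimes>\<^bsub>R\<^esub> b) \<odot>\<^bsub>lmod_quot M K\<^esub> X = a \<odot>\<^bsub>lmod_quot M K\<^esub> (b \<odot>\<^bsub>lmod_quot M K\<^esub> X)"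
    by (clarsimp simp: quot_carrier coset_smult smult_closed smult_assoc1)
next
  fix X assume "X \<in> carrier (lmod_quot M K)"
  then show "\<one>\<^bsub>R\<^esub> \<odot>\<^bsub>lmod_quot M K\<^esub> X = X"
    by (clarsimp simp: quot_carrier coset_smult smult_one)
qed

end

subsection \<open>Cyclic modules\<close>

lemma lmod_self_simps [simp]:
  "carrier (lmod_self R) = carrier R" "\<zero>\<^bsub>lmod_self R\<^esub> = \<zero>\<^bsub>R\<^esub>"
  "add (lmod_self R) = add R" "smult (lmod_self R) = mult R"
  by (simp_all add: lmod_self_def)

lemma lmod_self_left_module:
  assumes "ring R" shows "left_module R (lmod_self R)"
proof -
  interpret R: ring R by fact
  show ?thesis
  proof (intro left_module.intro abelian_groupI left_module_axioms.intro assms)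
    show "\<exists>y\<in>carrier (lmod_self R). y \<oplus>\<^bsub>lmod_self R\<^esub> x = \<zero>\<^bsub>lmod_self R\<^esub>"
      if "x \<in> carrier (lmod_self R)" for x
      using that by (intro bexI[of _ "\<ominus>\<^bsub>R\<^esub> x"]) (auto simp: R.l_neg)
  qed (auto simp: R.a_ac R.l_distr R.r_distr R.m_assoc)
qed

lemma lmod_span_submodule:
  assumes "left_module R M" "S \<subseteq> carrier M"
  shows "Module.submodule (lmod_span R M S) R M"
proof -
  interpret M: left_module R M by fact
  have whole: "Module.submodule (carrier M) R M"
    by (intro M.submoduleI) (auto intro: M.smult_closed)
  show ?thesis
  proof (intro M.submoduleI)
    show "lmod_span R M S \<subseteq> carrier M" using whole assms(2) by (auto simp: lmod_span_def)
  qed (auto simp: lmod_span_def Module.submodule_def submodule_axioms_def subgroup_def)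
qed

text \<open>The locale is about \<open>cyclic_pres R S\<close>; the left ideal \<open>relsub\<close> generated by the relations is the
  submodule that is divided out.\<close>

locale cyclic_presentation = ring R for R :: "'d ring" (structure) +
  fixes S assumes S: "S \<subseteq> carrier R"
begin

definition "relsub = lmod_span R (lmod_self R) S"

sublocale lmod_subm R "lmod_self R" relsub
  using lmod_self_left_module[OF ring_axioms] lmod_span_submodule[of R "lmod_self R" S] S
  by (auto simp: lmod_subm_def lmod_subm_axioms_def relsub_def)

lemma cyclic_pres_eq: "cyclic_pres R S = lmod_quot (lmod_self R) relsub"
  by (simp add: cyclic_pres_def relsub_def)

lemma gen_eq: "cyclic_pres_gen R S = relsub +>\<^bsub>lmod_self R\<^esub> \<one>\<^bsub>R\<^esub>"
  by (simp add: cyclic_pres_gen_def relsub_def)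

lemma cyclic_pres_left_module: "left_module R (cyclic_pres R S)"
  using quot_left_module by (simp add: cyclic_pres_eq)

lemma smult_gen: "a \<in> carrier R \<Longrightarrow> a \<odot>\<^bsub>cyclic_pres R S\<^esub> cyclic_pres_gen R S = relsub +>\<^bsub>lmod_self R\<^esub> a"
  using coset_smult[of a "\<one>\<^bsub>R\<^esub>"] by (simp add: cyclic_pres_eq gen_eq)

lemma gen_closed: "cyclic_pres_gen R S \<in> carrier (cyclic_pres R S)"
  by (simp add: gen_eq cyclic_pres_eq coset_closed)

lemma cyclic_pres_generated:
  "carrier (cyclic_pres R S) = (\<lambda>a. a \<odot>\<^bsub>cyclic_pres R S\<^esub> cyclic_pres_gen R S) ` carrier R"
  using smult_gen by (simp add: cyclic_pres_eq quot_carrier cong: image_cong)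

lemma genE:
  assumes "X \<in> carrier (cyclic_pres R S)"
  obtains a where "a \<in> carrier R" "X = a \<odot>\<^bsub>cyclic_pres R S\<^esub> cyclic_pres_gen R S"
  using assms cyclic_pres_generated by auto

lemma rels_sub_relsub: "S \<subseteq> relsub" by (auto simp: relsub_def lmod_span_def)

lemma relsub_minimal: "Module.submodule H R (lmod_self R) \<Longrightarrow> S \<subseteq> H \<Longrightarrow> relsub \<subseteq> H"
  by (auto simp: relsub_def lmod_span_def)

lemma rel_gen: 
  assumes "s \<in> S" shows "s \<odot>\<^bsub>cyclic_pres R S\<^esub> cyclic_pres_gen R S = \<zero>\<^bsub>cyclic_pres R S\<^esub>"
proof -
  have s: "s \<in> carrier R" "s \<in> relsub" using assms S rels_sub_relsub by auto
  then have "relsub +>\<^bsub>lmod_self R\<^esub> s = relsub"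
    using M.a_coset_join2[of s relsub] K.a_subgroup by simp
  then show ?thesis using smult_gen[OF s(1)] by (simp add: cyclic_pres_eq lmod_quot_def)
qed

text \<open>The annihilator of \<open>t\<close> is a left ideal containing the relations, hence contains \<open>relsub\<close>. So
  \<open>a \<odot> z \<mapsto> a \<odot> t\<close> does not depend on the chosen multiplier \<open>a\<close>.\<close>

lemma cyclic_pres_universal:
  assumes "left_module R N" and t: "t \<in> carrier N"
    and rel: "\<And>s. s \<in> S \<Longrightarrow> s \<odot>\<^bsub>N\<^esub> t = \<zero>\<^bsub>N\<^esub>"
  shows "\<exists>h\<in>lmod_hom R (cyclic_pres R S) N. h (cyclic_pres_gen R S) = t"
proof -
  interpret N: left_module R N by fact
  let ?z = "cyclic_pres_gen R S" and ?T = "cyclic_pres R S"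
  interpret T: left_module R ?T by (rule cyclic_pres_left_module)
  have "Module.submodule {a \<in> carrier R. a \<odot>\<^bsub>N\<^esub> t = \<zero>\<^bsub>N\<^esub>} R (lmod_self R)"
    using t by (intro submoduleI) (auto simp: N.smult_l_distr N.smult_assoc1)
  then have K: "relsub \<subseteq> {a \<in> carrier R. a \<odot>\<^bsub>N\<^esub> t = \<zero>\<^bsub>N\<^esub>}"
    using relsub_minimal S rel by blast
  have wd: "a \<odot>\<^bsub>N\<^esub> t = b \<odot>\<^bsub>N\<^esub> t"
    if ab: "a \<in> carrier R" "b \<in> carrier R" and eq: "a \<odot>\<^bsub>?T\<^esub> ?z = b \<odot>\<^bsub>?T\<^esub> ?z" for a b
  proof -
    have "a \<in> relsub +>\<^bsub>lmod_self R\<^esub> b" using eq ab smult_gen K.a_rcos_self[of a] by simp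
    then obtain k where k: "k \<in> relsub" "a = k \<oplus>\<^bsub>R\<^esub> b" by (auto simp: a_r_coset_def')
    then show ?thesis using K t ab by (auto simp: N.smult_l_distr N.smult_closed)
  qed
  define h where "h X = (SOME a. a \<in> carrier R \<and> a \<odot>\<^bsub>?T\<^esub> ?z = X) \<odot>\<^bsub>N\<^esub> t" for X
  have h: "h (a \<odot>\<^bsub>?T\<^esub> ?z) = a \<odot>\<^bsub>N\<^esub> t" if "a \<in> carrier R" for a
  proof -
    have "\<exists>b. b \<in> carrier R \<and> b \<odot>\<^bsub>?T\<^esub> ?z = a \<odot>\<^bsub>?T\<^esub> ?z" using that by blast
    from someI_ex[OF this] show ?thesis unfolding h_def using that wd by blast
  qed
  have "h \<in> lmod_hom R ?T N"
  proof (rule lmod_homI)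
    fix X assume "X \<in> carrier ?T"
    then obtain a where "a \<in> carrier R" "X = a \<odot>\<^bsub>?T\<^esub> ?z" by (meson genE)
    then show "h X \<in> carrier N" using h t N.smult_closed by simp
  next
    fix X Y assume "X \<in> carrier ?T" "Y \<in> carrier ?T"
    then obtain a b where ab: "a \<in> carrier R" "X = a \<odot>\<^bsub>?T\<^esub> ?z" "b \<in> carrier R" "Y = b \<odot>\<^bsub>?T\<^esub> ?z"
      by (meson genE)
    then have "X \<oplus>\<^bsub>?T\<^esub> Y = (a \<oplus>\<^bsub>R\<^esub> b) \<odot>\<^bsub>?T\<^esub> ?z" using T.smult_l_distr gen_closed by simp
    then show "h (X \<oplus>\<^bsub>?T\<^esub> Y) = h X \<oplus>\<^bsub>N\<^esub> h Y" using ab h t N.smult_l_distr by simp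
  next
    fix c X assume c: "c \<in> carrier R" and "X \<in> carrier ?T"
    then obtain a where a: "a \<in> carrier R" "X = a \<odot>\<^bsub>?T\<^esub> ?z"
      by (meson genE)
    then have "c \<odot>\<^bsub>?T\<^esub> X = (c \<otimes>\<^bsub>R\<^esub> a) \<odot>\<^bsub>?T\<^esub> ?z" using T.smult_assoc1 gen_closed c by simp
    then show "h (c \<odot>\<^bsub>?T\<^esub> X) = c \<odot>\<^bsub>N\<^esub> h X" using a c h t N.smult_assoc1 by simp
  qed
  moreover have "h ?z = t" using h[of "\<one>\<^bsub>R\<^esub>"] T.smult_one[OF gen_closed] N.smult_one[OF t] by simp
  ultimately show ?thesis by blast
qed

end

context left_module
begin

lemma neg_zero [simp]: "\<ominus>\<^bsub>M\<^esub> \<zero>\<^bsub>M\<^esub> = \<zero>\<^bsub>M\<^esub>"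
  using M.minus_equality[of "\<zero>\<^bsub>M\<^esub>" "\<zero>\<^bsub>M\<^esub>"] by simp

lemma diff_zero_imp_eq:
  assumes "x \<in> carrier M" "y \<in> carrier M" "x \<ominus>\<^bsub>M\<^esub> y = \<zero>\<^bsub>M\<^esub>" shows "x = y"
  using M.minus_equality[of x "\<ominus>\<^bsub>M\<^esub> y"] assms by (simp add: a_minus_def)

end

section \<open>Extensions\<close>

lemma extensionD:
  assumes "extension R N M e"
  shows "left_module R N" "left_module R M" "left_module R (mid e)"
    "inc e \<in> lmod_hom R N (mid e)" "prj e \<in> lmod_hom R (mid e) M"
    "inj_on (inc e) (carrier N)"
    "a \<in> carrier N \<Longrightarrow> prj e (inc e a) = \<zero>\<^bsub>M\<^esub>"
  using assms by (auto simp: extension_def)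

lemma extension_kerE:
  assumes "extension R N M e" "t \<in> carrier (mid e)" "prj e t = \<zero>\<^bsub>M\<^esub>"
  obtains a where "a \<in> carrier N" "t = inc e a"
proof -
  have "t \<in> inc e ` carrier N" using assms by (simp add: extension_def)
  then show ?thesis using that by blast
qed

lemma extension_surjE:
  assumes "extension R N M e" "m \<in> carrier M"
  obtains t where "t \<in> carrier (mid e)" "prj e t = m"
proof -
  have "m \<in> prj e ` carrier (mid e)" using assms by (simp add: extension_def)
  then show ?thesis using that by blast
qed

text \<open>Exactness at the submodule only has to be checked as triviality of the kernel.\<close>

lemma extensionI:
  assumes "left_module R N" "left_module R M" "left_module R (mid e)"
    "inc e \<in> lmod_hom R N (mid e)" "prj e \<in> lmod_hom R (mid e) M"
    and inj: "\<And>a. \<lbrakk>a \<in> carrier N; inc e a = \<zero>\<^bsub>mid e\<^esub>\<rbrakk> \<Longrightarrow> a = \<zero>\<^bsub>N\<^esub>"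
    and "\<And>a. a \<in> carrier N \<Longrightarrow> prj e (inc e a) = \<zero>\<^bsub>M\<^esub>"
    and "\<And>t. \<lbrakk>t \<in> carrier (mid e); prj e t = \<zero>\<^bsub>M\<^esub>\<rbrakk> \<Longrightarrow> \<exists>a\<in>carrier N. t = inc e a"
    and "\<And>m. m \<in> carrier M \<Longrightarrow> \<exists>t\<in>carrier (mid e). prj e t = m"
  shows "extension R N M e"
proof -
  interpret N: left_module R N by fact
  interpret T: left_module R "mid e" by fact
  have "inj_on (inc e) (carrier N)"
  proof (rule inj_onI)
    fix a b assume ab: "a \<in> carrier N" "b \<in> carrier N" "inc e a = inc e b"
    then have "inc e (a \<ominus>\<^bsub>N\<^esub> b) = \<zero>\<^bsub>mid e\<^esub>"
      using lmod_hom_minus[OF assms(4,1,3)] lmod_homD(1)[OF assms(4)] by (simp add: T.M.r_neg a_minus_def)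
    then have "a \<ominus>\<^bsub>N\<^esub> b = \<zero>\<^bsub>N\<^esub>" using inj ab by simp
    then show "a = b" by (rule N.diff_zero_imp_eq[OF ab(1,2)])
  qed
  then show ?thesis
    using assms lmod_homD(1)[OF assms(4)] lmod_homD(1)[OF assms(5)]
    unfolding extension_def by blast
qed

text \<open>The short five lemma: a homomorphism of the middle terms compatible with inclusions and
  projections is bijective. All isomorphisms of extensions below are obtained from it.\<close>

lemma ext_isoI:
  assumes e: "extension R N M e" and e': "extension R N M e'"
    and hom: "\<phi> \<in> lmod_hom R (mid e) (mid e')"
    and \<phi>i: "\<And>a. a \<in> carrier N \<Longrightarrow> \<phi> (inc e a) = inc e' a"
    and \<phi>p: "\<And>t. t \<in> carrier (mid e) \<Longrightarrow> prj e' (\<phi> t) = prj e t"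
  shows "ext_iso R N M e e'"
proof -
  note E = extensionD[OF e] and E' = extensionD[OF e']
  interpret N: left_module R N by (rule E)
  interpret M: left_module R M by (rule E)
  interpret T: left_module R "mid e" by (rule E)
  interpret T': left_module R "mid e'" by (rule E')
  note \<phi>c = lmod_homD(1)[OF hom]
  have "inj_on \<phi> (carrier (mid e))"
  proof (rule inj_onI)
    fix x y assume xy: "x \<in> carrier (mid e)" "y \<in> carrier (mid e)" "\<phi> x = \<phi> y"
    let ?d = "x \<ominus>\<^bsub>mid e\<^esub> y"
    have \<phi>d: "\<phi> ?d = \<zero>\<^bsub>mid e'\<^esub>"
      using xy lmod_hom_minus[OF hom E(3) E'(3)] \<phi>c by (simp add: T'.M.r_neg a_minus_def)
    have "prj e ?d = \<zero>\<^bsub>M\<^esub>"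
      using \<phi>p[of ?d] xy \<phi>d lmod_hom_zero[OF E'(5) E'(3) E(2)] by simp
    then obtain a where a: "a \<in> carrier N" "?d = inc e a"
      using extension_kerE[OF e, of ?d] xy by auto
    then have "inc e' a = inc e' \<zero>\<^bsub>N\<^esub>"
      using \<phi>i \<phi>d lmod_hom_zero[OF E'(4) E(1) E'(3)] by simp
    then have "a = \<zero>\<^bsub>N\<^esub>" using E'(6) a by (auto dest: inj_onD)
    then have "?d = \<zero>\<^bsub>mid e\<^esub>" using a lmod_hom_zero[OF E(4) E(1) E(3)] by simp
    then show "x = y" by (rule T.diff_zero_imp_eq[OF xy(1,2)])
  qed
  moreover have "\<exists>x\<in>carrier (mid e). \<phi> x = y" if y: "y \<in> carrier (mid e')" for y
  proof -
    obtain x where x: "x \<in> carrier (mid e)" "prj e x = prj e' y"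
      using extension_surjE[OF e] lmod_homD(1)[OF E'(5) y] by metis
    have "prj e' (y \<ominus>\<^bsub>mid e'\<^esub> \<phi> x) = \<zero>\<^bsub>M\<^esub>"
      using x y \<phi>c \<phi>p lmod_hom_minus[OF E'(5) E'(3) E(2)] lmod_homD(1)[OF E'(5)]
      by (simp add: M.M.r_neg a_minus_def)
    then obtain a where a: "a \<in> carrier N" "y \<ominus>\<^bsub>mid e'\<^esub> \<phi> x = inc e' a"
      using extension_kerE[OF e', of "y \<ominus>\<^bsub>mid e'\<^esub> \<phi> x"] x y \<phi>c by auto
    have "\<phi> (inc e a \<oplus>\<^bsub>mid e\<^esub> x) = (y \<ominus>\<^bsub>mid e'\<^esub> \<phi> x) \<oplus>\<^bsub>mid e'\<^esub> \<phi> x"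
      using lmod_homD(2)[OF hom] lmod_homD(1)[OF E(4)] a x \<phi>i by simp
    also have "\<dots> = y" using x y \<phi>c by (simp add: a_minus_def T'.M.a_assoc T'.M.l_neg)
    finally show ?thesis using lmod_homD(1)[OF E(4)] a x by blast
  qed
  ultimately have "bij_betw \<phi> (carrier (mid e)) (carrier (mid e'))"
    using \<phi>c by (auto simp: bij_betw_def)
  then show ?thesis
    using assms unfolding ext_iso_def lmod_iso_def by blast
qed

lemma ext_iso_sym:
  assumes "ext_iso R N M e e'" shows "ext_iso R N M e' e"
proof -
  obtain \<phi> where e: "extension R N M e" "extension R N M e'"
    and \<phi>: "\<phi> \<in> lmod_iso R (mid e) (mid e')"
      "\<forall>a\<in>carrier N. \<phi> (inc e a) = inc e' a"
      "\<forall>t\<in>carrier (mid e). prj e' (\<phi> t) = prj e t"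
    using assms by (auto simp: ext_iso_def)
  let ?\<psi> = "inv_into (carrier (mid e)) \<phi>"
  have \<psi>: "?\<psi> \<in> lmod_iso R (mid e') (mid e)" using lmod_iso_inv \<phi>(1) extensionD(3) e(1) by blast
  have bij: "bij_betw \<phi> (carrier (mid e)) (carrier (mid e'))" using \<phi>(1) by (simp add: lmod_iso_def)
  show ?thesis
  proof (rule ext_isoI[OF e(2,1)])
    show "?\<psi> \<in> lmod_hom R (mid e') (mid e)" using \<psi> by (simp add: lmod_iso_def)
    show "?\<psi> (inc e' a) = inc e a" if "a \<in> carrier N" for a
      using \<phi>(2) that bij_betw_inv_into_left[OF bij] lmod_homD(1)[OF extensionD(4)[OF e(1)]] by metis
    show "prj e (?\<psi> t) = prj e' t" if "t \<in> carrier (mid e')" for t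
      using \<phi>(3) that bij_betw_inv_into_right[OF bij that] bij_betwE[OF bij_betw_inv_into[OF bij]] by metis
  qed
qed

lemma ext_iso_trans:
  assumes "ext_iso R N M e e'" "ext_iso R N M e' e''" shows "ext_iso R N M e e''"
proof -
  obtain \<phi> where e: "extension R N M e" "extension R N M e'"
    and \<phi>: "\<phi> \<in> lmod_iso R (mid e) (mid e')"
      "\<forall>a\<in>carrier N. \<phi> (inc e a) = inc e' a"
      "\<forall>t\<in>carrier (mid e). prj e' (\<phi> t) = prj e t"
    using assms(1) by (auto simp: ext_iso_def)
  obtain \<psi> where e'': "extension R N M e''"
    and \<psi>: "\<psi> \<in> lmod_iso R (mid e') (mid e'')"
      "\<forall>a\<in>carrier N. \<psi> (inc e' a) = inc e'' a"
      "\<forall>t\<in>carrier (mid e'). prj e'' (\<psi> t) = prj e' t"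
    using assms(2) by (auto simp: ext_iso_def)
  have h: "\<phi> \<in> lmod_hom R (mid e) (mid e')" "\<psi> \<in> lmod_hom R (mid e') (mid e'')"
    using \<phi>(1) \<psi>(1) by (auto simp: lmod_iso_def)
  show ?thesis
    by (rule ext_isoI[OF e(1) e'' lmod_hom_comp[OF h]]) (use \<phi> \<psi> lmod_homD(1)[OF h(1)] in auto)
qed

lemma lmod_isomorphic_if_ext_iso: "ext_iso R N M e e' \<Longrightarrow> lmod_isomorphic R (mid e) (mid e')"
  by (auto simp: ext_iso_def lmod_isomorphic_def)

lemma ext_trivial_extension:
  assumes N: "left_module R N" and M: "left_module R M"
  shows "extension R N M (ext_trivial N M)"
proof -
  interpret N: left_module R N by fact
  interpret M: left_module R M by fact
  show ?thesis
  proof (rule extensionI)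
    show "left_module R (mid (ext_trivial N M))"
      using lmod_sum_left_module[OF N M] by (simp add: ext_trivial_def)
    show "inc (ext_trivial N M) \<in> lmod_hom R N (mid (ext_trivial N M))"
      by (rule lmod_homI) (auto simp: ext_trivial_def)
    show "prj (ext_trivial N M) \<in> lmod_hom R (mid (ext_trivial N M)) M"
      by (rule lmod_homI) (auto simp: ext_trivial_def)
    show "\<exists>t\<in>carrier (mid (ext_trivial N M)). prj (ext_trivial N M) t = m" if "m \<in> carrier M" for m
      using that by (intro bexI[of _ "(\<zero>\<^bsub>N\<^esub>, m)"]) (auto simp: ext_trivial_def)
  qed (use assms in \<open>auto simp: ext_trivial_def\<close>)
qed

text \<open>The isomorphism carries the canonical section \<open>m \<mapsto> (0, m)\<close> of the direct sum to a section.\<close>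

lemma ext_split_if_iso_trivial:
  assumes "ext_iso R N M (ext_trivial N M) e" shows "ext_split R N M e"
proof -
  obtain \<phi> where e: "extension R N M e" "extension R N M (ext_trivial N M)"
    and \<phi>: "\<phi> \<in> lmod_hom R (lmod_sum N M) (mid e)"
      "\<forall>t\<in>carrier N \<times> carrier M. prj e (\<phi> t) = snd t"
    using assms by (auto simp: ext_iso_def lmod_iso_def ext_trivial_def)
  interpret N: left_module R N using extensionD[OF e(1)] by simp
  interpret M: left_module R M using extensionD[OF e(1)] by simp
  have "(\<lambda>m. (\<zero>\<^bsub>N\<^esub>, m)) \<in> lmod_hom R M (lmod_sum N M)" by (rule lmod_homI) auto
  from lmod_hom_comp[OF this \<phi>(1)] show ?thesis
    using \<phi>(2) e(1) unfolding ext_split_def by (intro conjI bexI[of _ "\<lambda>m. \<phi> (\<zero>\<^bsub>N\<^esub>, m)"]) auto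
qed

subsection \<open>The Baer sum\<close>

lemma ext_sum_extension:
  assumes e: "extension R N M e" and e': "extension R N' M' e'"
  shows "extension R (lmod_sum N N') (lmod_sum M M') (ext_sum e e')"
proof -
  note E = extensionD[OF e] and E' = extensionD[OF e']
  interpret N: left_module R N by (rule E)
  interpret M: left_module R M by (rule E)
  interpret T: left_module R "mid e" by (rule E)
  interpret N': left_module R N' by (rule E')
  interpret M': left_module R M' by (rule E')
  interpret T': left_module R "mid e'" by (rule E')
  note h = lmod_homD[OF E(4)] lmod_homD[OF E(5)] lmod_homD[OF E'(4)] lmod_homD[OF E'(5)]
  show ?thesis
  proof (rule extensionI)
    show "left_module R (lmod_sum N N')" "left_module R (lmod_sum M M')"
      "left_module R (mid (ext_sum e e'))"
      using E E' by (auto intro!: lmod_sum_left_module simp: ext_sum_def)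
    show "inc (ext_sum e e') \<in> lmod_hom R (lmod_sum N N') (mid (ext_sum e e'))"
      by (rule lmod_homI) (auto simp: ext_sum_def h)
    show "prj (ext_sum e e') \<in> lmod_hom R (mid (ext_sum e e')) (lmod_sum M M')"
      by (rule lmod_homI) (auto simp: ext_sum_def h)
  next
    fix a assume a: "a \<in> carrier (lmod_sum N N')" "inc (ext_sum e e') a = \<zero>\<^bsub>mid (ext_sum e e')\<^esub>"
    then obtain a1 a2 where [simp]: "a = (a1, a2)" and a12: "a1 \<in> carrier N" "a2 \<in> carrier N'"
      by auto
    have "inc e a1 = inc e \<zero>\<^bsub>N\<^esub>" "inc e' a2 = inc e' \<zero>\<^bsub>N'\<^esub>"
      using a lmod_hom_zero[OF E(4) E(1) E(3)] lmod_hom_zero[OF E'(4) E'(1) E'(3)]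
      by (auto simp: ext_sum_def)
    then show "a = \<zero>\<^bsub>lmod_sum N N'\<^esub>"
      using E(6) E'(6) a12 by (auto dest: inj_onD)
  next
    fix a assume "a \<in> carrier (lmod_sum N N')"
    then show "prj (ext_sum e e') (inc (ext_sum e e') a) = \<zero>\<^bsub>lmod_sum M M'\<^esub>"
      using E(7) E'(7) by (auto simp: ext_sum_def)
  next
    fix t assume t: "t \<in> carrier (mid (ext_sum e e'))" "prj (ext_sum e e') t = \<zero>\<^bsub>lmod_sum M M'\<^esub>"
    then obtain t1 t2 where [simp]: "t = (t1, t2)" and t12: "t1 \<in> carrier (mid e)" "t2 \<in> carrier (mid e')"
      "prj e t1 = \<zero>\<^bsub>M\<^esub>" "prj e' t2 = \<zero>\<^bsub>M'\<^esub>"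
      by (auto simp: ext_sum_def)
    obtain a1 a2 where "a1 \<in> carrier N" "t1 = inc e a1" "a2 \<in> carrier N'" "t2 = inc e' a2"
      using extension_kerE[OF e] extension_kerE[OF e'] t12 by metis
    then show "\<exists>a\<in>carrier (lmod_sum N N'). t = inc (ext_sum e e') a"
      by (intro bexI[of _ "(a1, a2)"]) (auto simp: ext_sum_def)
  next
    fix m assume "m \<in> carrier (lmod_sum M M')"
    then obtain m1 m2 where [simp]: "m = (m1, m2)" and m: "m1 \<in> carrier M" "m2 \<in> carrier M'" by auto
    obtain t1 t2 where "t1 \<in> carrier (mid e)" "prj e t1 = m1" "t2 \<in> carrier (mid e')" "prj e' t2 = m2"
      using extension_surjE[OF e m(1)] extension_surjE[OF e' m(2)] by metis
    then show "\<exists>t\<in>carrier (mid (ext_sum e e')). prj (ext_sum e e') t = m"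
      by (intro bexI[of _ "(t1, t2)"]) (auto simp: ext_sum_def)
  qed
qed

lemma (in left_module) submodule_left_module:
  assumes "H \<subseteq> carrier M" "\<zero>\<^bsub>M\<^esub> \<in> H"
    and "\<And>x y. \<lbrakk>x \<in> H; y \<in> H\<rbrakk> \<Longrightarrow> x \<oplus>\<^bsub>M\<^esub> y \<in> H"
    and "\<And>a x. \<lbrakk>a \<in> carrier R; x \<in> H\<rbrakk> \<Longrightarrow> a \<odot>\<^bsub>M\<^esub> x \<in> H"
  shows "left_module R (M\<lparr>carrier := H\<rparr>)"
proof -
  have sub: "subgroup H (add_monoid M)" using submoduleI[OF assms] by (simp add: Module.submodule_def)
  have H: "x \<in> carrier M" if "x \<in> H" for x using that assms(1) by blast
  show ?thesis
  proof (intro left_module.intro abelian_groupI left_module_axioms.intro)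
    show "ring R" by (rule R.ring_axioms)
    show "\<exists>y\<in>carrier (M\<lparr>carrier := H\<rparr>). y \<oplus>\<^bsub>M\<lparr>carrier := H\<rparr>\<^esub> x = \<zero>\<^bsub>M\<lparr>carrier := H\<rparr>\<^esub>"
      if "x \<in> carrier (M\<lparr>carrier := H\<rparr>)" for x
      using that subgroup.m_inv_closed[OF sub, of x] H[of x]
      by (intro bexI[of _ "\<ominus>\<^bsub>M\<^esub> x"]) (auto simp: M.l_neg a_inv_def[symmetric])
  qed (use assms in \<open>auto simp: H M.a_ac smult_l_distr smult_r_distr smult_assoc1 smult_one\<close>)
qed

lemma ext_pullback_extension:
  assumes e: "extension R N M e" and h: "h \<in> lmod_hom R M' M" and M': "left_module R M'"
  shows "extension R N M' (ext_pullback M' h e)"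
proof -
  note E = extensionD[OF e]
  interpret N: left_module R N by (rule E)
  interpret M: left_module R M by (rule E)
  interpret T: left_module R "mid e" by (rule E)
  interpret M': left_module R M' by (rule M')
  interpret S: left_module R "lmod_sum (mid e) M'" by (rule lmod_sum_left_module[OF E(3) M'])
  note map_facts = lmod_homD[OF E(4)] lmod_homD[OF E(5)] lmod_homD[OF h]
    lmod_hom_zero[OF E(4) E(1) E(3)] lmod_hom_zero[OF E(5) E(3) E(2)] lmod_hom_zero[OF h M' E(2)]
  show ?thesis
  proof (rule extensionI)
    show "left_module R (mid (ext_pullback M' h e))"
      unfolding ext_pullback_def extn.simps
      by (rule S.submodule_left_module) (auto simp: map_facts T.smult_closed M'.smult_closed)
    show "inc (ext_pullback M' h e) \<in> lmod_hom R N (mid (ext_pullback M' h e))"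
      by (rule lmod_homI) (auto simp: ext_pullback_def map_facts E(7))
    show "prj (ext_pullback M' h e) \<in> lmod_hom R (mid (ext_pullback M' h e)) M'"
      by (rule lmod_homI) (auto simp: ext_pullback_def)
  next
    fix a assume "a \<in> carrier N" "inc (ext_pullback M' h e) a = \<zero>\<^bsub>mid (ext_pullback M' h e)\<^esub>"
    then show "a = \<zero>\<^bsub>N\<^esub>"
      using E(6) map_facts(10) inj_onD[OF E(6), of a "\<zero>\<^bsub>N\<^esub>"] by (simp add: ext_pullback_def)
  next
    fix t assume "t \<in> carrier (mid (ext_pullback M' h e))" "prj (ext_pullback M' h e) t = \<zero>\<^bsub>M'\<^esub>"
    then obtain t1 where t: "t = (t1, \<zero>\<^bsub>M'\<^esub>)" "t1 \<in> carrier (mid e)" "prj e t1 = \<zero>\<^bsub>M\<^esub>"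
      by (auto simp: ext_pullback_def map_facts)
    then obtain a where "a \<in> carrier N" "t1 = inc e a" using extension_kerE[OF e] by metis
    then show "\<exists>a\<in>carrier N. t = inc (ext_pullback M' h e) a"
      using t by (auto simp: ext_pullback_def)
  next
    fix m assume m: "m \<in> carrier M'"
    then obtain t where "t \<in> carrier (mid e)" "prj e t = h m"
      using extension_surjE[OF e, of "h m"] map_facts by metis
    then show "\<exists>t\<in>carrier (mid (ext_pullback M' h e)). prj (ext_pullback M' h e) t = m"
      using m by (intro bexI[of _ "(t, m)"]) (auto simp: ext_pullback_def)
  qed (use E M' in \<open>auto simp: ext_pullback_def\<close>)
qed

text \<open>The middle term of the pushout is the quotient of \<open>dsum\<close> by the submodule \<open>glue\<close>, which identifies
  \<open>(h a, 0)\<close> with \<open>(0, inc e a)\<close>; \<open>cls\<close> is the quotient map.\<close>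

locale pushout_data =
  fixes R :: "'d ring" and N :: "('d, 'n) module" and M :: "('d, 'm) module"
    and e :: "('d, 'n, 'm, 't) extn" and N' :: "('d, 'n1) module" and h
  assumes e: "extension R N M e" and h: "h \<in> lmod_hom R N N'" and N': "left_module R N'"
begin

sublocale N: left_module R N by (rule extensionD[OF e])
sublocale M: left_module R M by (rule extensionD[OF e])
sublocale T: left_module R "mid e" by (rule extensionD[OF e])
sublocale N': left_module R N' by (rule N')

definition "dsum = lmod_sum N' (mid e)"
definition "glue = (\<lambda>a. (h a, \<ominus>\<^bsub>mid e\<^esub> (inc e a))) ` carrier N"

lemmas E = extensionD[OF e]

lemma map_facts: "x \<in> carrier N \<Longrightarrow> inc e x \<in> carrier (mid e)" "t \<in> carrier (mid e) \<Longrightarrow> prj e t \<in> carrier M"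
  "x \<in> carrier N \<Longrightarrow> h x \<in> carrier N'"
  "h \<zero>\<^bsub>N\<^esub> = \<zero>\<^bsub>N'\<^esub>" "inc e \<zero>\<^bsub>N\<^esub> = \<zero>\<^bsub>mid e\<^esub>" "prj e \<zero>\<^bsub>mid e\<^esub> = \<zero>\<^bsub>M\<^esub>"
  using lmod_homD(1)[OF E(4)] lmod_homD(1)[OF E(5)] lmod_homD(1)[OF h]
    lmod_hom_zero[OF E(4) E(1) E(3)] lmod_hom_zero[OF E(5) E(3) E(2)] lmod_hom_zero[OF h E(1) N']
  by auto

sublocale S: left_module R dsum
  unfolding dsum_def by (rule lmod_sum_left_module[OF N' E(3)])

sublocale Q: lmod_subm R dsum glue
proof (intro lmod_subm.intro lmod_subm_axioms.intro S.left_module_axioms S.submoduleI)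
  show "glue \<subseteq> carrier dsum" by (auto simp: glue_def dsum_def map_facts)
  show "\<zero>\<^bsub>dsum\<^esub> \<in> glue" by (auto simp: glue_def dsum_def map_facts intro!: image_eqI[of _ _ "\<zero>\<^bsub>N\<^esub>"])
next
  fix x y assume "x \<in> glue" "y \<in> glue"
  then obtain a b where ab: "a \<in> carrier N" "x = (h a, \<ominus>\<^bsub>mid e\<^esub> (inc e a))"
    "b \<in> carrier N" "y = (h b, \<ominus>\<^bsub>mid e\<^esub> (inc e b))" by (auto simp: glue_def)
  then have "x \<oplus>\<^bsub>dsum\<^esub> y = (h (a \<oplus>\<^bsub>N\<^esub> b), \<ominus>\<^bsub>mid e\<^esub> (inc e (a \<oplus>\<^bsub>N\<^esub> b)))"
    using lmod_homD(2)[OF E(4)] lmod_homD(2)[OF h]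
    by (simp add: dsum_def T.M.minus_add map_facts)
  then show "x \<oplus>\<^bsub>dsum\<^esub> y \<in> glue" using ab by (auto simp: glue_def)
next
  fix c x assume c: "c \<in> carrier R" and "x \<in> glue"
  then obtain a where a: "a \<in> carrier N" "x = (h a, \<ominus>\<^bsub>mid e\<^esub> (inc e a))" by (auto simp: glue_def)
  then have "c \<odot>\<^bsub>dsum\<^esub> x = (h (c \<odot>\<^bsub>N\<^esub> a), \<ominus>\<^bsub>mid e\<^esub> (inc e (c \<odot>\<^bsub>N\<^esub> a)))"
    using lmod_homD(3)[OF E(4)] lmod_homD(3)[OF h] c
    by (simp add: dsum_def T.smult_neg map_facts)
  then show "c \<odot>\<^bsub>dsum\<^esub> x \<in> glue" using a c N.smult_closed by (auto simp: glue_def)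
qed

abbreviation "cls x \<equiv> glue +>\<^bsub>dsum\<^esub> x"
abbreviation "P \<equiv> ext_pushout N N' h e"

lemma mid_P: "mid P = lmod_quot dsum glue"
  and inc_P: "inc P a = cls (a, \<zero>\<^bsub>mid e\<^esub>)"
  by (simp_all add: ext_pushout_def Let_def dsum_def glue_def)

text \<open>The projection of the pushout takes the common value of \<open>prj e\<close> on a coset: elements of \<open>glue\<close> have
  second component in the image of \<open>inc e\<close>, which \<open>prj e\<close> kills.\<close>

lemma prj_P:
  assumes "a \<in> carrier N'" "t \<in> carrier (mid e)" shows "prj P (cls (a, t)) = prj e t"
proof -
  have "(case p of (a', t') \<Rightarrow> prj e t') = prj e t" if p: "p \<in> cls (a, t)" for p
  proof -
    obtain a' t' where [simp]: "p = (a', t')" by fastforce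
    note t' = p[simplified]
    obtain b where b: "b \<in> carrier N" "t' = \<ominus>\<^bsub>mid e\<^esub> (inc e b) \<oplus>\<^bsub>mid e\<^esub> t"
      using t' by (auto simp: a_r_coset_def' glue_def dsum_def)
    then show ?thesis
      using assms lmod_homD(2)[OF E(5)] lmod_hom_neg[OF E(5) E(3) E(2)] E(7) map_facts
      by (simp)
  qed
  then have "(\<lambda>(a, t). prj e t) ` cls (a, t) = (\<lambda>_. prj e t) ` cls (a, t)" by (rule image_cong[OF refl])
  moreover have "(a, t) \<in> cls (a, t)" using Q.K.a_rcos_self assms by (simp add: dsum_def)
  ultimately have "(\<lambda>(a, t). prj e t) ` cls (a, t) = {prj e t}" by (simp only: image_constant)
  then show ?thesis by (simp add: ext_pushout_def Let_def dsum_def glue_def)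
qed

lemma in_dsum: "x \<in> carrier dsum \<longleftrightarrow> (\<exists>a t. x = (a, t) \<and> a \<in> carrier N' \<and> t \<in> carrier (mid e))"
  by (auto simp: dsum_def)

lemma dsum_ops: "(a, t) \<oplus>\<^bsub>dsum\<^esub> (b, s) = (a \<oplus>\<^bsub>N'\<^esub> b, t \<oplus>\<^bsub>mid e\<^esub> s)"
  "c \<odot>\<^bsub>dsum\<^esub> (a, t) = (c \<odot>\<^bsub>N'\<^esub> a, c \<odot>\<^bsub>mid e\<^esub> t)" "\<zero>\<^bsub>dsum\<^esub> = (\<zero>\<^bsub>N'\<^esub>, \<zero>\<^bsub>mid e\<^esub>)"
  by (simp_all add: dsum_def)

lemma mid_PE:
  assumes "X \<in> carrier (mid P)"
  obtains a t where "a \<in> carrier N'" "t \<in> carrier (mid e)" "X = cls (a, t)"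
  using assms by (auto simp: mid_P Q.quot_carrier in_dsum)

lemma cls_eq:
  assumes "a \<in> carrier N'" "b \<in> carrier N"
  shows "cls (a, inc e b) = cls (a \<oplus>\<^bsub>N'\<^esub> h b, \<zero>\<^bsub>mid e\<^esub>)"
proof -
  have "a \<oplus>\<^bsub>N'\<^esub> h b \<oplus>\<^bsub>N'\<^esub> \<ominus>\<^bsub>N'\<^esub> a = h b \<oplus>\<^bsub>N'\<^esub> (a \<oplus>\<^bsub>N'\<^esub> \<ominus>\<^bsub>N'\<^esub> a)"
    using N'.M.a_comm[of a "h b"] N'.M.a_assoc[of "h b" a "\<ominus>\<^bsub>N'\<^esub> a"] assms map_facts by simp
  then have "(a \<oplus>\<^bsub>N'\<^esub> h b, \<zero>\<^bsub>mid e\<^esub>) \<ominus>\<^bsub>dsum\<^esub> (a, inc e b) = (h b, \<ominus>\<^bsub>mid e\<^esub> inc e b)"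
    using assms by (simp add: a_minus_def dsum_def lmod_sum_neg[OF N' E(3)] map_facts N'.M.r_neg)
  also have "\<dots> \<in> glue" using assms by (auto simp: glue_def)
  finally show ?thesis
    using Q.coset_eq_iff[of "(a \<oplus>\<^bsub>N'\<^esub> h b, \<zero>\<^bsub>mid e\<^esub>)" "(a, inc e b)"] assms
    by (simp add: in_dsum map_facts)
qed

lemma pushout_extension: "extension R N' M P"
proof (rule extensionI)
  show "left_module R (mid P)" unfolding mid_P by (rule Q.quot_left_module)
  show "inc P \<in> lmod_hom R N' (mid P)"
    by (rule lmod_homI) (auto simp: inc_P mid_P Q.coset_closed Q.coset_add Q.coset_smult in_dsum dsum_ops simp del: lmod_sum_simps)
  show "prj P \<in> lmod_hom R (mid P) M"
  proof (rule lmod_homI)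
    fix X assume "X \<in> carrier (mid P)"
    then show "prj P X \<in> carrier M" by (elim mid_PE) (simp add: prj_P map_facts)
  next
    fix X Y assume "X \<in> carrier (mid P)" "Y \<in> carrier (mid P)"
    then obtain a t b s where ab: "a \<in> carrier N'" "t \<in> carrier (mid e)" "X = cls (a, t)"
      "b \<in> carrier N'" "s \<in> carrier (mid e)" "Y = cls (b, s)" by (meson mid_PE)
    have "X \<oplus>\<^bsub>mid P\<^esub> Y = cls (a \<oplus>\<^bsub>N'\<^esub> b, t \<oplus>\<^bsub>mid e\<^esub> s)"
      using ab Q.coset_add[of "(a, t)" "(b, s)"] by (simp add: mid_P in_dsum dsum_ops)
    then show "prj P (X \<oplus>\<^bsub>mid P\<^esub> Y) = prj P X \<oplus>\<^bsub>M\<^esub> prj P Y"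
      using ab lmod_homD(2)[OF E(5)] by (simp add: prj_P)
  next
    fix c X assume c: "c \<in> carrier R" and "X \<in> carrier (mid P)"
    then obtain a t where a: "a \<in> carrier N'" "t \<in> carrier (mid e)" "X = cls (a, t)" by (meson mid_PE)
    have "c \<odot>\<^bsub>mid P\<^esub> X = cls (c \<odot>\<^bsub>N'\<^esub> a, c \<odot>\<^bsub>mid e\<^esub> t)"
      using a c Q.coset_smult[of c "(a, t)"] by (simp add: mid_P in_dsum dsum_ops)
    then show "prj P (c \<odot>\<^bsub>mid P\<^esub> X) = c \<odot>\<^bsub>M\<^esub> prj P X"
      using a c lmod_homD(3)[OF E(5)] N'.smult_closed T.smult_closed by (simp add: prj_P)
  qed
next
  fix a assume a: "a \<in> carrier N'" "inc P a = \<zero>\<^bsub>mid P\<^esub>"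
  then have "cls (a, \<zero>\<^bsub>mid e\<^esub>) = cls (\<zero>\<^bsub>N'\<^esub>, \<zero>\<^bsub>mid e\<^esub>)"
    using Q.quot_zero by (simp add: inc_P mid_P dsum_ops)
  then have "(a, \<zero>\<^bsub>mid e\<^esub>) \<ominus>\<^bsub>dsum\<^esub> (\<zero>\<^bsub>N'\<^esub>, \<zero>\<^bsub>mid e\<^esub>) \<in> glue"
    using Q.coset_eq_iff[of "(a, \<zero>\<^bsub>mid e\<^esub>)" "(\<zero>\<^bsub>N'\<^esub>, \<zero>\<^bsub>mid e\<^esub>)"] a by (simp add: in_dsum)
  then have "(a, \<zero>\<^bsub>mid e\<^esub>) \<in> glue"
    using a by (simp add: dsum_def a_minus_def lmod_sum_neg[OF N' E(3)])
  then obtain b where b: "b \<in> carrier N" "a = h b" "\<zero>\<^bsub>mid e\<^esub> = \<ominus>\<^bsub>mid e\<^esub> (inc e b)"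
    by (auto simp: glue_def)
  then have "inc e b = inc e \<zero>\<^bsub>N\<^esub>"
    using map_facts T.M.minus_minus[of "inc e b"] by (metis T.neg_zero)
  then have "b = \<zero>\<^bsub>N\<^esub>" using E(6) b(1) by (auto dest: inj_onD)
  then show "a = \<zero>\<^bsub>N'\<^esub>" using b(2) map_facts(4) by simp
next
  fix X assume X: "X \<in> carrier (mid P)" "prj P X = \<zero>\<^bsub>M\<^esub>"
  then obtain a t where a: "a \<in> carrier N'" "t \<in> carrier (mid e)" "X = cls (a, t)" by (meson mid_PE)
  then obtain b where b: "b \<in> carrier N" "t = inc e b"
    using X extension_kerE[OF e, of t] by (auto simp: prj_P)
  have "X = inc P (a \<oplus>\<^bsub>N'\<^esub> h b)" using a b cls_eq by (simp add: inc_P)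
  then show "\<exists>a\<in>carrier N'. X = inc P a" using a b map_facts by blast
next
  fix m assume m: "m \<in> carrier M"
  then obtain t where t: "t \<in> carrier (mid e)" "prj e t = m" using extension_surjE[OF e] by metis
  then show "\<exists>t\<in>carrier (mid P). prj P t = m"
    by (intro bexI[of _ "cls (\<zero>\<^bsub>N'\<^esub>, t)"]) (auto simp: prj_P mid_P Q.coset_closed in_dsum)
qed (use E N' in \<open>auto simp: inc_P prj_P map_facts\<close>)

end

text \<open>The diagonal of \<open>M\<close> and the codiagonal of \<open>N\<close> are homomorphisms, so both steps in the construction
  of the Baer sum produce extensions.\<close>

lemma baer_sum_extension:
  assumes e: "extension R N M e" and e': "extension R N M e'"
  shows "pushout_data R (lmod_sum N N) M (ext_pullback M (\<lambda>m. (m, m)) (ext_sum e e')) N (\<lambda>(a, b). a \<oplus>\<^bsub>N\<^esub> b)"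
proof -
  interpret N: left_module R N by (rule extensionD[OF e])
  interpret M: left_module R M by (rule extensionD[OF e])
  have "(\<lambda>m. (m, m)) \<in> lmod_hom R M (lmod_sum M M)" by (rule lmod_homI) auto
  then have "extension R (lmod_sum N N) M (ext_pullback M (\<lambda>m. (m, m)) (ext_sum e e'))"
    by (rule ext_pullback_extension[OF ext_sum_extension[OF e e'] _ M.left_module_axioms])
  moreover have "(\<lambda>(a, b). a \<oplus>\<^bsub>N\<^esub> b) \<in> lmod_hom R (lmod_sum N N) N"
    by (rule lmod_homI) (auto simp: N.M.a_ac N.smult_r_distr)
  ultimately show ?thesis by (simp add: pushout_data_def N.left_module_axioms)
qed

section \<open>The free algebra and its representations\<close>

lemma free_alg_sum_induct [case_names zero single add]:
  assumes "P 0" "\<And>w c. P (Poly_Mapping.single w c)" "\<And>p q. \<lbrakk>P p; P q\<rbrakk> \<Longrightarrow> P (p + q)"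
  shows "P (p :: 'k::field free_alg)"
proof (induction p rule: update_induct)
  case (update f a b)
  have "Poly_Mapping.update a b f = Poly_Mapping.single a b + f"
    using update(1) by (intro poly_mapping_eqI) (auto simp: lookup_update lookup_add lookup_single when_def in_keys_iff)
  then show ?case using update assms by simp
qed (use assms in simp)

lemma single_Word_Cons: "Poly_Mapping.single (Word (a # ws)) c = gen a * Poly_Mapping.single (Word ws) (c :: 'k::field)"
  by (simp add: gen_def mult_single plus_dword_def)

text \<open>Scalars and generators generate the free algebra under sums and products, so two actions that
  agree on them are equal.\<close>

lemma free_alg_induct [case_names scal gen add mult]:
  assumes "\<And>c. P (scal c)" "\<And>a. P (gen a)" "\<And>p q. \<lbrakk>P p; P q\<rbrakk> \<Longrightarrow> P (p + q)"
    "\<And>p q. \<lbrakk>P p; P q\<rbrakk> \<Longrightarrow> P (p * q)"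
  shows "P (p :: 'k::field free_alg)"
proof -
  have word: "P (Poly_Mapping.single (Word ws) c)" for ws c
  proof (induction ws)
    case Nil
    then show ?case using assms(1)[of c] by (simp add: scal_def zero_dword_def)
  qed (auto simp: single_Word_Cons assms)
  show ?thesis
  proof (induction p rule: free_alg_sum_induct)
    case zero
    then show ?case using assms(1)[of 0] by (simp add: scal_def)
  next
    case (single w c)
    then show ?case using word[of "letters w"] by simp
  qed (rule assms)
qed

lemma scal_simps: "scal (c + d) = scal c + scal d" "scal (c * d) = scal c * scal d" "scal 1 = 1"
  "scal 0 = 0" "scal (c - d) = scal c - scal d" "scal (- c) = - scal c"
  by (simp_all add: scal_def single_add single_diff single_uminus mult_single)

lemma scal_numeral: "scal (numeral k) = numeral k"
  by (simp add: scal_def)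

lemma scal_of_nat: "scal (of_nat k) = of_nat k"
  by (induction k) (simp_all add: scal_simps)

lemma scal_commute: "p * scal c = scal c * (p :: 'k::field free_alg)"
proof (induction p rule: free_alg_sum_induct)
  case (single w d)
  then show ?case by (simp add: scal_def mult_single mult.commute)
qed (auto simp: algebra_simps)

text \<open>Operators \<open>\<rho>\<close> for the generators are linear on a whole type, but are meant to satisfy the relations
  only on the subspace \<open>V\<close>: the coordinate operators below truncate outside of the coordinate range.\<close>

locale gen_rep =
  fixes s :: "'k::field \<Rightarrow> 'v::ab_group_add \<Rightarrow> 'v" and \<rho> :: "dgen \<Rightarrow> 'v \<Rightarrow> 'v" and V :: "'v set"
  assumes s_add: "s c (v + w) = s c v + s c w"
    and s_add_left: "s (c + d) v = s c v + s d v"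
    and s_mult: "s (c * d) v = s c (s d v)"
    and s_one: "s 1 v = v"
    and \<rho>_add: "\<rho> a (v + w) = \<rho> a v + \<rho> a w"
    and \<rho>_s: "\<rho> a (s c v) = s c (\<rho> a v)"
    and V_zero: "0 \<in> V"
    and V_add: "\<lbrakk>v \<in> V; w \<in> V\<rbrakk> \<Longrightarrow> v + w \<in> V"
    and V_s: "v \<in> V \<Longrightarrow> s c v \<in> V"
    and V_\<rho>: "v \<in> V \<Longrightarrow> \<rho> a v \<in> V"
begin

definition act :: "'k free_alg \<Rightarrow> 'v \<Rightarrow> 'v" where
  "act p v = (\<Sum>w\<in>Poly_Mapping.keys p. s (Poly_Mapping.lookup p w) (foldr \<rho> (letters w) v))"

lemma s_zero_left [simp]: "s 0 v = 0" using s_add_left[of 0 0 v] by simp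
lemma s_zero [simp]: "s c 0 = 0" using s_add[of c 0 0] by simp
lemma \<rho>_zero [simp]: "\<rho> a 0 = 0" using \<rho>_add[of a 0 0] by simp
lemma s_minus_one: "s (-1) v = - v" using s_add_left[of "-1" 1 v] s_one by (simp add: eq_neg_iff_add_eq_0)

lemma foldr_add: "foldr \<rho> ws (v + w) = foldr \<rho> ws v + foldr \<rho> ws w"
  by (induction ws) (simp_all add: \<rho>_add)

lemma foldr_s: "foldr \<rho> ws (s c v) = s c (foldr \<rho> ws v)"
  by (induction ws) (simp_all add: \<rho>_s)

lemma foldr_V: "v \<in> V \<Longrightarrow> foldr \<rho> ws v \<in> V"
  by (induction ws) (simp_all add: V_\<rho>)

lemma act_superset:
  assumes "finite A" "Poly_Mapping.keys p \<subseteq> A"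
  shows "act p v = (\<Sum>w\<in>A. s (Poly_Mapping.lookup p w) (foldr \<rho> (letters w) v))"
  unfolding act_def using assms by (intro sum.mono_neutral_left) (auto simp: in_keys_iff)

lemma act_add: "act (p + q) v = act p v + act q v"
proof -
  let ?A = "Poly_Mapping.keys p \<union> Poly_Mapping.keys q"
  have "act (p + q) v = (\<Sum>w\<in>?A. s (Poly_Mapping.lookup (p + q) w) (foldr \<rho> (letters w) v))"
    using Poly_Mapping.keys_add[of p q] by (intro act_superset) auto
  moreover have "act p v = (\<Sum>w\<in>?A. s (Poly_Mapping.lookup p w) (foldr \<rho> (letters w) v))"
    by (intro act_superset) auto
  moreover have "act q v = (\<Sum>w\<in>?A. s (Poly_Mapping.lookup q w) (foldr \<rho> (letters w) v))"
    by (intro act_superset) auto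
  ultimately show ?thesis by (simp add: lookup_add s_add_left sum.distrib)
qed

lemma act_single: "act (Poly_Mapping.single w c) v = s c (foldr \<rho> (letters w) v)"
  by (subst act_superset[of "{w}"]) auto

lemma act_0 [simp]: "act 0 v = 0"
  by (simp add: act_def)

lemma act_v_add: "act p (v + w) = act p v + act p w"
  by (induction p rule: free_alg_sum_induct) (simp_all add: act_single act_add foldr_add s_add)

lemma act_v_s: "act p (s c v) = s c (act p v)"
  by (induction p rule: free_alg_sum_induct)
    (simp_all add: act_single act_add foldr_s s_add s_mult[symmetric] mult.commute)

lemma act_V: "v \<in> V \<Longrightarrow> act p v \<in> V"
  by (induction p rule: free_alg_sum_induct) (simp_all add: act_single act_add foldr_V V_add V_s V_zero)

lemma act_v_0 [simp]: "act p 0 = 0" using act_v_add[of p 0 0] by simp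

lemma act_scal: "act (scal c) v = s c v"
  by (simp add: scal_def act_single zero_dword_def)

lemma act_gen: "act (gen a) v = \<rho> a v"
  by (simp add: gen_def act_single s_one)

lemma act_one: "act 1 v = v"
  using act_scal[of 1] by (simp add: scal_simps s_one)

lemma foldr_act: "act (Poly_Mapping.single w c * q) v = s c (foldr \<rho> (letters w) (act q v))"
proof (induction q rule: free_alg_sum_induct)
  case zero
  have "foldr \<rho> ws 0 = 0" for ws by (induction ws) simp_all
  then show ?case by simp
next
  case (single u d)
  then show ?case by (simp add: mult_single act_single plus_dword_def s_mult foldr_s)
qed (simp add: distrib_left act_add foldr_add s_add)

lemma act_mult: "act (p * q) v = act p (act q v)"
  by (induction p rule: free_alg_sum_induct) (simp_all add: foldr_act act_single distrib_right act_add)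

lemma act_uminus: "act (- p) v = - act p v"
  using act_add[of p "-p" v] by (simp add: eq_neg_iff_add_eq_0 add.commute)

lemma act_diff: "act (p - q) v = act p v - act q v"
  using act_add[of "p - q" q v] by simp

lemma act_numeral: "act (numeral k) v = s (numeral k) v"
  using act_scal[of "numeral k"] by (simp add: scal_numeral)

lemmas act_simps = act_add act_diff act_mult act_scal act_gen act_one act_numeral power2_eq_square

end

subsection \<open>The double as a ring\<close>

lemma double_ideal: "ideal double_ideal (class_ring :: 'k::field free_alg ring)"
  unfolding double_ideal_def by (rule ring.genideal_ideal[OF class_ring.ring_axioms]) simp

lemma double_ideal_add: "\<lbrakk>p \<in> double_ideal; q \<in> double_ideal\<rbrakk> \<Longrightarrow> p + q \<in> double_ideal"
  using additive_subgroup.a_closed[OF ideal.axioms(1)[OF double_ideal]] by simp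

lemma double_ideal_lmult: "q \<in> double_ideal \<Longrightarrow> p * q \<in> double_ideal"
  using ideal.I_l_closed[OF double_ideal] by simp

lemma double_ideal_rmult: "q \<in> double_ideal \<Longrightarrow> q * p \<in> double_ideal"
  using ideal.I_r_closed[OF double_ideal] by simp

lemma double_ideal_zero: "0 \<in> double_ideal"
  using additive_subgroup.zero_closed[OF ideal.axioms(1)[OF double_ideal]] by simp

lemma double_ideal_uminus: "p \<in> double_ideal \<Longrightarrow> - p \<in> (double_ideal :: 'k::field free_alg set)"
  using double_ideal_lmult[of p "-1"] by simp

lemma double_ideal_diff: "\<lbrakk>p \<in> double_ideal; q \<in> double_ideal\<rbrakk> \<Longrightarrow> p - q \<in> (double_ideal :: 'k::field free_alg set)"
  using double_ideal_add[of p "- q"] double_ideal_uminus[of q] by simp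

lemma double_rels_sub: "double_rels \<subseteq> (double_ideal :: 'k::field free_alg set)"
  unfolding double_ideal_def by (rule ring.genideal_self[OF class_ring.ring_axioms]) simp

lemma dbl_coset: "dbl p = {q + p | q. q \<in> double_ideal}"
  by (auto simp: dbl_def a_r_coset_def')

lemma dbl_self: "p \<in> dbl p"
  using double_ideal_zero by (force simp: dbl_coset)

lemma dbl_eq_iff: "dbl p = dbl q \<longleftrightarrow> p - q \<in> (double_ideal :: 'k::field free_alg set)"
proof
  assume "dbl p = dbl q"
  then have "p \<in> dbl q" using dbl_self[of p] by simp
  then show "p - q \<in> double_ideal" by (auto simp: dbl_coset)
next
  assume pq: "p - q \<in> double_ideal"
  have "r + p = (r + (p - q)) + q" "r + q = (r - (p - q)) + p" for r by simp_all
  then show "dbl p = dbl q"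
    using double_ideal_add[OF _ pq] double_ideal_diff[OF _ pq] unfolding dbl_coset by blast
qed

lemma ring_jordan_double: "ring (jordan_double :: 'k::field double ring)"
  unfolding jordan_double_def by (rule ideal.quotient_is_ring[OF double_ideal])

lemma carrier_jordan_double: "carrier jordan_double = range (dbl :: 'k::field free_alg \<Rightarrow> _)"
  by (auto simp: jordan_double_def FactRing_def A_RCOSETS_def' dbl_def a_r_coset_def')

lemma dbl_carrier [simp, intro]: "dbl p \<in> carrier jordan_double"
  by (auto simp: carrier_jordan_double)

lemma dbl_ops:
  fixes p q :: "'k::field free_alg"
  shows "dbl p \<oplus>\<^bsub>jordan_double\<^esub> dbl q = dbl (p + q)" "dbl p \<otimes>\<^bsub>jordan_double\<^esub> dbl q = dbl (p * q)"
    "\<one>\<^bsub>jordan_double\<^esub> = dbl (1 :: 'k free_alg)" "\<zero>\<^bsub>jordan_double\<^esub> = dbl (0 :: 'k free_alg)"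
proof -
  have h: "dbl \<in> Ring.ring_hom (class_ring :: 'k free_alg ring) jordan_double"
    unfolding jordan_double_def dbl_def[abs_def] by (rule ideal.rcos_ring_hom[OF double_ideal])
  show "dbl p \<oplus>\<^bsub>jordan_double\<^esub> dbl q = dbl (p + q)" using Ring.ring_hom_add[OF h] by simp
  show "dbl p \<otimes>\<^bsub>jordan_double\<^esub> dbl q = dbl (p * q)" using Ring.ring_hom_mult[OF h] by simp
  show "\<one>\<^bsub>jordan_double\<^esub> = dbl (1 :: 'k free_alg)" using Ring.ring_hom_one[OF h] by simp
  have "\<zero>\<^bsub>jordan_double\<^esub> = (double_ideal :: 'k free_alg set)"
    by (simp add: jordan_double_def FactRing_def)
  then show "\<zero>\<^bsub>jordan_double\<^esub> = dbl (0 :: 'k free_alg)" by (auto simp: dbl_coset)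
qed

context gen_rep
begin

text \<open>The elements acting as zero on \<open>V\<close> form a two-sided ideal, because \<open>V\<close> is stable under the action.\<close>

lemma act_double_ideal:
  assumes rels: "\<And>p v. \<lbrakk>p \<in> double_rels; v \<in> V\<rbrakk> \<Longrightarrow> act p v = 0"
    and "p \<in> double_ideal" "v \<in> V"
  shows "act p v = 0"
proof -
  let ?I = "{p. \<forall>v\<in>V. act p v = 0}"
  have inv: "inv\<^bsub>add_monoid (class_ring :: 'k free_alg ring)\<^esub> p = - p" for p
    unfolding a_inv_def[symmetric] by (simp only: class_ring_simps)
  have "ideal ?I class_ring"
  proof (rule idealI)
    show "ring (class_ring :: 'k free_alg ring)" by (rule class_ring.ring_axioms)
    show "subgroup ?I (add_monoid (class_ring :: 'k free_alg ring))"
      using inv by (auto simp: subgroup_def act_add act_uminus)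
  qed (auto simp: act_mult act_V)
  then have "double_ideal \<subseteq> ?I"
    unfolding double_ideal_def using rels by (intro ring.genideal_minimal[OF class_ring.ring_axioms]) auto
  then show ?thesis using assms by auto
qed

text \<open>A module over the double may let a class act through an arbitrary representative, as \<open>L n\<close> does,
  as soon as the operators satisfy the defining relations.\<close>

lemma model_left_module:
  fixes M :: "('k double, 'v) module"
  assumes rels: "\<And>p v. \<lbrakk>p \<in> double_rels; v \<in> V\<rbrakk> \<Longrightarrow> act p v = 0"
    and M: "carrier M = V" "\<zero>\<^bsub>M\<^esub> = 0" "add M = (+)"
    and smult: "\<And>d v. v \<in> V \<Longrightarrow> d \<odot>\<^bsub>M\<^esub> v = act (SOME p. p \<in> d) v"
  shows "left_module jordan_double M" and "v \<in> V \<Longrightarrow> dbl p \<odot>\<^bsub>M\<^esub> v = act p v"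
proof -
  have sm: "dbl p \<odot>\<^bsub>M\<^esub> v = act p v" if v: "v \<in> V" for p v
  proof -
    have "(SOME q. q \<in> dbl p) \<in> dbl p" using dbl_self by (rule someI)
    then obtain r where r: "r \<in> double_ideal" "(SOME q. q \<in> dbl p) = r + p" by (auto simp: dbl_coset)
    then show ?thesis using smult[OF v] act_double_ideal[OF rels r(1) v] by (simp add: act_add)
  qed
  then show "v \<in> V \<Longrightarrow> dbl p \<odot>\<^bsub>M\<^esub> v = act p v" .
  show "left_module jordan_double M"
  proof (intro left_module.intro abelian_groupI left_module_axioms.intro)
    show "ring jordan_double" by (rule ring_jordan_double)
    show "\<exists>y\<in>carrier M. y \<oplus>\<^bsub>M\<^esub> x = \<zero>\<^bsub>M\<^esub>" if "x \<in> carrier M" for x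
      using that V_s[of x "-1"] by (intro bexI[of _ "- x"]) (auto simp: M s_minus_one)
  qed (auto simp: M V_zero V_add add.assoc add.commute carrier_jordan_double sm act_V dbl_ops
      act_add act_v_add act_mult act_one)
qed

end

section \<open>An explicit family of extensions\<close>

definition coord_space :: "nat \<Rightarrow> (nat \<Rightarrow> 'k::field) set" where
  "coord_space n = {f. \<forall>i>n. f i = 0}"

definition sfun :: "'k::field \<Rightarrow> (nat \<Rightarrow> 'k) \<Rightarrow> (nat \<Rightarrow> 'k)" where
  "sfun c f = (\<lambda>j. c * f j)"

text \<open>In these coordinate forms the relations become identities between polynomials in the index. In the
  clause for \<open>Dv\<close> the coefficient vanishes at \<open>j = n\<close>, so the value \<open>f (Suc n)\<close> does not enter.\<close>

lemma L_op_coords: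
  "L_op n Dxi f = (\<lambda>j. if j \<le> n then (of_nat n - 2 * of_nat j) * f j else 0)"
  "L_op n Dv f = (\<lambda>j. if j \<le> n then (of_nat j + 1) * (of_nat n - of_nat j) / 2 * f (Suc j) else (0 :: 'k::field_char_0))"
  "L_op n Dy f = (\<lambda>j. if 0 < j \<and> j \<le> n then f (j - 1) else 0)"
  "L_op n Dx f = (\<lambda>j. 0)" "L_op n Du f = (\<lambda>j. 0)"
  "L_op n Dg f = (\<lambda>j. if j \<le> n then f j else 0)"
  "L_op n Dginv f = (\<lambda>j. if j \<le> n then f j else 0)"
proof -
  show "L_op n Dxi f = (\<lambda>j. if j \<le> n then (of_nat n - 2 * of_nat j) * f j else 0)"
    by (rule ext) (simp add: L_op_def zL_def if_distrib[of "\<lambda>x. _ * x"] cong: if_cong)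
  show "L_op n Dv f = (\<lambda>j. if j \<le> n then (of_nat j + 1) * (of_nat n - of_nat j) / 2 * f (Suc j) else (0 :: 'k))"
  proof
    fix j
    have "L_op n Dv f j = (\<Sum>i\<le>n. if i = Suc j then of_nat (i * (n - i + 1)) / 2 * f i else 0)"
      unfolding L_op_def
    proof (rule sum.cong[OF refl])
      fix i assume "i \<in> {..n}"
      then show "f i * L_gen n Dv i j = (if i = Suc j then of_nat (i * (n - i + 1)) / 2 * f i else 0)"
        by (cases i) (auto simp: zL_def)
    qed
    also have "\<dots> = (if Suc j \<le> n then of_nat (Suc j * (n - Suc j + 1)) / 2 * f (Suc j) else 0)"
      by (simp add: sum.delta')
    also have "\<dots> = (if j \<le> n then (of_nat j + 1) * (of_nat n - of_nat j) / 2 * f (Suc j) else 0)"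
    proof (cases "Suc j \<le> n")
      case True
      then have "of_nat (Suc j * (n - Suc j + 1)) = (of_nat j + 1) * (of_nat n - of_nat j :: 'k)"
        by (simp only: of_nat_mult of_nat_add of_nat_diff) simp
      with True show ?thesis by (simp del: of_nat_mult)
    qed (auto simp: not_less_eq_eq le_Suc_eq)
    finally show "L_op n Dv f j = (if j \<le> n then (of_nat j + 1) * (of_nat n - of_nat j) / 2 * f (Suc j) else 0)" .
  qed
  show "L_op n Dy f = (\<lambda>j. if 0 < j \<and> j \<le> n then f (j - 1) else 0)"
  proof
    fix j
    have "L_op n Dy f j = (\<Sum>i\<le>n. if 0 < j \<and> j \<le> n \<and> i = j - 1 then f i else 0)"
      unfolding L_op_def by (rule sum.cong) (auto simp: zL_def)
    then show "L_op n Dy f j = (if 0 < j \<and> j \<le> n then f (j - 1) else 0)"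
      by (cases "0 < j \<and> j \<le> n") auto
  qed
qed (auto simp: L_op_def zL_def if_distrib[of "\<lambda>x. _ * x"] cong: if_cong)

lemma sum_fun_apply: "(\<Sum>i\<in>A. f i) j = (\<Sum>i\<in>A. f i (j :: nat) :: 'k::field)"
  by (induction A rule: infinite_finite_induct) auto

interpretation Lrep: gen_rep sfun "L_op n :: dgen \<Rightarrow> (nat \<Rightarrow> 'k::field_char_0) \<Rightarrow> _" "coord_space n" for n
proof
  fix a :: dgen and v w :: "nat \<Rightarrow> 'k" and c
  show "L_op n a (v + w) = L_op n a v + L_op n a w"
    by (cases a) (auto simp: L_op_coords fun_eq_iff distrib_left)
  show "L_op n a (sfun c v) = sfun c (L_op n a v)"
    by (cases a) (auto simp: L_op_coords sfun_def fun_eq_iff algebra_simps)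
  show "L_op n a v \<in> coord_space n" by (cases a) (auto simp: coord_space_def L_op_coords)
qed (auto simp: sfun_def coord_space_def fun_eq_iff algebra_simps)

lemma free_act_L: "free_act (L_op n) p f = Lrep.act n p f"
  by (auto simp: fun_eq_iff free_act_def Lrep.act_def sum_fun_apply sfun_def)

text \<open>The off-diagonal part of the action on \<open>T(n,1)\<close>, in coordinates with respect to the vectors
  \<open>y\<^sup>i x \<cdot> z\<close> and \<open>y\<^sup>k \<cdot> z\<close>. In the cyclic module one computes
  \<open>x y\<^sup>k z = y\<^sup>k x z\<close>,
  \<open>g y\<^sup>k z = y\<^sup>k z + k y\<^sup>k\<^sup>-\<^sup>1 x z\<close>,
  \<open>g\<^sup>-\<^sup>1 y\<^sup>k z = y\<^sup>k z - k y\<^sup>k\<^sup>-\<^sup>1 x z\<close>,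
  \<open>u y\<^sup>k z = - (k (k - 1) / 2) y\<^sup>k\<^sup>-\<^sup>2 x z\<close> and
  \<open>v y\<^sup>k z = (k (n + 3 - k) / 2) y\<^sup>k\<^sup>-\<^sup>1 z + (k (k - 1) (n + 4 - 2 k) / 4) y\<^sup>k\<^sup>-\<^sup>2 x z\<close>;
  the coefficient at index \<open>j\<close> collects the contribution of \<open>k = j\<close>, \<open>j + 1\<close> or \<open>j + 2\<close>.\<close>

definition D_op :: "nat \<Rightarrow> dgen \<Rightarrow> (nat \<Rightarrow> 'k::field) \<Rightarrow> (nat \<Rightarrow> 'k)" where
  "D_op n a h = (\<lambda>j. if j \<le> n then (case a of
      Dx \<Rightarrow> h j
    | Dg \<Rightarrow> (of_nat j + 1) * h (Suc j)
    | Dginv \<Rightarrow> - (of_nat j + 1) * h (Suc j)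
    | Du \<Rightarrow> - (of_nat j + 1) * (of_nat j + 2) / 2 * h (Suc (Suc j))
    | Dv \<Rightarrow> (of_nat j + 1) * (of_nat j + 2) * (of_nat n - 2 * of_nat j) / 4 * h (Suc (Suc j))
    | _ \<Rightarrow> 0) else 0)"

text \<open>The extension of \<open>L (n + 2)\<close> by \<open>L n\<close> with the off-diagonal part scaled by \<open>c\<close>: the first component
  belongs to the submodule, the second to the quotient.\<close>

definition X_op :: "nat \<Rightarrow> 'k::field \<Rightarrow> dgen \<Rightarrow> (nat \<Rightarrow> 'k) \<times> (nat \<Rightarrow> 'k) \<Rightarrow> (nat \<Rightarrow> 'k) \<times> (nat \<Rightarrow> 'k)" where
  "X_op n c a v = (L_op n a (fst v) + sfun c (D_op n a (snd v)), L_op (n + 2) a (snd v))"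

definition sprod :: "'k::field \<Rightarrow> (nat \<Rightarrow> 'k) \<times> (nat \<Rightarrow> 'k) \<Rightarrow> (nat \<Rightarrow> 'k) \<times> (nat \<Rightarrow> 'k)" where
  "sprod c v = (sfun c (fst v), sfun c (snd v))"

interpretation Xrep: gen_rep sprod "X_op n c :: dgen \<Rightarrow> (nat \<Rightarrow> 'k::field_char_0) \<times> _ \<Rightarrow> _"
    "coord_space n \<times> coord_space (n + 2)" for n c
proof
  fix a :: dgen and v w :: "(nat \<Rightarrow> 'k) \<times> (nat \<Rightarrow> 'k)" and d
  have add: "D_op n a (f + h) = D_op n a f + D_op n a h" for f h :: "nat \<Rightarrow> 'k"
    by (cases a) (auto simp: D_op_def fun_eq_iff algebra_simps add_divide_distrib diff_divide_distrib)
  have s: "D_op n a (sfun d f) = sfun d (D_op n a f)" for f :: "nat \<Rightarrow> 'k"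
    by (cases a) (auto simp: D_op_def sfun_def fun_eq_iff)
  show "X_op n c a (v + w) = X_op n c a v + X_op n c a w"
    by (cases v; cases w) (simp add: X_op_def Lrep.\<rho>_add add Lrep.s_add algebra_simps)
  show "X_op n c a (sprod d v) = sprod d (X_op n c a v)"
    by (cases v) (simp add: X_op_def sprod_def Lrep.\<rho>_s s Lrep.s_add Lrep.s_mult[symmetric] mult.commute)
  show "X_op n c a v \<in> coord_space n \<times> coord_space (n + 2)" if "v \<in> coord_space n \<times> coord_space (n + 2)"
  proof -
    have "D_op n a h \<in> coord_space n" for h :: "nat \<Rightarrow> 'k" by (auto simp: D_op_def coord_space_def)
    then show ?thesis using that unfolding X_op_def
      by (auto intro!: Lrep.V_add Lrep.V_s Lrep.V_\<rho> simp del: add_2_eq_Suc')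
  qed
qed (auto simp: sprod_def Lrep.V_zero zero_prod_def Lrep.s_add Lrep.s_add_left Lrep.s_mult Lrep.s_one
    intro!: Lrep.V_add Lrep.V_s)

text \<open>Each relation is an identity between coordinates. The case distinctions isolate the indices where
  the truncation of the coordinate range takes effect.\<close>

lemma X_rels:
  assumes "p \<in> double_rels" and "v \<in> coord_space n \<times> coord_space (n + 2)"
  shows "Xrep.act n (c :: 'k::field_char_0) p v = 0"
proof -
  obtain f h where v: "v = (f, h)" by fastforce
  have f: "f j = 0" if "j > n" for j using assms(2) v that by (auto simp: coord_space_def)
  have h: "h j = 0" if "j > Suc (Suc n)" for j using assms(2) v that by (auto simp: coord_space_def)
  note defs = v Xrep.act_simps X_op_def sprod_def sfun_def D_op_def L_op_coords
  have eq0: "Xrep.act n c p v = 0" if "\<And>j. fst (Xrep.act n c p v) j = 0" "\<And>j. snd (Xrep.act n c p v) j = 0" for p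
    using that by (simp add: prod_eq_iff fun_eq_iff zero_prod_def)
  have 1: "Xrep.act n c (gen Dg * gen Dginv - 1) v = 0"
    by (rule eq0; rename_tac j; case_tac "n = j"; case_tac j; auto simp: defs f h not_le field_simps)
  have 2: "Xrep.act n c (gen Dginv * gen Dg - 1) v = 0"
    by (rule eq0; rename_tac j; case_tac "n = j"; case_tac j; auto simp: defs f h not_le field_simps)
  have 3: "Xrep.act n c (gen Dxi * gen Dg - gen Dg * gen Dxi) v = 0"
    by (rule eq0; rename_tac j; case_tac "n = j"; case_tac j; auto simp: defs f h not_le field_simps)
  have 4: "Xrep.act n c (gen Dg * gen Dx - gen Dx * gen Dg) v = 0"
    by (rule eq0; rename_tac j; case_tac "n = j"; case_tac j; auto simp: defs f h not_le field_simps)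
  have 5: "Xrep.act n c (gen Dg * gen Dy - (gen Dy * gen Dg + gen Dx * gen Dg)) v = 0"
    by (rule eq0; rename_tac j; case_tac "n = j"; case_tac j; auto simp: defs f h not_le field_simps)
  have 6: "Xrep.act n c (gen Dxi * gen Dy - (gen Dy * gen Dxi - 2 * gen Dy)) v = 0"
    by (rule eq0; rename_tac j; case_tac "n = j"; case_tac j; auto simp: defs f h not_le field_simps)
  have 7: "Xrep.act n c (gen Dxi * gen Dx - (gen Dx * gen Dxi - 2 * gen Dx)) v = 0"
    by (rule eq0; rename_tac j; case_tac "n = j"; case_tac j; auto simp: defs f h not_le field_simps)
  have 8: "Xrep.act n c (gen Du * gen Dg - gen Dg * gen Du) v = 0"
    by (rule eq0; rename_tac j; case_tac "n = j"; case_tac j; auto simp: defs f h not_le field_simps)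
  have 9: "Xrep.act n c (gen Dv * gen Dg - (gen Dg * gen Dv + gen Dg * gen Du)) v = 0"
    by (rule eq0; rename_tac j; case_tac "n = j"; case_tac j; auto simp: defs f h not_le field_simps)
  have 10: "Xrep.act n c (gen Dv * gen Dxi - (gen Dxi * gen Dv - 2 * gen Dv)) v = 0"
    by (rule eq0; rename_tac j; case_tac "n = j"; case_tac j; auto simp: defs f h not_le field_simps)
  have 11: "Xrep.act n c (gen Du * gen Dxi - (gen Dxi * gen Du - 2 * gen Du)) v = 0"
    by (rule eq0; rename_tac j; case_tac "n = j"; case_tac j; auto simp: defs f h not_le field_simps)
  have 12: "Xrep.act n c (gen Dy * gen Dx - (gen Dx * gen Dy - scal (1/2) * (gen Dx)^2)) v = 0"
    by (rule eq0; rename_tac j; case_tac "n = j"; case_tac j; auto simp: defs f h not_le field_simps)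
  have 13: "Xrep.act n c (gen Dv * gen Du - (gen Du * gen Dv - scal (1/2) * (gen Du)^2)) v = 0"
    by (rule eq0; rename_tac j; case_tac "n = j"; case_tac j; auto simp: defs f h not_le field_simps)
  have 14: "Xrep.act n c (gen Du * gen Dx - gen Dx * gen Du) v = 0"
    by (rule eq0; rename_tac j; case_tac "n = j"; case_tac j; auto simp: defs f h not_le field_simps)
  have 15: "Xrep.act n c (gen Dv * gen Dx - (gen Dx * gen Dv + (1 - gen Dg) + gen Dx * gen Du)) v = 0"
    by (rule eq0; rename_tac j; case_tac "n = j"; case_tac j; auto simp: defs f h not_le field_simps)
  have 16: "Xrep.act n c (gen Du * gen Dy - (gen Dy * gen Du + (1 - gen Dg))) v = 0"
    by (rule eq0; rename_tac j; case_tac "n = j"; case_tac j; auto simp: defs f h not_le field_simps)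
  have 17: "Xrep.act n c (gen Dv * gen Dy - (gen Dy * gen Dv + scal (1/2) * gen Dg * gen Dxi + gen Dy * gen Du)) v = 0"
    by (rule eq0; rename_tac j; case_tac "n = j"; case_tac "j = Suc (Suc n)"; case_tac j; auto simp: defs f h not_le field_simps)
  show ?thesis
    using assms(1) 1 2 3 4 5 6 7 8 9 10 11 12 13 14 15 16 17
    unfolding double_rels_def Let_def by blast
qed

lemma (in gen_rep) act_sum: "act (\<Sum>i\<in>A. p i) v = (\<Sum>i\<in>A. act (p i) v)"
  by (induction A rule: infinite_finite_induct) (auto simp: act_add)

declare zero_fun_apply [simp del] plus_fun_apply [simp del]

lemma X_op_Pair: "X_op n c a (f, h) = (L_op n a f + sfun c (D_op n a h), L_op (n + 2) a h)"
  by (simp add: X_op_def)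

lemma sfun_apply: "sfun c f j = c * f j"
  by (simp add: sfun_def)

lemma sprod_Pair: "sprod c (f, h) = (sfun c f, sfun c h)" "snd (sprod c v) = sfun c (snd v)"
  "fst (sprod c v) = sfun c (fst v)"
  by (simp_all add: sprod_def)

lemma sfun_commute: "sfun c (sfun d f) = sfun d (sfun c f)"
  by (simp add: sfun_def mult.left_commute)

text \<open>The three maps \<open>f \<mapsto> (f, 0)\<close>, \<open>(f, h) \<mapsto> h\<close> and \<open>(f, h) \<mapsto> (c f, h)\<close> commute with the action; it suffices
  to check generators. The third one goes from parameter \<open>1\<close> to parameter \<open>c\<close>.\<close>

lemma act_X_inc: "Xrep.act n c p (f, 0) = (Lrep.act n p f, 0 :: nat \<Rightarrow> 'k::field_char_0)"
proof (induction p arbitrary: f rule: free_alg_induct)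
  case (scal d)
  then show ?case by (simp add: Xrep.act_scal Lrep.act_scal sprod_Pair)
next
  case (gen a)
  have "D_op n a (0 :: nat \<Rightarrow> 'k) = 0" by (cases a) (auto simp: D_op_def fun_eq_iff zero_fun_apply)
  then show ?case by (simp add: Xrep.act_gen Lrep.act_gen X_op_Pair)
qed (simp_all add: Xrep.act_add Xrep.act_mult Lrep.act_add Lrep.act_mult)

lemma act_X_prj: "snd (Xrep.act n c p v) = Lrep.act (n + 2) p (snd v :: nat \<Rightarrow> 'k::field_char_0)"
proof (induction p arbitrary: v rule: free_alg_induct)
  case (scal d)
  then show ?case by (simp add: Xrep.act_scal Lrep.act_scal sprod_Pair)
next
  case (gen a)
  show ?case by (cases v) (simp add: Xrep.act_gen Lrep.act_gen X_op_Pair del: add_2_eq_Suc')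
qed (simp_all add: Xrep.act_add Xrep.act_mult Lrep.act_add Lrep.act_mult)

lemma act_X_scale:
  "Xrep.act n c p (sfun c f, h) = (sfun c (fst (Xrep.act n 1 p (f, h))), snd (Xrep.act n 1 p (f, h :: nat \<Rightarrow> 'k::field_char_0)))"
proof (induction p arbitrary: f h rule: free_alg_induct)
  case (scal d)
  then show ?case by (simp add: Xrep.act_scal sprod_Pair sfun_commute)
next
  case (gen a)
  show ?case by (simp add: Xrep.act_gen X_op_Pair Lrep.\<rho>_s Lrep.s_add Lrep.s_one)
next
  case (add p q)
  then show ?case by (simp add: Xrep.act_add Lrep.s_add)
next
  case (mult p q)
  then show ?case using mult.IH(1)[of "fst (Xrep.act n 1 q (f, h))" "snd (Xrep.act n 1 q (f, h))"]
    by (simp add: Xrep.act_mult)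
qed

text \<open>\<open>L n\<close> sits in the explicit extension as the first component.\<close>

lemma L_rels:
  assumes "p \<in> double_rels" "f \<in> coord_space n"
  shows "Lrep.act n p f = (0 :: nat \<Rightarrow> 'k::field_char_0)"
  using X_rels[of p "(f, 0)" n 0] assms act_X_inc[of n 0 p f] Lrep.V_zero[of "n + 2"]
  by (simp add: zero_prod_def)

lemma L_simps [simp]:
  "carrier (L n) = coord_space n" "\<zero>\<^bsub>L n\<^esub> = 0" "f \<oplus>\<^bsub>L n\<^esub> h = f + h"
  by (simp_all add: L_def coord_space_def zero_fun_def plus_fun_def)

lemma
  shows L_left_module: "left_module jordan_double (L n :: ('k::field_char_0 double, nat \<Rightarrow> 'k) module)"
    and L_smult: "f \<in> coord_space n \<Longrightarrow> dbl p \<odot>\<^bsub>L n\<^esub> f = Lrep.act n p (f :: nat \<Rightarrow> 'k)"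
proof -
  have L: "carrier (L n) = (coord_space n :: (nat \<Rightarrow> 'k) set)" "\<zero>\<^bsub>L n\<^esub> = (0 :: nat \<Rightarrow> 'k)"
    "add (L n) = ((+) :: (nat \<Rightarrow> 'k) \<Rightarrow> _)"
    and sm: "d \<odot>\<^bsub>L n\<^esub> f = Lrep.act n (SOME p. p \<in> d) f" for d and f :: "nat \<Rightarrow> 'k"
    by (simp_all add: L_def coord_space_def zero_fun_def plus_fun_def[abs_def] free_act_L)
  show "left_module jordan_double (L n :: ('k double, nat \<Rightarrow> 'k) module)"
    by (rule Lrep.model_left_module(1)[OF L_rels L sm])
  show "dbl p \<odot>\<^bsub>L n\<^esub> f = Lrep.act n p f" if "f \<in> coord_space n"
    by (rule Lrep.model_left_module(2)[OF L_rels L sm that])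
qed

definition Xmod :: "nat \<Rightarrow> 'k::field_char_0 \<Rightarrow> ('k double, (nat \<Rightarrow> 'k) \<times> (nat \<Rightarrow> 'k)) module" where
  "Xmod n c = \<lparr>carrier = coord_space n \<times> coord_space (n + 2), mult = undefined, one = undefined,
     zero = 0, add = (+), smult = (\<lambda>d v. Xrep.act n c (SOME p. p \<in> d) v)\<rparr>"

lemma Xmod_simps [simp]:
  "carrier (Xmod n c) = coord_space n \<times> coord_space (n + 2)" "\<zero>\<^bsub>Xmod n c\<^esub> = 0"
  "v \<oplus>\<^bsub>Xmod n c\<^esub> w = v + w"
  by (simp_all add: Xmod_def)

lemma
  shows Xmod_left_module: "left_module jordan_double (Xmod n c)"
    and Xmod_smult: "v \<in> coord_space n \<times> coord_space (n + 2) \<Longrightarrow> dbl p \<odot>\<^bsub>Xmod n c\<^esub> v = Xrep.act n c p v"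
  using Xrep.model_left_module[where M = "Xmod n c" and n = n and c = c, OF X_rels] by (simp_all add: Xmod_def)

definition X_ext :: "nat \<Rightarrow> 'k::field_char_0 \<Rightarrow> ('k double, nat \<Rightarrow> 'k, nat \<Rightarrow> 'k, (nat \<Rightarrow> 'k) \<times> (nat \<Rightarrow> 'k)) extn" where
  "X_ext n c = \<lparr>mid = Xmod n c, inc = (\<lambda>f. (f, 0)), prj = snd\<rparr>"

lemma lmod_homI_dbl:
  assumes "\<And>x. x \<in> carrier M \<Longrightarrow> h x \<in> carrier N"
    and "\<And>x y. \<lbrakk>x \<in> carrier M; y \<in> carrier M\<rbrakk> \<Longrightarrow> h (x \<oplus>\<^bsub>M\<^esub> y) = h x \<oplus>\<^bsub>N\<^esub> h y"
    and "\<And>p x. x \<in> carrier M \<Longrightarrow> h (dbl p \<odot>\<^bsub>M\<^esub> x) = dbl p \<odot>\<^bsub>N\<^esub> h x"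
  shows "h \<in> lmod_hom jordan_double M N"
  using assms by (intro lmod_homI) (auto simp: carrier_jordan_double)

lemma X_ext_extension: "extension jordan_double (L n) (L (n + 2)) (X_ext n c)"
proof (rule extensionI)
  show "inc (X_ext n c) \<in> lmod_hom jordan_double (L n) (mid (X_ext n c))"
    by (rule lmod_homI_dbl) (auto simp: X_ext_def Lrep.V_zero L_smult Xmod_smult act_X_inc)
  show "prj (X_ext n c) \<in> lmod_hom jordan_double (mid (X_ext n c)) (L (n + 2))"
    by (rule lmod_homI_dbl) (auto simp: X_ext_def L_smult Xmod_smult act_X_prj)
  show "\<exists>t\<in>carrier (mid (X_ext n c)). prj (X_ext n c) t = h" if "h \<in> carrier (L (n + 2))" for h
    using that by (intro bexI[of _ "(0, h)"]) (auto simp: X_ext_def Lrep.V_zero)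
qed (auto simp: X_ext_def L_left_module Xmod_left_module zero_prod_def)

subsection \<open>Basis vectors\<close>

lemma zL_coord_space: "zL n i \<in> coord_space n"
  by (auto simp: zL_def coord_space_def)

lemma L_op_Dy_zL: "L_op n Dy (zL n i) = (zL n (Suc i) :: nat \<Rightarrow> 'k::field_char_0)"
  by (auto simp: L_op_coords zL_def fun_eq_iff)

lemma act_L_Dy_pow: "Lrep.act n (gen Dy ^ i) (zL n 0) = (zL n i :: nat \<Rightarrow> 'k::field_char_0)"
  by (induction i) (simp_all add: Lrep.act_one Lrep.act_mult Lrep.act_gen L_op_Dy_zL)

lemma zL_expand:
  assumes "f \<in> coord_space n" shows "f = (\<Sum>i\<le>n. sfun (f i) (zL n i))"
proof
  fix j
  show "f j = (\<Sum>i\<le>n. sfun (f i) (zL n i)) j"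
    using assms by (auto simp: sum_fun_apply sfun_def zL_def coord_space_def if_distrib[of "\<lambda>x. _ * x"] cong: if_cong)
qed

lemma L_generated:
  assumes "f \<in> coord_space n"
  shows "f = Lrep.act n (\<Sum>i\<le>n. scal (f i) * gen Dy ^ i) (zL n 0 :: nat \<Rightarrow> 'k::field_char_0)"
  using zL_expand[OF assms] by (simp add: Lrep.act_sum Lrep.act_mult Lrep.act_scal act_L_Dy_pow)

text \<open>\<open>L n\<close> is generated by its highest weight vector.\<close>

lemma L_hom_eqI:
  assumes h: "\<phi> \<in> lmod_hom jordan_double (L n) M" "\<psi> \<in> lmod_hom jordan_double (L n) M"
    and z: "\<phi> (zL n 0) = \<psi> (zL n 0)" and f: "f \<in> coord_space n"
  shows "\<phi> f = \<psi> (f :: nat \<Rightarrow> 'k::field_char_0)"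
proof -
  let ?p = "\<Sum>i\<le>n. scal (f i) * gen Dy ^ i"
  have "f = dbl ?p \<odot>\<^bsub>L n\<^esub> zL n 0" using L_generated[OF f] by (simp add: L_smult zL_coord_space)
  then have eq: "\<phi> f = \<phi> (dbl ?p \<odot>\<^bsub>L n\<^esub> zL n 0)" "\<psi> f = \<psi> (dbl ?p \<odot>\<^bsub>L n\<^esub> zL n 0)" by simp_all
  show ?thesis unfolding eq
    using lmod_homD(3)[OF h(1), of "dbl ?p" "zL n 0"] lmod_homD(3)[OF h(2), of "dbl ?p" "zL n 0"] z
    by (simp add: zL_coord_space)
qed

definition zX :: "nat \<Rightarrow> (nat \<Rightarrow> 'k::field_char_0) \<times> (nat \<Rightarrow> 'k)" where
  "zX n = (0, zL (n + 2) 0)"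

lemma zX_carrier: "zX n \<in> coord_space n \<times> coord_space (n + 2)"
  by (simp add: zX_def Lrep.V_zero zL_coord_space)

lemma act_X_Dy: "Xrep.act n c (gen Dy) (f, h) = (L_op n Dy f, L_op (n + 2) Dy h)"
  by (simp add: Xrep.act_gen X_op_Pair D_op_def sfun_def fun_eq_iff plus_fun_apply)

lemma act_X_Dy_pow: "Xrep.act n c (gen Dy ^ k) (zX n) = (0, zL (n + 2) k)"
  by (induction k) (simp_all add: Xrep.act_one Xrep.act_mult act_X_Dy L_op_Dy_zL zX_def Lrep.\<rho>_zero del: add_2_eq_Suc')

lemma act_X_Dx: "Xrep.act n c (gen Dx) (zX n) = (sfun c (zL n 0), 0)"
  by (auto simp: Xrep.act_gen X_op_Pair zX_def D_op_def L_op_coords zL_def sfun_def fun_eq_iff zero_fun_apply plus_fun_apply)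

lemma act_X_Dy_pow_Dx: "Xrep.act n c (gen Dy ^ i * gen Dx) (zX n) = (sfun c (zL n i), 0)"
  using act_X_inc[of n c "gen Dy ^ i" "sfun c (zL n 0)"]
  by (simp add: Xrep.act_mult act_X_Dx Lrep.act_v_s act_L_Dy_pow)

section \<open>Vectors in modules over the double\<close>

locale dmod =
  fixes M :: "('k::field_char_0 double, 'm) module"
  assumes dmod: "left_module jordan_double M"
begin

sublocale left_module jordan_double M by (rule dmod)

lemma dbl_closed: "m \<in> carrier M \<Longrightarrow> dbl p \<odot>\<^bsub>M\<^esub> m \<in> carrier M"
  using smult_closed by simp

lemma dbl_add: "m \<in> carrier M \<Longrightarrow> dbl (p + q) \<odot>\<^bsub>M\<^esub> m = dbl p \<odot>\<^bsub>M\<^esub> m \<oplus>\<^bsub>M\<^esub> dbl q \<odot>\<^bsub>M\<^esub> m"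
  using smult_l_distr[of "dbl p" "dbl q" m] by (simp add: dbl_ops)

lemma dbl_mult: "m \<in> carrier M \<Longrightarrow> dbl (p * q) \<odot>\<^bsub>M\<^esub> m = dbl p \<odot>\<^bsub>M\<^esub> (dbl q \<odot>\<^bsub>M\<^esub> m)"
  using smult_assoc1[of "dbl p" "dbl q" m] by (simp add: dbl_ops)

lemma dbl_one: "m \<in> carrier M \<Longrightarrow> dbl 1 \<odot>\<^bsub>M\<^esub> m = m"
  using smult_one[of m] by (simp add: dbl_ops)

lemma dbl_zero: "m \<in> carrier M \<Longrightarrow> dbl 0 \<odot>\<^bsub>M\<^esub> m = \<zero>\<^bsub>M\<^esub>"
  using zero_smult[of m] by (simp add: dbl_ops)

lemma dbl_add_right: "\<lbrakk>m \<in> carrier M; m' \<in> carrier M\<rbrakk> \<Longrightarrow>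
    dbl p \<odot>\<^bsub>M\<^esub> (m \<oplus>\<^bsub>M\<^esub> m') = dbl p \<odot>\<^bsub>M\<^esub> m \<oplus>\<^bsub>M\<^esub> dbl p \<odot>\<^bsub>M\<^esub> m'"
  using smult_r_distr by simp

lemma dbl_diff:
  assumes "m \<in> carrier M"
  shows "dbl (p - q) \<odot>\<^bsub>M\<^esub> m = dbl p \<odot>\<^bsub>M\<^esub> m \<ominus>\<^bsub>M\<^esub> dbl q \<odot>\<^bsub>M\<^esub> m"
proof -
  have "dbl p \<odot>\<^bsub>M\<^esub> m = dbl (p - q) \<odot>\<^bsub>M\<^esub> m \<oplus>\<^bsub>M\<^esub> dbl q \<odot>\<^bsub>M\<^esub> m"
    using dbl_add[OF assms, of "p - q" q] by simp
  then show ?thesis using assms by (simp add: a_minus_def dbl_closed M.a_assoc M.r_neg)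
qed

lemma dbl_sum:
  assumes "m \<in> carrier M" "finite A"
  shows "(\<Oplus>\<^bsub>M\<^esub>i\<in>A. dbl (p i) \<odot>\<^bsub>M\<^esub> m) = dbl (\<Sum>i\<in>A. p i) \<odot>\<^bsub>M\<^esub> m"
  using assms(2) by (induction A) (auto simp: dbl_zero dbl_add assms(1) dbl_closed)

definition ann :: "'m \<Rightarrow> 'k free_alg set" where
  "ann m = {p. dbl p \<odot>\<^bsub>M\<^esub> m = \<zero>\<^bsub>M\<^esub>}"

lemma ann_add: "\<lbrakk>m \<in> carrier M; p \<in> ann m; q \<in> ann m\<rbrakk> \<Longrightarrow> p + q \<in> ann m"
  by (simp add: ann_def dbl_add)

lemma ann_lmult: "\<lbrakk>m \<in> carrier M; q \<in> ann m\<rbrakk> \<Longrightarrow> p * q \<in> ann m"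
  by (simp add: ann_def dbl_mult)

lemma ann_uminus: "\<lbrakk>m \<in> carrier M; p \<in> ann m\<rbrakk> \<Longrightarrow> - p \<in> ann m"
  using ann_lmult[of m p "-1"] by simp

lemma ann_diff: "\<lbrakk>m \<in> carrier M; p \<in> ann m; q \<in> ann m\<rbrakk> \<Longrightarrow> p - q \<in> ann m"
  using ann_add[of m p "-q"] ann_uminus[of m q] by simp

lemma ann_double_ideal: 
  assumes "m \<in> carrier M" "p \<in> double_ideal" shows "p \<in> ann m"
proof -
  have "dbl p = dbl 0" using assms(2) by (simp add: dbl_eq_iff)
  then show ?thesis using dbl_zero[OF assms(1)] by (simp add: ann_def)
qed

lemma ann_eq_iff:
  assumes "m \<in> carrier M" shows "p - q \<in> ann m \<longleftrightarrow> dbl p \<odot>\<^bsub>M\<^esub> m = dbl q \<odot>\<^bsub>M\<^esub> m"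
proof
  assume "p - q \<in> ann m"
  then show "dbl p \<odot>\<^bsub>M\<^esub> m = dbl q \<odot>\<^bsub>M\<^esub> m"
    using diff_zero_imp_eq[of "dbl p \<odot>\<^bsub>M\<^esub> m" "dbl q \<odot>\<^bsub>M\<^esub> m"] assms dbl_diff dbl_closed
    by (simp add: ann_def)
qed (use assms in \<open>simp add: ann_def dbl_diff a_minus_def M.r_neg dbl_closed\<close>)

end

text \<open>The defining relations in the order of \<open>double_rels\<close>; below they are cited by position.\<close>

lemma rels_in_double_ideal:
  fixes u v \<xi> g g' x y :: "'k::field free_alg"
  defines "u \<equiv> gen Du" and "v \<equiv> gen Dv" and "\<xi> \<equiv> gen Dxi" and "g \<equiv> gen Dg" and "g' \<equiv> gen Dginv"
    and "x \<equiv> gen Dx" and "y \<equiv> gen Dy"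
  shows "g * g' - 1 \<in> double_ideal" "g' * g - 1 \<in> double_ideal"
    "\<xi> * g - g * \<xi> \<in> double_ideal" "g * x - x * g \<in> double_ideal"
    "g * y - (y * g + x * g) \<in> double_ideal" "\<xi> * y - (y * \<xi> - 2 * y) \<in> double_ideal"
    "\<xi> * x - (x * \<xi> - 2 * x) \<in> double_ideal" "u * g - g * u \<in> double_ideal"
    "v * g - (g * v + g * u) \<in> double_ideal" "v * \<xi> - (\<xi> * v - 2 * v) \<in> double_ideal"
    "u * \<xi> - (\<xi> * u - 2 * u) \<in> double_ideal" "y * x - (x * y - scal (1/2) * x^2) \<in> double_ideal"
    "v * u - (u * v - scal (1/2) * u^2) \<in> double_ideal" "u * x - x * u \<in> double_ideal"
    "v * x - (x * v + (1 - g) + x * u) \<in> double_ideal" "u * y - (y * u + (1 - g)) \<in> double_ideal"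
    "v * y - (y * v + scal (1/2) * g * \<xi> + y * u) \<in> double_ideal"
  unfolding assms
  by (rule subsetD[OF double_rels_sub]; simp add: double_rels_def Let_def)+

section \<open>The module \<open>T(n,1)\<close>\<close>

lemma T1_rels_carrier: "T1_rels n \<subseteq> carrier jordan_double"
  by (auto simp: T1_rels_def)

interpretation cp: cyclic_presentation "jordan_double :: 'k::field_char_0 double ring" "T1_rels n" for n
  by (intro cyclic_presentation.intro cyclic_presentation_axioms.intro ring_jordan_double T1_rels_carrier)

interpretation T1: dmod "T1 n :: ('k::field_char_0 double, _) module" for n
  using cp.cyclic_pres_left_module by (simp add: dmod_def T1_def)

abbreviation zTgen :: "nat \<Rightarrow> 'k::field_char_0 double set" where
  "zTgen n \<equiv> cyclic_pres_gen jordan_double (T1_rels n)"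

lemma zTgen_carrier: "zTgen n \<in> carrier (T1 n)"
  using cp.gen_closed by (simp add: T1_def)

lemma T1_elemE:
  assumes "X \<in> carrier (T1 n)"
  obtains p where "X = dbl p \<odot>\<^bsub>T1 n\<^esub> zTgen n"
  using cp.genE[of X n] assms by (auto simp: T1_def carrier_jordan_double)

abbreviation T1_ann :: "nat \<Rightarrow> 'k::field_char_0 free_alg set" where
  "T1_ann n \<equiv> T1.ann n (zTgen n)"

lemma T1_ann_rels:
  fixes n :: nat
  defines "A \<equiv> T1_ann n :: 'k::field_char_0 free_alg set"
  shows "gen Dg - 1 \<in> A" "gen Dxi - of_nat (n + 2) \<in> A" "gen Du \<in> A" "gen Dv \<in> A"
    "gen Dx ^ 2 \<in> A" "gen Dy ^ (n + 3) \<in> A" "gen Dy ^ (n + 1) * gen Dx \<in> A"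
proof -
  have "p \<in> A" if "dbl p \<in> T1_rels n" for p
    using cp.rel_gen[OF that] unfolding A_def T1.ann_def T1_def[symmetric] by simp
  note * = this[unfolded T1_rels_def]
  show "gen Dg - 1 \<in> A" "gen Dxi - of_nat (n + 2) \<in> A" "gen Du \<in> A" "gen Dv \<in> A"
    "gen Dx ^ 2 \<in> A" "gen Dy ^ (n + 3) \<in> A" "gen Dy ^ (n + 1) * gen Dx \<in> A"
    by (rule *, blast)+
qed

lemmas T1_ann_add = T1.ann_add[OF zTgen_carrier] and T1_ann_lmult = T1.ann_lmult[OF zTgen_carrier]
  and T1_ann_diff = T1.ann_diff[OF zTgen_carrier]
  and T1_ann_double_ideal = T1.ann_double_ideal[OF zTgen_carrier]

text \<open>Maps the generator of \<open>T(n,1)\<close> to the vector with coordinates \<open>f\<close> and \<open>h\<close> with respect to \<open>y\<^sup>i x \<cdot> z\<close> and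
  \<open>y\<^sup>k \<cdot> z\<close>.\<close>

definition norm_form :: "nat \<Rightarrow> (nat \<Rightarrow> 'k) \<Rightarrow> (nat \<Rightarrow> 'k) \<Rightarrow> 'k::field_char_0 free_alg" where
  "norm_form n f h = (\<Sum>k\<le>n + 2. scal (h k) * gen Dy ^ k) + (\<Sum>i\<le>n. scal (f i) * (gen Dy ^ i * gen Dx))"

text \<open>The preimage in the free algebra of the span of the vectors \<open>y\<^sup>k \<cdot> z\<close> and \<open>y\<^sup>i x \<cdot> z\<close>. Working in the free algebra
  instead of the quotient allows ring arithmetic in a type class. The aim is that all of the free
  algebra is obtained, which is shown by proving stability under left multiplication by each generator.\<close>

definition spanT :: "nat \<Rightarrow> 'k::field_char_0 free_alg set" where
  "spanT n = {p. \<exists>f h. p - norm_form n f h \<in> T1_ann n}"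

lemma norm_form_add: "norm_form n (f + f') (h + h') = norm_form n f h + norm_form n f' h'"
  by (simp add: norm_form_def plus_fun_apply scal_simps distrib_right sum.distrib)

lemma norm_form_scal: "norm_form n (sfun c f) (sfun c h) = scal c * norm_form n f h"
  by (simp add: norm_form_def sfun_apply scal_simps sum_distrib_left distrib_left mult.assoc)

lemma spanT_add:
  assumes "p \<in> spanT n" "q \<in> spanT n" shows "p + q \<in> spanT n"
proof -
  obtain f h f' h' where "p - norm_form n f h \<in> T1_ann n" "q - norm_form n f' h' \<in> T1_ann n"
    using assms by (auto simp: spanT_def)
  then have "(p - norm_form n f h) + (q - norm_form n f' h') \<in> T1_ann n" by (rule T1_ann_add)
  also have "(p - norm_form n f h) + (q - norm_form n f' h') = p + q - norm_form n (f + f') (h + h')"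
    by (simp add: norm_form_add)
  finally show ?thesis by (auto simp: spanT_def)
qed

lemma spanT_scal:
  assumes "p \<in> spanT n" shows "scal c * p \<in> spanT n"
proof -
  obtain f h where "p - norm_form n f h \<in> T1_ann n" using assms by (auto simp: spanT_def)
  then have "scal c * (p - norm_form n f h) \<in> T1_ann n" by (rule T1_ann_lmult)
  also have "scal c * (p - norm_form n f h) = scal c * p - norm_form n (sfun c f) (sfun c h)"
    by (simp add: norm_form_scal right_diff_distrib)
  finally show ?thesis by (auto simp: spanT_def)
qed

lemma spanT_uminus: "p \<in> spanT n \<Longrightarrow> - p \<in> spanT n"
  using spanT_scal[of p n "-1"] by (simp add: scal_simps)

lemma spanT_diff: "\<lbrakk>p \<in> spanT n; q \<in> spanT n\<rbrakk> \<Longrightarrow> p - q \<in> spanT n"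
  using spanT_add[of p n "-q"] spanT_uminus[of q n] by simp

lemma spanT_ann: "p \<in> T1_ann n \<Longrightarrow> p \<in> spanT n"
  by (auto simp: spanT_def norm_form_def scal_simps intro!: exI[of _ "\<lambda>_. 0"])

lemma spanT_cong:
  assumes "p \<in> spanT n" "q - p \<in> T1_ann n" shows "q \<in> spanT n"
  using spanT_add[OF assms(1) spanT_ann[OF assms(2)]] by simp

text \<open>Computation modulo a defining relation \<open>\<rho>\<close> times a right factor.\<close>

lemma spanT_cong_rel:
  assumes "p \<in> spanT n" "\<rho> \<in> double_ideal" "q - p = \<rho> * r" shows "q \<in> spanT n"
proof (rule spanT_cong[OF assms(1)])
  show "q - p \<in> T1_ann n" unfolding assms(3) by (rule T1_ann_double_ideal[OF double_ideal_rmult[OF assms(2)]])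
qed

lemma spanT_sum: "(\<And>i. i \<in> A \<Longrightarrow> p i \<in> spanT n) \<Longrightarrow> (\<Sum>i\<in>A. p i) \<in> spanT n"
proof (induction A rule: infinite_finite_induct)
  case (insert a A)
  then show ?case by (auto intro: spanT_add)
qed (auto intro: spanT_ann T1.ann_double_ideal[OF zTgen_carrier] double_ideal_zero)

lemma spanT_norm_form: "norm_form n f h \<in> spanT n"
  unfolding spanT_def mem_Collect_eq
  by (rule exI[of _ f], rule exI[of _ h]) (simp only: diff_self T1_ann_double_ideal[OF double_ideal_zero])

lemma spanT_monom: "gen Dy ^ k * gen Dx ^ j \<in> spanT n"
proof -
  consider "j = 0" "k \<le> n + 2" | "j = 0" "k \<ge> n + 3" | "j = 1" "k \<le> n" | "j = 1" "k \<ge> n + 1" | "j \<ge> 2"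
    by linarith
  then show ?thesis
  proof cases
    case 1
    have *: "norm_form n (\<lambda>_. 0) (\<lambda>i. if i = k then 1 else 0) = gen Dy ^ k * gen Dx ^ j"
      using 1 by (simp add: norm_form_def scal_simps if_distrib[of scal] if_distrib[of "\<lambda>x. x * _"] cong: if_cong)
    show ?thesis unfolding *[symmetric] by (rule spanT_norm_form)
  next
    case 2
    then have "gen Dy ^ k * gen Dx ^ j = gen Dy ^ (k - (n + 3)) * gen Dy ^ (n + 3)"
      by (simp add: power_add[symmetric])
    then show ?thesis using T1_ann_lmult[OF T1_ann_rels(6)] spanT_ann by metis
  next
    case 3
    have *: "norm_form n (\<lambda>i. if i = k then 1 else 0) (\<lambda>_. 0) = gen Dy ^ k * gen Dx ^ j"
      using 3 by (simp add: norm_form_def scal_simps if_distrib[of scal] if_distrib[of "\<lambda>x. x * _"] cong: if_cong)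
    show ?thesis unfolding *[symmetric] by (rule spanT_norm_form)
  next
    case 4
    then have "gen Dy ^ k * gen Dx ^ j = gen Dy ^ (k - (n + 1)) * (gen Dy ^ (n + 1) * gen Dx)"
      by (simp only: mult.assoc[symmetric] power_add[symmetric]) simp
    then show ?thesis using T1_ann_lmult[OF T1_ann_rels(7)] spanT_ann by metis
  next
    case 5
    then have "gen Dy ^ k * gen Dx ^ j = (gen Dy ^ k * gen Dx ^ (j - 2)) * gen Dx ^ 2"
      by (metis le_add_diff_inverse2 mult.assoc power_add)
    then show ?thesis using T1_ann_lmult[OF T1_ann_rels(5)] spanT_ann by metis
  qed
qed

lemma spanT_one: "1 \<in> spanT n"
  using spanT_monom[of 0 0] by (metis mult_1 power_0)

lemma spanT_lmultI:
  assumes q: "\<And>k j. q * (gen Dy ^ k * gen Dx ^ j) \<in> spanT n" and p: "p \<in> spanT n"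
  shows "q * p \<in> spanT n"
proof -
  obtain f h where fh: "p - norm_form n f h \<in> T1_ann n" using p by (auto simp: spanT_def)
  have s: "q * (scal c * r) \<in> spanT n" if "q * r \<in> spanT n" for c r
    using spanT_scal[OF that, of c] by (simp add: mult.assoc[symmetric] scal_commute[of q])
  have "q * norm_form n f h \<in> spanT n"
    unfolding norm_form_def distrib_left sum_distrib_left
    using q[of _ 0] q[of _ 1] by (intro spanT_add spanT_sum s) auto
  moreover have "q * p - q * norm_form n f h \<in> T1_ann n"
    using T1_ann_lmult[OF fh, of q] by (simp add: right_diff_distrib)
  ultimately show ?thesis by (rule spanT_cong)
qed

lemma monom_induct:
  assumes "P 1" "\<And>r. P r \<Longrightarrow> P (gen Dx * r)" "\<And>r. P r \<Longrightarrow> P (gen Dy * r)"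
  shows "P (gen Dy ^ k * gen Dx ^ j)"
proof (induction k)
  case 0
  show ?case using assms by (induction j) simp_all
next
  case (Suc k)
  then show ?case using assms(3) by (simp add: mult.assoc)
qed

text \<open>Pushing \<open>q\<close> through a monomial \<open>y\<^sup>k x\<^sup>j\<close> one letter at a time: no coefficient has to be known, only
  that the commutation relations lead to products already in the span.\<close>

lemma spanT_gen_lmultI:
  fixes p q :: "'k::field_char_0 free_alg"
  assumes "q \<in> spanT n"
    and "\<And>r. \<lbrakk>r \<in> spanT n; q * r \<in> spanT n\<rbrakk> \<Longrightarrow> q * (gen Dx * r) \<in> spanT n"
    and "\<And>r. \<lbrakk>r \<in> spanT n; q * r \<in> spanT n\<rbrakk> \<Longrightarrow> q * (gen Dy * r) \<in> spanT n"
    and xy: "\<And>r :: 'k free_alg. r \<in> spanT n \<Longrightarrow> gen Dx * r \<in> spanT n" "\<And>r :: 'k free_alg. r \<in> spanT n \<Longrightarrow> gen Dy * r \<in> spanT n"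
    and p: "p \<in> spanT n"
  shows "q * p \<in> spanT n"
proof (rule spanT_lmultI[OF _ p])
  fix k j
  have "(gen Dy ^ k * gen Dx ^ j :: 'k free_alg) \<in> spanT n \<and> q * (gen Dy ^ k * gen Dx ^ j) \<in> spanT n"
    by (rule monom_induct[where P = "\<lambda>r. r \<in> spanT n \<and> q * r \<in> spanT n"]) (use assms spanT_one in auto)
  then show "q * (gen Dy ^ k * gen Dx ^ j) \<in> spanT n" by simp
qed

lemma spanT_y:
  fixes p :: "'k::field_char_0 free_alg"
  assumes "p \<in> spanT n" shows "gen Dy * p \<in> spanT n"
proof (rule spanT_lmultI[OF _ assms])
  show "gen Dy * (gen Dy ^ k * gen Dx ^ j) \<in> spanT n" for k j
    using spanT_monom[of "Suc k" j] by (metis mult.assoc power_Suc)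
qed

lemma x_pow_y: "gen Dx ^ i * gen Dy - (gen Dy * gen Dx ^ i + scal (of_nat i / 2) * gen Dx ^ (i + 1)) \<in> (double_ideal :: 'k::field_char_0 free_alg set)"
proof (induction i)
  case 0
  then show ?case by (simp add: scal_simps double_ideal_zero)
next
  case (Suc i)
  let ?x = "gen Dx :: 'k free_alg" and ?y = "gen Dy :: 'k free_alg"
  have "?x * (?x ^ i * ?y - (?y * ?x ^ i + scal (of_nat i / 2) * ?x ^ (i + 1)))
      - (?y * ?x - (?x * ?y - scal (1/2) * ?x\<^sup>2)) * ?x ^ i \<in> double_ideal"
    by (intro double_ideal_diff double_ideal_lmult[OF Suc] double_ideal_rmult[OF rels_in_double_ideal(12)])
  also have "?x * (?x ^ i * ?y - (?y * ?x ^ i + scal (of_nat i / 2) * ?x ^ (i + 1)))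
      - (?y * ?x - (?x * ?y - scal (1/2) * ?x\<^sup>2)) * ?x ^ i =
    ?x ^ Suc i * ?y - (?y * ?x ^ Suc i + (scal (of_nat i / 2) + scal (1/2)) * ?x ^ (Suc i + 1))"
  proof -
    have c: "?x * (scal d * r) = scal d * (?x * r)" for d r
      by (simp only: mult.assoc[symmetric] scal_commute)
    have X: "?x ^ (i + 1) = ?x * ?x ^ i" "?x ^ Suc i = ?x * ?x ^ i" "?x ^ (Suc i + 1) = ?x * (?x * ?x ^ i)"
      by simp_all
    show ?thesis unfolding X by (simp add: algebra_simps power2_eq_square c)
  qed
  also have "scal (of_nat i / 2) + scal (1/2) = (scal (of_nat (Suc i) / 2) :: 'k free_alg)"
    by (simp add: scal_simps[symmetric] add_divide_distrib add.commute)
  finally show ?case .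
qed

text \<open>Since \<open>x y = y x + x\<^sup>2 / 2\<close>, moving \<open>x\<close> past \<open>y\<close> produces higher powers of \<open>x\<close>. The induction is therefore on
  the monomial for all powers of \<open>x\<close> at once.\<close>

lemma spanT_x:
  fixes p :: "'k::field_char_0 free_alg"
  assumes "p \<in> spanT n" shows "gen Dx * p \<in> spanT n"
proof (rule spanT_lmultI[OF _ assms])
  fix k j
  have "\<forall>i. gen Dx ^ i * (gen Dy ^ k * gen Dx ^ j) \<in> (spanT n :: 'k free_alg set)"
  proof (rule monom_induct[where P = "\<lambda>r. \<forall>i. gen Dx ^ i * r \<in> spanT n"])
    show "\<forall>i. gen Dx ^ i * 1 \<in> spanT n" using spanT_monom[of 0] by (metis mult_1 mult.right_neutral power_0)
  next
    fix r :: "'k free_alg" assume r: "\<forall>i. gen Dx ^ i * r \<in> spanT n"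
    show "\<forall>i. gen Dx ^ i * (gen Dx * r) \<in> spanT n"
      using r by (metis mult.assoc power_Suc2)
  next
    fix r :: "'k free_alg" assume r: "\<forall>i. gen Dx ^ i * r \<in> spanT n"
    show "\<forall>i. gen Dx ^ i * (gen Dy * r) \<in> spanT n"
    proof
      fix i
      have "gen Dy * (gen Dx ^ i * r) + scal (of_nat i / 2) * (gen Dx ^ (i + 1) * r) \<in> spanT n"
        by (intro spanT_add spanT_y spanT_scal r[rule_format])
      then show "gen Dx ^ i * (gen Dy * r) \<in> spanT n"
        by (rule spanT_cong_rel[OF _ x_pow_y[of i], of _ _ _ r]) (simp add: left_diff_distrib distrib_right mult.assoc)
    qed
  qed
  from this[rule_format, of 1] show "gen Dx * (gen Dy ^ k * gen Dx ^ j) \<in> (spanT n :: 'k free_alg set)" by simp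
qed

lemma spanT_g:
  fixes p :: "'k::field_char_0 free_alg"
  assumes "p \<in> spanT n" shows "gen Dg * p \<in> spanT n"
proof (rule spanT_gen_lmultI[OF _ _ _ spanT_x spanT_y assms])
  have "gen Dg - 1 \<in> (T1_ann n :: 'k free_alg set)" by (rule T1_ann_rels)
  then show "gen Dg \<in> (spanT n :: 'k free_alg set)" by (rule spanT_cong[OF spanT_one])
next
  fix r :: "'k free_alg" assume r: "r \<in> spanT n" "gen Dg * r \<in> spanT n"
  show "gen Dg * (gen Dx * r) \<in> spanT n"
    by (rule spanT_cong_rel[OF spanT_x[OF r(2)] rels_in_double_ideal(4), of _ r]) (simp add: algebra_simps)
  show "gen Dg * (gen Dy * r) \<in> spanT n"
    by (rule spanT_cong_rel[OF spanT_add[OF spanT_y[OF r(2)] spanT_x[OF r(2)]] rels_in_double_ideal(5), of _ r])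
      (simp add: algebra_simps)
qed

text \<open>The commutation rules for \<open>g\<^sup>-\<^sup>1\<close> follow from those for \<open>g\<close> by multiplying with \<open>g\<^sup>-\<^sup>1\<close> on both sides; the
  remaining terms cancel modulo \<open>g g\<^sup>-\<^sup>1 - 1\<close> and \<open>g\<^sup>-\<^sup>1 g - 1\<close>.\<close>

lemma ginv_x: "gen Dginv * gen Dx - gen Dx * gen Dginv \<in> (double_ideal :: 'k::field free_alg set)"
proof -
  let ?g = "gen Dg :: 'k free_alg" and ?g' = "gen Dginv :: 'k free_alg" and ?x = "gen Dx :: 'k free_alg"
  have "?g' * ((?g * ?x - ?x * ?g) * ?g') + (?g' * (?x * (?g * ?g' - 1)) - (?g' * ?g - 1) * (?x * ?g')) \<in> double_ideal"
    by (intro double_ideal_add double_ideal_diff double_ideal_lmult double_ideal_rmult rels_in_double_ideal(1,2,4))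
  then have "- (?g' * ((?g * ?x - ?x * ?g) * ?g') + (?g' * (?x * (?g * ?g' - 1)) - (?g' * ?g - 1) * (?x * ?g'))) \<in> double_ideal"
    by (rule double_ideal_uminus)
  also have "- (?g' * ((?g * ?x - ?x * ?g) * ?g') + (?g' * (?x * (?g * ?g' - 1)) - (?g' * ?g - 1) * (?x * ?g')))
    = ?g' * ?x - ?x * ?g'"
    by (simp add: algebra_simps)
  finally show ?thesis .
qed

lemma ginv_y: "gen Dginv * gen Dy - (gen Dy * gen Dginv - gen Dginv * gen Dx) \<in> (double_ideal :: 'k::field free_alg set)"
proof -
  let ?g = "gen Dg :: 'k free_alg" and ?g' = "gen Dginv :: 'k free_alg"
    and ?x = "gen Dx :: 'k free_alg" and ?y = "gen Dy :: 'k free_alg"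
  have "- (?g' * ((?g * ?y - (?y * ?g + ?x * ?g)) * ?g') +
    (?g' * ((?y + ?x) * (?g * ?g' - 1)) - (?g' * ?g - 1) * (?y * ?g'))) \<in> double_ideal"
    by (intro double_ideal_uminus double_ideal_add double_ideal_diff double_ideal_lmult double_ideal_rmult
        rels_in_double_ideal(1,2,5))
  also have "- (?g' * ((?g * ?y - (?y * ?g + ?x * ?g)) * ?g') +
    (?g' * ((?y + ?x) * (?g * ?g' - 1)) - (?g' * ?g - 1) * (?y * ?g'))) =
    ?g' * ?y - (?y * ?g' - ?g' * ?x)"
    by (simp add: algebra_simps)
  finally show ?thesis .
qed

lemma spanT_ginv:
  fixes p :: "'k::field_char_0 free_alg"
  assumes "p \<in> spanT n" shows "gen Dginv * p \<in> spanT n"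
proof (rule spanT_gen_lmultI[OF _ _ _ spanT_x spanT_y assms])
  have "(gen Dginv * gen Dg - 1) - gen Dginv * (gen Dg - 1) \<in> (T1_ann n :: 'k free_alg set)"
    by (intro T1_ann_diff T1_ann_lmult T1_ann_rels T1_ann_double_ideal rels_in_double_ideal)
  then have "gen Dginv - 1 \<in> (T1_ann n :: 'k free_alg set)" by (simp add: algebra_simps)
  then show "gen Dginv \<in> (spanT n :: 'k free_alg set)" by (rule spanT_cong[OF spanT_one])
next
  fix r :: "'k free_alg" assume r: "r \<in> spanT n" "gen Dginv * r \<in> spanT n"
  show x: "gen Dginv * (gen Dx * r) \<in> spanT n"
    by (rule spanT_cong_rel[OF spanT_x[OF r(2)] ginv_x, of _ r]) (simp add: algebra_simps)
  show "gen Dginv * (gen Dy * r) \<in> spanT n"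
    by (rule spanT_cong_rel[OF spanT_diff[OF spanT_y[OF r(2)] x] ginv_y, of _ r])
      (simp add: algebra_simps)
qed

lemma spanT_xi:
  fixes p :: "'k::field_char_0 free_alg"
  assumes "p \<in> spanT n" shows "gen Dxi * p \<in> spanT n"
proof (rule spanT_gen_lmultI[OF _ _ _ spanT_x spanT_y assms])
  have "gen Dxi - scal (of_nat (n + 2)) * 1 \<in> (T1_ann n :: 'k free_alg set)"
    using T1_ann_rels(2) unfolding scal_of_nat mult_1_right .
  then show "gen Dxi \<in> (spanT n :: 'k free_alg set)" by (rule spanT_cong[OF spanT_scal[OF spanT_one]])
next
  fix r :: "'k free_alg" assume r: "r \<in> spanT n" "gen Dxi * r \<in> spanT n"
  show "gen Dxi * (gen Dx * r) \<in> spanT n"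
    by (rule spanT_cong_rel[OF spanT_diff[OF spanT_x[OF r(2)] spanT_scal[OF spanT_x[OF r(1)], of 2]]
          rels_in_double_ideal(7), of _ r]) (simp add: algebra_simps scal_numeral)
  show "gen Dxi * (gen Dy * r) \<in> spanT n"
    by (rule spanT_cong_rel[OF spanT_diff[OF spanT_y[OF r(2)] spanT_scal[OF spanT_y[OF r(1)], of 2]]
          rels_in_double_ideal(6), of _ r]) (simp add: algebra_simps scal_numeral)
qed

lemma spanT_u:
  fixes p :: "'k::field_char_0 free_alg"
  assumes "p \<in> spanT n" shows "gen Du * p \<in> spanT n"
proof (rule spanT_gen_lmultI[OF _ _ _ spanT_x spanT_y assms])
  show "gen Du \<in> (spanT n :: 'k free_alg set)" by (intro spanT_ann T1_ann_rels)
next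
  fix r :: "'k free_alg" assume r: "r \<in> spanT n" "gen Du * r \<in> spanT n"
  show "gen Du * (gen Dx * r) \<in> spanT n"
    by (rule spanT_cong_rel[OF spanT_x[OF r(2)] rels_in_double_ideal(14), of _ r]) (simp add: algebra_simps)
  show "gen Du * (gen Dy * r) \<in> spanT n"
    by (rule spanT_cong_rel[OF spanT_add[OF spanT_y[OF r(2)] spanT_diff[OF r(1) spanT_g[OF r(1)]]]
          rels_in_double_ideal(16), of _ r]) (simp add: algebra_simps)
qed

lemma spanT_v:
  fixes p :: "'k::field_char_0 free_alg"
  assumes "p \<in> spanT n" shows "gen Dv * p \<in> spanT n"
proof (rule spanT_gen_lmultI[OF _ _ _ spanT_x spanT_y assms])
  show "gen Dv \<in> (spanT n :: 'k free_alg set)" by (intro spanT_ann T1_ann_rels)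
next
  fix r :: "'k free_alg" assume r: "r \<in> spanT n" "gen Dv * r \<in> spanT n"
  show "gen Dv * (gen Dx * r) \<in> spanT n"
    by (rule spanT_cong_rel[OF spanT_add[OF spanT_add[OF spanT_x[OF r(2)] spanT_diff[OF r(1) spanT_g[OF r(1)]]]
          spanT_x[OF spanT_u[OF r(1)]]] rels_in_double_ideal(15), of _ r]) (simp add: algebra_simps)
  show "gen Dv * (gen Dy * r) \<in> spanT n"
    by (rule spanT_cong_rel[OF spanT_add[OF spanT_add[OF spanT_y[OF r(2)]
          spanT_scal[OF spanT_g[OF spanT_xi[OF r(1)]], of "1/2"]] spanT_y[OF spanT_u[OF r(1)]]]
          rels_in_double_ideal(17), of _ r]) (simp add: algebra_simps)
qed

lemma spanT_all: "(p :: 'k::field_char_0 free_alg) \<in> spanT n"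
proof -
  have "\<forall>r\<in>spanT n. p * r \<in> spanT n"
  proof (induction p rule: free_alg_induct)
    case (gen a)
    then show ?case
      by (cases a) (auto intro: spanT_u spanT_v spanT_xi spanT_g spanT_ginv spanT_x spanT_y)
  qed (auto simp: distrib_right mult.assoc intro: spanT_add spanT_scal)
  then show ?thesis using spanT_one by (metis mult.right_neutral)
qed

lemma T1_universal:
  fixes M :: "('k::field_char_0 double, 'm) module"
  assumes M: "left_module jordan_double M" and t: "t \<in> carrier M"
    and rels: "\<And>p. p \<in> {gen Dg - 1, gen Dxi - of_nat (n + 2), gen Du, gen Dv,
     gen Dx ^ 2, gen Dy ^ (n + 3), gen Dy ^ (n + 1) * gen Dx} \<Longrightarrow> dbl p \<odot>\<^bsub>M\<^esub> t = \<zero>\<^bsub>M\<^esub>"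
  shows "\<exists>h\<in>lmod_hom jordan_double (T1 n) M. h (zTgen n) = t"
  unfolding T1_def using rels by (intro cp.cyclic_pres_universal[OF M t]) (auto simp: T1_rels_def)

lemma sum_Pair: "(\<Sum>i\<in>A. (f i, g i)) = (\<Sum>i\<in>A. f i, \<Sum>i\<in>A. g i)"
  by (induction A rule: infinite_finite_induct) (auto simp: zero_prod_def)

lemma act_X_norm_form:
  "Xrep.act n 1 (norm_form n f h) (zX n) =
     (\<Sum>i\<le>n. sfun (f i) (zL n i), \<Sum>k\<le>n + 2. sfun (h k) (zL (n + 2) k :: nat \<Rightarrow> 'k::field_char_0))"
  by (simp add: norm_form_def Xrep.act_add Xrep.act_sum Xrep.act_mult[of _ _ "scal _"] Xrep.act_scal
      act_X_Dy_pow act_X_Dy_pow_Dx sprod_Pair Lrep.s_zero Lrep.s_one sum_Pair del: add_2_eq_Suc')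

lemma sum_zL: "(\<Sum>i\<le>n. sfun (f i) (zL n i)) j = (if j \<le> n then f j else (0 :: 'k::field_char_0))"
  by (auto simp: sum_fun_apply sfun_apply zL_def if_distrib[of "\<lambda>x. _ * x"] cong: if_cong)

lemma act_X_norm_form':
  assumes "f \<in> coord_space n" "h \<in> coord_space (n + 2)"
  shows "Xrep.act n 1 (norm_form n f h) (zX n) = (f, h :: nat \<Rightarrow> 'k::field_char_0)"
  unfolding act_X_norm_form using zL_expand[OF assms(1)] zL_expand[OF assms(2)] by simp

lemma L_op_Dx: "L_op n Dx f = (0 :: nat \<Rightarrow> 'k::field_char_0)"
  by (simp add: L_op_coords zero_fun_def)

text \<open>The generator of the explicit module satisfies the defining relations of \<open>T(n,1)\<close>.\<close>

lemma T1_to_X: "\<exists>F. F \<in> lmod_hom jordan_double (T1 n) (Xmod n 1) \<and> F (zTgen n) = (zX n :: (nat \<Rightarrow> 'k::field_char_0) \<times> _)"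
proof -
  let ?z = "zX n :: (nat \<Rightarrow> 'k) \<times> (nat \<Rightarrow> 'k)"
  have z: "?z \<in> coord_space n \<times> coord_space (n + 2)" by (rule zX_carrier)
  have zL0: "zL m i = (0 :: nat \<Rightarrow> 'k)" if "i > m" for m i using that by (auto simp: zL_def fun_eq_iff zero_fun_apply)
  have g: "Xrep.act n 1 (gen Dg - 1) ?z = 0"
    by (simp add: Xrep.act_simps zX_def X_op_Pair zero_prod_def)
      (auto simp: L_op_coords D_op_def zL_def sfun_def fun_eq_iff plus_fun_apply zero_fun_apply)
  have xi: "Xrep.act n 1 (gen Dxi - scal (of_nat (n + 2))) ?z = 0"
    by (simp add: Xrep.act_simps zX_def X_op_Pair zero_prod_def sprod_Pair Lrep.s_zero)
      (auto simp: L_op_coords D_op_def zL_def sfun_def fun_eq_iff plus_fun_apply zero_fun_apply)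
  have u: "Xrep.act n 1 (gen Du) ?z = 0"
    by (simp add: Xrep.act_simps zX_def X_op_Pair zero_prod_def)
      (auto simp: L_op_coords D_op_def zL_def sfun_def fun_eq_iff plus_fun_apply zero_fun_apply)
  have v: "Xrep.act n 1 (gen Dv) ?z = 0"
    by (simp add: Xrep.act_simps zX_def X_op_Pair zero_prod_def)
      (auto simp: L_op_coords D_op_def zL_def sfun_def fun_eq_iff plus_fun_apply zero_fun_apply)
  have x: "Xrep.act n 1 ((gen Dx) ^ 2) ?z = 0"
    by (simp add: power2_eq_square Xrep.act_mult act_X_Dx act_X_inc Lrep.act_gen L_op_Dx zero_prod_def)
  have y: "Xrep.act n 1 (gen Dy ^ (n + 3)) ?z = 0"
    by (simp add: act_X_Dy_pow zL0 zero_prod_def del: add_2_eq_Suc')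
  have yx: "Xrep.act n 1 (gen Dy ^ (n + 1) * gen Dx) ?z = 0"
    by (simp only: act_X_Dy_pow_Dx) (simp add: zL0 zero_prod_def)
  have "\<exists>F\<in>lmod_hom jordan_double (T1 n) (Xmod n 1). F (zTgen n) = (zX n :: (nat \<Rightarrow> 'k) \<times> _)"
  proof (rule T1_universal[OF Xmod_left_module])
    show "?z \<in> carrier (Xmod n 1)" using z by simp
    fix p :: "'k free_alg"
    assume "p \<in> {gen Dg - 1, gen Dxi - of_nat (n + 2), gen Du, gen Dv,
     gen Dx ^ 2, gen Dy ^ (n + 3), gen Dy ^ (n + 1) * gen Dx}"
    then have "Xrep.act n 1 p ?z = 0"
      using g xi u v x y yx unfolding scal_of_nat by blast
    then show "dbl p \<odot>\<^bsub>Xmod n 1\<^esub> ?z = \<zero>\<^bsub>Xmod n 1\<^esub>" using Xmod_smult[OF z] by simp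
  qed
  then show ?thesis by blast
qed

text \<open>The homomorphism is unique, as \<open>T(n,1)\<close> is generated by \<open>zTgen n\<close>; it gives coordinates on \<open>T(n,1)\<close>.\<close>

definition T1_map :: "nat \<Rightarrow> 'k::field_char_0 double set \<Rightarrow> (nat \<Rightarrow> 'k) \<times> (nat \<Rightarrow> 'k)" where
  "T1_map n = (SOME F. F \<in> lmod_hom jordan_double (T1 n) (Xmod n 1) \<and> F (zTgen n) = zX n)"

lemma T1_map:
  "(T1_map n :: 'k::field_char_0 double set \<Rightarrow> _) \<in> lmod_hom jordan_double (T1 n) (Xmod n 1) \<and>
    T1_map n (zTgen n :: 'k double set) = zX n"
  unfolding T1_map_def by (rule someI_ex[OF T1_to_X])

lemmas T1_map_hom = T1_map[THEN conjunct1] and T1_map_gen = T1_map[THEN conjunct2]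

lemma T1_map_dbl: "T1_map n (dbl p \<odot>\<^bsub>T1 n\<^esub> zTgen n) = Xrep.act n 1 p (zX n)"
  by (simp only: lmod_homD(3)[OF T1_map_hom dbl_carrier zTgen_carrier] Xmod_smult[OF zX_carrier] T1_map_gen)

lemma norm_form_zero:
  assumes "\<And>i. i \<le> n \<Longrightarrow> f i = 0" "\<And>k. k \<le> n + 2 \<Longrightarrow> h k = 0"
  shows "norm_form n f h = 0"
  using assms by (auto simp: norm_form_def scal_simps intro!: sum.neutral)

text \<open>Modulo the annihilator, \<open>p\<close> is a normal form, whose coefficients can be read off from its action on
  \<open>zX n\<close>; so they all vanish.\<close>

lemma T1_ann_if_act_zero:
  fixes p :: "'k::field_char_0 free_alg"
  assumes "Xrep.act n 1 p (zX n) = 0" shows "p \<in> T1_ann n"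
proof -
  obtain f h where fh: "p - norm_form n f h \<in> T1_ann n" using spanT_all[of p n] by (auto simp: spanT_def)
  then have "dbl p \<odot>\<^bsub>T1 n\<^esub> zTgen n = dbl (norm_form n f h) \<odot>\<^bsub>T1 n\<^esub> zTgen n"
    using T1.ann_eq_iff[OF zTgen_carrier] by blast
  then have "Xrep.act n 1 (norm_form n f h) (zX n) = 0"
    using assms T1_map_dbl by metis
  then have f0: "(\<Sum>i\<le>n. sfun (f i) (zL n i)) = 0" and h0: "(\<Sum>k\<le>n + 2. sfun (h k) (zL (n + 2) k)) = 0"
    by (simp_all add: act_X_norm_form zero_prod_def)
  have "f i = 0" if "i \<le> n" for i using sum_zL[of f n i] that f0 by (simp add: zero_fun_apply)
  moreover have "h k = 0" if "k \<le> n + 2" for k using sum_zL[of h "n + 2" k] that h0 by (simp add: zero_fun_apply)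
  ultimately have "norm_form n f h = 0" by (rule norm_form_zero)
  then show ?thesis using fh by simp
qed

lemma T1_map_iso: "T1_map n \<in> lmod_iso jordan_double (T1 n) (Xmod n 1 :: ('k::field_char_0 double, _) module)"
proof -
  have "inj_on (T1_map n) (carrier (T1 n :: ('k double, _) module))"
  proof (rule inj_onI)
    fix X Y :: "'k double set" assume XY: "X \<in> carrier (T1 n)" "Y \<in> carrier (T1 n)" "T1_map n X = T1_map n Y"
    obtain p q where pq: "X = dbl p \<odot>\<^bsub>T1 n\<^esub> zTgen n" "Y = dbl q \<odot>\<^bsub>T1 n\<^esub> zTgen n"
      using T1_elemE[OF XY(1)] T1_elemE[OF XY(2)] by metis
    have "Xrep.act n 1 (p - q) (zX n) = 0" using XY(3) by (simp add: pq T1_map_dbl Xrep.act_diff)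
    then show "X = Y" using T1_ann_if_act_zero T1.ann_eq_iff[OF zTgen_carrier] pq by blast
  qed
  moreover have surj: "v \<in> T1_map n ` carrier (T1 n)" if "v \<in> coord_space n \<times> coord_space (n + 2)"
    for v :: "(nat \<Rightarrow> 'k) \<times> (nat \<Rightarrow> 'k)"
    using that act_X_norm_form'[of "fst v" n "snd v"]
    by (intro image_eqI[of _ _ "dbl (norm_form n (fst v) (snd v)) \<odot>\<^bsub>T1 n\<^esub> zTgen n"])
      (auto simp: T1_map_dbl mem_Times_iff intro!: T1.dbl_closed zTgen_carrier)
  moreover have "T1_map n ` carrier (T1 n) \<subseteq> (coord_space n \<times> coord_space (n + 2) :: ((nat \<Rightarrow> 'k) \<times> _) set)"
    using lmod_homD(1)[OF T1_map_hom[of n]] by (intro image_subsetI) simp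
  ultimately have "bij_betw (T1_map n) (carrier (T1 n)) (carrier (Xmod n 1 :: ('k double, _) module))"
    unfolding bij_betw_def Xmod_simps by blast
  then show ?thesis using T1_map_hom by (simp add: lmod_iso_def)
qed

lemma zT_eq: "zT n i j = dbl (gen Dy ^ i * gen Dx ^ j) \<odot>\<^bsub>T1 n\<^esub> zTgen n"
  by (simp add: zT_def)

lemma T1_finsum:
  fixes p :: "nat \<Rightarrow> 'k::field_char_0 free_alg"
  assumes "finite A"
  shows "(\<Oplus>\<^bsub>T1 n\<^esub>i\<in>A. dbl (scal (a i)) \<odot>\<^bsub>T1 n\<^esub> (dbl (p i) \<odot>\<^bsub>T1 n\<^esub> zTgen n)) =
     dbl (\<Sum>i\<in>A. scal (a i) * p i) \<odot>\<^bsub>T1 n\<^esub> zTgen n"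
  using T1.dbl_sum[OF zTgen_carrier assms, where p = "\<lambda>i. scal (a i) * p i"]
  by (simp only: T1.dbl_mult[OF zTgen_carrier])

lemma T1_norm_form:
  "(\<Oplus>\<^bsub>T1 n\<^esub>k\<in>{..n + 2}. dbl (scal (a k)) \<odot>\<^bsub>T1 n\<^esub> zT n k 0) \<oplus>\<^bsub>T1 n\<^esub>
         (\<Oplus>\<^bsub>T1 n\<^esub>i\<in>{..n}. dbl (scal (c i)) \<odot>\<^bsub>T1 n\<^esub> zT n i 1) =
    dbl (norm_form n c a) \<odot>\<^bsub>T1 n\<^esub> (zTgen n :: 'k::field_char_0 double set)"
  unfolding zT_eq T1_finsum[OF finite_atMost] norm_form_def T1.dbl_add[OF zTgen_carrier] by simp

text \<open>In the coordinates given by \<open>T1_map\<close>, the maps of \<open>\<E>(b)\<close> are \<open>f \<mapsto> (b f, 0)\<close> and \<open>(f, h) \<mapsto> h\<close>.\<close>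

lemma T1_map_iota:
  assumes "f \<in> coord_space n"
  shows "iota n b f \<in> carrier (T1 n)" "T1_map n (iota n b f) = (sfun b f, 0 :: nat \<Rightarrow> 'k::field_char_0)"
proof -
  have eq: "iota n b f = dbl (norm_form n (sfun b f) (\<lambda>_. 0)) \<odot>\<^bsub>T1 n\<^esub> zTgen n"
    unfolding iota_def zT_eq T1_finsum[OF finite_atMost]
    by (simp add: norm_form_def scal_simps sfun_apply mult.commute)
  show "iota n b f \<in> carrier (T1 n)" unfolding eq by (rule T1.dbl_closed[OF zTgen_carrier])
  show "T1_map n (iota n b f) = (sfun b f, 0 :: nat \<Rightarrow> 'k)"
    unfolding eq T1_map_dbl zero_fun_def[symmetric]
    by (rule act_X_norm_form') (auto intro: Lrep.V_s Lrep.V_zero assms)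
qed

lemma T1_map_proj:
  assumes "t \<in> carrier (T1 n)"
  shows "proj n t = snd (T1_map n t :: (nat \<Rightarrow> 'k::field_char_0) \<times> _)"
proof -
  have eq: "(\<exists>a c. t = dbl (norm_form n c a) \<odot>\<^bsub>T1 n\<^esub> zTgen n \<and> w = (\<lambda>j. \<Sum>k\<le>n + 2. a k * zL (n + 2) k j))
      \<longleftrightarrow> w = snd (T1_map n t)" (is "?l \<longleftrightarrow> ?r") for w :: "nat \<Rightarrow> 'k"
  proof
    assume ?l
    then obtain a c where ac: "t = dbl (norm_form n c a) \<odot>\<^bsub>T1 n\<^esub> zTgen n"
      "w = (\<lambda>j. \<Sum>k\<le>n + 2. a k * zL (n + 2) k j)" by blast
    have "w = (\<Sum>k\<le>n + 2. sfun (a k) (zL (n + 2) k))"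
      unfolding ac(2) by (simp add: fun_eq_iff sum_fun_apply sfun_apply del: add_2_eq_Suc')
    then show ?r unfolding ac(1) T1_map_dbl act_X_norm_form by simp
  next
    assume w: ?r
    obtain p where p: "t = dbl p \<odot>\<^bsub>T1 n\<^esub> zTgen n" using T1_elemE[OF assms] .
    obtain c a where "p - norm_form n c a \<in> T1_ann n" using spanT_all[of p n] by (auto simp: spanT_def)
    then have t: "t = dbl (norm_form n c a) \<odot>\<^bsub>T1 n\<^esub> zTgen n"
      using T1.ann_eq_iff[OF zTgen_carrier] p by blast
    have "w = (\<Sum>k\<le>n + 2. sfun (a k) (zL (n + 2) k))"
      using w unfolding t T1_map_dbl act_X_norm_form by simp
    then have "w = (\<lambda>j. \<Sum>k\<le>n + 2. a k * zL (n + 2) k j)"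
      by (simp add: fun_eq_iff sum_fun_apply sfun_apply del: add_2_eq_Suc')
    with t show ?l by blast
  qed
  show ?thesis unfolding proj_def T1_norm_form eq by simp
qed

lemma T1_left_module: "left_module jordan_double (T1 n :: ('k::field_char_0 double, _) module)"
  by (rule T1.dmod)

lemma inj_T1_map: "\<lbrakk>X \<in> carrier (T1 n); Y \<in> carrier (T1 n); T1_map n X = T1_map n Y\<rbrakk> \<Longrightarrow> X = Y"
  using T1_map_iso[of n] by (auto simp: lmod_iso_def bij_betw_def dest: inj_onD)

lemma surj_T1_map:
  fixes f h :: "nat \<Rightarrow> 'k::field_char_0"
  assumes "f \<in> coord_space n" "h \<in> coord_space (n + 2)"
  obtains X where "X \<in> carrier (T1 n)" "T1_map n X = (f, h)"
proof -
  have "(f, h) \<in> T1_map n ` carrier (T1 n)"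
    using T1_map_iso[of n, where 'k = 'k] assms by (simp add: lmod_iso_def bij_betw_def)
  then show ?thesis using that by auto
qed

text \<open>All properties are checked in the coordinates given by \<open>T1_map\<close>.\<close>

lemma E_ext_extension:
  fixes b :: "'k::field_char_0"
  assumes "b \<noteq> 0"
  shows "extension jordan_double (L n) (L (n + 2)) (E_ext n b)"
proof -
  note F = lmod_homD[OF T1_map_hom[of n]]
  note T1c = T1.smult_closed T1.M.a_closed T1.dbl_closed
  show ?thesis
  proof (rule extensionI)
    show "inc (E_ext n b) \<in> lmod_hom jordan_double (L n) (mid (E_ext n b))"
    proof (rule lmod_homI_dbl; unfold E_ext_def extn.simps L_simps)
      fix f :: "nat \<Rightarrow> 'k" assume f: "f \<in> coord_space n"
      show "iota n b f \<in> carrier (T1 n)" using T1_map_iota[OF f] by simp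
      fix p
      have "T1_map n (iota n b (Lrep.act n p f)) = T1_map n (dbl p \<odot>\<^bsub>T1 n\<^esub> iota n b f)"
        using T1_map_iota[OF f] T1_map_iota[OF Lrep.act_V[OF f]]
        by (simp add: F Xmod_smult Lrep.V_s Lrep.V_zero f act_X_inc Lrep.act_v_s)
      then show "iota n b (dbl p \<odot>\<^bsub>L n\<^esub> f) = dbl p \<odot>\<^bsub>T1 n\<^esub> iota n b f"
        unfolding L_smult[OF f]
        by (rule inj_T1_map[rotated 2]) (auto intro!: T1_map_iota f Lrep.act_V T1c)
    next
      fix f f' :: "nat \<Rightarrow> 'k" assume f: "f \<in> coord_space n" "f' \<in> coord_space n"
      have "T1_map n (iota n b (f + f')) = T1_map n (iota n b f \<oplus>\<^bsub>T1 n\<^esub> iota n b f')"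
        using T1_map_iota[OF f(1)] T1_map_iota[OF f(2)] T1_map_iota[OF Lrep.V_add[OF f]]
        by (simp add: F Lrep.s_add)
      then show "iota n b (f + f') = iota n b f \<oplus>\<^bsub>T1 n\<^esub> iota n b f'"
        by (rule inj_T1_map[rotated 2]) (auto intro!: T1_map_iota f Lrep.V_add T1c)
    qed
    show "prj (E_ext n b) \<in> lmod_hom jordan_double (mid (E_ext n b)) (L (n + 2))"
    proof (rule lmod_homI_dbl; unfold E_ext_def extn.simps L_simps)
      fix X :: "'k double set" assume X: "X \<in> carrier (T1 n)"
      have FX: "T1_map n X \<in> coord_space n \<times> coord_space (n + 2)" using F(1)[OF X] by simp
      then show "proj n X \<in> coord_space (n + 2)" by (auto simp: T1_map_proj[OF X] mem_Times_iff)
      fix p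
      show "proj n (dbl p \<odot>\<^bsub>T1 n\<^esub> X) = dbl p \<odot>\<^bsub>L (n + 2)\<^esub> proj n X"
        using FX X by (auto simp: T1_map_proj T1c F Xmod_smult act_X_prj L_smult mem_Times_iff simp del: add_2_eq_Suc')
    next
      fix X Y :: "'k double set" assume "X \<in> carrier (T1 n)" "Y \<in> carrier (T1 n)"
      then show "proj n (X \<oplus>\<^bsub>T1 n\<^esub> Y) = proj n X + proj n Y" by (simp add: T1_map_proj T1c F)
    qed
  next
    fix f :: "nat \<Rightarrow> 'k" assume f: "f \<in> carrier (L n)"
    have z: "T1_map n \<zero>\<^bsub>T1 n\<^esub> = (0 :: (nat \<Rightarrow> 'k) \<times> (nat \<Rightarrow> 'k))"
      using lmod_hom_zero[OF T1_map_hom T1_left_module Xmod_left_module] by simp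
    show "prj (E_ext n b) (inc (E_ext n b) f) = \<zero>\<^bsub>L (n + 2)\<^esub>"
      using T1_map_iota[of f n b] f by (simp add: E_ext_def T1_map_proj)
    assume "inc (E_ext n b) f = \<zero>\<^bsub>mid (E_ext n b)\<^esub>"
    then have "sfun b f = 0" using z T1_map_iota(2)[of f n b] f by (simp add: E_ext_def zero_prod_def)
    then have "sfun (1 / b) (sfun b f) = sfun (1 / b) 0" by simp
    then show "f = \<zero>\<^bsub>L n\<^esub>"
      using assms by (simp add: Lrep.s_mult[symmetric] Lrep.s_one Lrep.s_zero)
  next
    fix X assume X: "X \<in> carrier (mid (E_ext n b))" "prj (E_ext n b) X = \<zero>\<^bsub>L (n + 2)\<^esub>"
    then have X': "X \<in> carrier (T1 n)" by (simp add: E_ext_def)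
    then obtain f where f: "T1_map n X = (f, 0)" "f \<in> coord_space n"
      using X F(1)[OF X'] T1_map_proj[OF X'] by (cases "T1_map n X") (auto simp: E_ext_def)
    have g: "sfun (1 / b) f \<in> coord_space n" using f by (intro Lrep.V_s)
    have "X = iota n b (sfun (1 / b) f)"
      by (rule inj_T1_map[OF X' T1_map_iota(1)[OF g]])
        (use assms in \<open>simp add: f T1_map_iota(2)[OF g] Lrep.s_mult[symmetric] Lrep.s_one\<close>)
    then show "\<exists>a\<in>carrier (L n). X = inc (E_ext n b) a" using g by (auto simp: E_ext_def)
  next
    fix h :: "nat \<Rightarrow> 'k" assume "h \<in> carrier (L (n + 2))"
    then obtain X where "X \<in> carrier (T1 n)" "T1_map n X = (0, h)"
      using surj_T1_map[of 0 n h] Lrep.V_zero by auto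
    then show "\<exists>t\<in>carrier (mid (E_ext n b)). prj (E_ext n b) t = h"
      by (intro bexI[of _ X]) (simp_all add: E_ext_def T1_map_proj)
  qed (simp_all add: L_left_module E_ext_def T1_left_module del: add_2_eq_Suc')
qed

section \<open>Classification of the extensions\<close>

abbreviation "LL_extension n \<equiv> extension jordan_double (L n) (L (n + 2))"

abbreviation "LL_iso n \<equiv> ext_iso jordan_double (L n) (L (n + 2))"

text \<open>The invariant \<open>c\<close> of the extension: \<open>t\<close>, called the top vector below, is the lift of weight \<open>n + 2\<close> of the
  highest weight vector of the quotient.\<close>

definition ext_inv :: "nat \<Rightarrow> ('k::field_char_0 double, nat \<Rightarrow> 'k, nat \<Rightarrow> 'k, 't) extn \<Rightarrow> 'k \<Rightarrow> bool" where
  "ext_inv n e c \<longleftrightarrow> (\<exists>t\<in>carrier (mid e). prj e t = zL (n + 2) 0 \<and>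
     dbl (gen Dxi - scal (of_nat (n + 2))) \<odot>\<^bsub>mid e\<^esub> t = \<zero>\<^bsub>mid e\<^esub> \<and>
     dbl (gen Dx) \<odot>\<^bsub>mid e\<^esub> t = inc e (sfun c (zL n 0)))"

lemma act_L_weight:
  "f \<in> coord_space m \<Longrightarrow> Lrep.act m (gen Dxi - scal \<mu>) f = (\<lambda>j. (of_nat m - 2 * of_nat j - \<mu>) * f j :: 'k::field_char_0)"
  by (auto simp: Lrep.act_diff Lrep.act_gen Lrep.act_scal L_op_coords sfun_def coord_space_def fun_eq_iff algebra_simps)

lemma act_L_weight_zL: "Lrep.act m (gen Dxi - scal (of_nat m)) (zL m 0) = (0 :: nat \<Rightarrow> 'k::field_char_0)"
  unfolding act_L_weight[OF zL_coord_space] by (auto simp: fun_eq_iff zL_def zero_fun_apply)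

text \<open>Multiplication by \<open>u\<close> or \<open>v\<close> raises weights by \<open>2\<close>, multiplication by \<open>x\<close> or \<open>y\<close> lowers them by \<open>2\<close>, and
  \<open>g\<close> preserves them.\<close>

lemma weight_shift:
  fixes \<mu> :: "'k::field_char_0"
  shows "(gen Dxi - scal (\<mu> + 2)) * gen Dv - gen Dv * (gen Dxi - scal \<mu>) \<in> double_ideal"
    "(gen Dxi - scal (\<mu> + 2)) * gen Du - gen Du * (gen Dxi - scal \<mu>) \<in> double_ideal"
    "(gen Dxi - scal (\<mu> - 2)) * gen Dx - gen Dx * (gen Dxi - scal \<mu>) \<in> double_ideal"
    "(gen Dxi - scal (\<mu> - 2)) * gen Dy - gen Dy * (gen Dxi - scal \<mu>) \<in> double_ideal"
    "(gen Dxi - scal \<mu>) * (gen Dg - 1) - (gen Dg - 1) * (gen Dxi - scal \<mu>) \<in> double_ideal"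
  using double_ideal_uminus[OF rels_in_double_ideal(10)] double_ideal_uminus[OF rels_in_double_ideal(11)]
    rels_in_double_ideal(7) rels_in_double_ideal(6) rels_in_double_ideal(3)
  by (simp_all add: algebra_simps scal_simps scal_numeral scal_commute)

locale LL_ext =
  fixes n :: nat and e :: "('k::field_char_0 double, nat \<Rightarrow> 'k, nat \<Rightarrow> 'k, 't) extn"
  assumes e: "LL_extension n e"
begin

lemmas E = extensionD[OF e]

sublocale T: dmod "mid e" by (simp add: dmod_def E)

abbreviation smul (infixr "\<cdot>" 75) where "p \<cdot> t \<equiv> dbl p \<odot>\<^bsub>mid e\<^esub> t"

lemma inc_closed: "f \<in> coord_space n \<Longrightarrow> inc e f \<in> carrier (mid e)"
  using lmod_homD(1)[OF E(4)] by simp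

lemma inc_add: "\<lbrakk>f \<in> coord_space n; f' \<in> coord_space n\<rbrakk> \<Longrightarrow> inc e (f + f') = inc e f \<oplus>\<^bsub>mid e\<^esub> inc e f'"
  using lmod_homD(2)[OF E(4)] by simp

lemma inc_act: "f \<in> coord_space n \<Longrightarrow> inc e (Lrep.act n p f) = p \<cdot> inc e f"
  using lmod_homD(3)[OF E(4), of "dbl p" f] by (simp add: L_smult)

lemma inc_zero: "inc e 0 = \<zero>\<^bsub>mid e\<^esub>"
  using lmod_hom_zero[OF E(4) E(1) E(3)] by simp

lemma prj_closed: "t \<in> carrier (mid e) \<Longrightarrow> prj e t \<in> coord_space (n + 2)"
  using lmod_homD(1)[OF E(5)] by simp

lemma prj_add: "\<lbrakk>t \<in> carrier (mid e); t' \<in> carrier (mid e)\<rbrakk> \<Longrightarrow> prj e (t \<oplus>\<^bsub>mid e\<^esub> t') = prj e t + prj e t'"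
  using lmod_homD(2)[OF E(5)] by simp

lemma prj_act: "t \<in> carrier (mid e) \<Longrightarrow> prj e (p \<cdot> t) = Lrep.act (n + 2) p (prj e t)"
  using lmod_homD(3)[OF E(5), of "dbl p" t] L_smult[OF prj_closed] by simp

lemma prj_zero: "prj e \<zero>\<^bsub>mid e\<^esub> = 0"
  using lmod_hom_zero[OF E(5) E(3) E(2)] by simp

lemma prj_inc: "f \<in> coord_space n \<Longrightarrow> prj e (inc e f) = 0"
  using E(7) by simp

lemma kerE:
  assumes "t \<in> carrier (mid e)" "prj e t = 0"
  obtains f where "f \<in> coord_space n" "t = inc e f"
  using extension_kerE[OF e assms(1)] assms(2) by auto

lemma inc_inj: "\<lbrakk>f \<in> coord_space n; f' \<in> coord_space n; inc e f = inc e f'\<rbrakk> \<Longrightarrow> f = f'"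
  using E(6) by (auto dest: inj_onD)

abbreviation has_weight :: "'k \<Rightarrow> 't \<Rightarrow> bool" where
  "has_weight \<mu> t \<equiv> (gen Dxi - scal \<mu>) \<cdot> t = \<zero>\<^bsub>mid e\<^esub>"

lemma weight_shift_smul:
  assumes "t \<in> carrier (mid e)" "has_weight \<mu> t" "(gen Dxi - scal \<nu>) * p - p * (gen Dxi - scal \<mu>) \<in> double_ideal"
  shows "has_weight \<nu> (p \<cdot> t)"
proof -
  have "((gen Dxi - scal \<nu>) * p) \<cdot> t = (p * (gen Dxi - scal \<mu>)) \<cdot> t"
    using T.ann_eq_iff[OF assms(1)] T.ann_double_ideal[OF assms(1,3)] by blast
  also have "\<dots> = \<zero>\<^bsub>mid e\<^esub>" by (simp add: T.dbl_mult assms)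
  finally show ?thesis using assms(1) by (simp add: T.dbl_mult)
qed

lemma ker_weight:
  assumes "t \<in> carrier (mid e)" "prj e t = 0" "has_weight \<mu> t"
  obtains f where "f \<in> coord_space n" "t = inc e f" "\<And>j. (of_nat n - 2 * of_nat j - \<mu>) * f j = 0"
proof -
  obtain f where f: "f \<in> coord_space n" "t = inc e f" using kerE[OF assms(1,2)] .
  have "inc e (Lrep.act n (gen Dxi - scal \<mu>) f) = inc e 0"
    using assms(3) f inc_act inc_zero by simp
  then have "Lrep.act n (gen Dxi - scal \<mu>) f = 0"
    by (rule inc_inj[OF Lrep.act_V[OF f(1)] Lrep.V_zero])
  from fun_cong[OF this] have "(of_nat n - 2 * of_nat j - \<mu>) * f j = 0" for j
    unfolding act_L_weight[OF f(1)] zero_fun_apply .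
  then show ?thesis using that f by blast
qed

text \<open>The hypothesis excludes the weights of the quotient, and with \<open>k \<ge> 1\<close> also those of the submodule.\<close>

lemma weight_vanish:
  assumes t: "t \<in> carrier (mid e)" "has_weight \<mu> t"
    and \<mu>: "\<And>k. k \<le> n + 2 \<Longrightarrow> \<mu> \<noteq> of_nat n + 2 - 2 * of_nat k"
  shows "t = \<zero>\<^bsub>mid e\<^esub>"
proof -
  have "Lrep.act (n + 2) (gen Dxi - scal \<mu>) (prj e t) = 0"
    using prj_act[OF t(1)] t(2) prj_zero by metis
  from fun_cong[OF this] have 1: "(of_nat (n + 2) - 2 * of_nat j - \<mu>) * prj e t j = 0" for j
    unfolding act_L_weight[OF prj_closed[OF t(1)]] zero_fun_apply .
  have "prj e t j = 0" for j
  proof (cases "j \<le> n + 2")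
    case True
    then have "of_nat (n + 2) - 2 * of_nat j - \<mu> \<noteq> 0" using \<mu>[OF True] by (auto simp: algebra_simps)
    then show ?thesis using 1[of j] by (simp only: mult_eq_0_iff) blast
  next
    case False
    then show ?thesis using prj_closed[OF t(1)] by (simp add: coord_space_def)
  qed
  then have "prj e t = 0" by (simp add: fun_eq_iff zero_fun_apply)
  then obtain f where f: "f \<in> coord_space n" "t = inc e f" "\<And>j. (of_nat n - 2 * of_nat j - \<mu>) * f j = 0"
    using ker_weight[OF t(1) _ t(2)] by metis
  have "f j = 0" for j
  proof (cases "j \<le> n")
    case True
    then have "of_nat n - 2 * of_nat j - \<mu> \<noteq> 0" using \<mu>[of "Suc j"] by (auto simp: algebra_simps)
    then show ?thesis using f(3)[of j] by (simp only: mult_eq_0_iff) blast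
  next
    case False
    then show ?thesis using f(1) by (simp add: coord_space_def)
  qed
  then have "f = 0" by (simp add: fun_eq_iff zero_fun_apply)
  then show ?thesis using f(2) inc_zero by simp
qed

lemma top_weight_ker:
  assumes "t \<in> carrier (mid e)" "prj e t = 0" "has_weight (of_nat (n + 2)) t"
  shows "t = \<zero>\<^bsub>mid e\<^esub>"
proof -
  obtain f where f: "f \<in> coord_space n" "t = inc e f"
    "\<And>j. (of_nat n - 2 * of_nat j - of_nat (n + 2)) * f j = 0" using ker_weight[OF assms] by metis
  have "f j = 0" for j
  proof -
    have "of_nat n - 2 * of_nat j - of_nat (n + 2) = (- of_nat (2 * Suc j) :: 'k)" by simp
    then show ?thesis using f(3)[of j] by (simp del: of_nat_mult of_nat_Suc)
  qed
  then have "f = 0" by (simp add: fun_eq_iff zero_fun_apply)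
  then show ?thesis using f(2) inc_zero by simp
qed

text \<open>Any lift has weight \<open>n + 2\<close> up to an error in the submodule, where \<open>\<xi> - (n + 2)\<close> has the nonzero eigenvalues
  \<open>- 2 (j + 1)\<close> and is therefore invertible; so the error can be corrected.\<close>

lemma top_vector_exists:
  obtains t where "t \<in> carrier (mid e)" "prj e t = zL (n + 2) 0" "has_weight (of_nat (n + 2)) t"
proof -
  let ?q = "gen Dxi - scal (of_nat (n + 2)) :: 'k free_alg"
  obtain t0 where t0: "t0 \<in> carrier (mid e)" "prj e t0 = zL (n + 2) 0"
    using extension_surjE[OF e, of "zL (n + 2) 0"] zL_coord_space by auto
  have "prj e (?q \<cdot> t0) = 0"
    unfolding prj_act[OF t0(1)] t0(2) by (rule act_L_weight_zL)
  then obtain f where f: "f \<in> coord_space n" "?q \<cdot> t0 = inc e f"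
    using kerE T.dbl_closed[OF t0(1)] by metis
  define f' where "f' = (\<lambda>j. f j / (2 * (of_nat j + 1)))"
  have f': "f' \<in> coord_space n" using f(1) by (simp add: f'_def coord_space_def)
  have nz: "of_nat j + 1 \<noteq> (0 :: 'k)" for j
    by (metis of_nat_Suc of_nat_neq_0 add.commute)
  have cancel: "- (2 * a) * (b / (2 * a)) + b = 0" if "a \<noteq> 0" for a b :: 'k
    using that by simp
  have "Lrep.act n ?q f' + f = 0"
  proof
    fix j
    have c: "of_nat n - 2 * of_nat j - of_nat (n + 2) = - (2 * (of_nat j + 1) :: 'k)" by simp
    show "(Lrep.act n ?q f' + f) j = 0 j"
      unfolding act_L_weight[OF f'] plus_fun_apply c zero_fun_apply
      unfolding f'_def by (rule cancel[OF nz])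
  qed
  then have "?q \<cdot> (t0 \<oplus>\<^bsub>mid e\<^esub> inc e f') = \<zero>\<^bsub>mid e\<^esub>"
    using t0 f f' inc_closed inc_zero inc_act[OF f', of ?q] inc_add[OF Lrep.act_V[OF f'] f(1), of ?q]
    by (simp add: T.dbl_add_right T.M.a_comm T.dbl_closed)
  moreover have "prj e (t0 \<oplus>\<^bsub>mid e\<^esub> inc e f') = zL (n + 2) 0"
    using t0 f' by (simp add: prj_add inc_closed prj_inc)
  ultimately show ?thesis using that t0(1) inc_closed[OF f'] by blast
qed

lemma top_vector_unique:
  assumes t: "t \<in> carrier (mid e)" "prj e t = zL (n + 2) 0" "has_weight (of_nat (n + 2)) t"
    and t': "t' \<in> carrier (mid e)" "prj e t' = zL (n + 2) 0" "has_weight (of_nat (n + 2)) t'"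
  shows "t = t'"
proof (rule T.diff_zero_imp_eq[OF t(1) t'(1)], rule top_weight_ker)
  show c: "t \<ominus>\<^bsub>mid e\<^esub> t' \<in> carrier (mid e)" using t t' by simp
  show "prj e (t \<ominus>\<^bsub>mid e\<^esub> t') = 0"
    using t t' prj_add[of "t \<ominus>\<^bsub>mid e\<^esub> t'" t'] by (simp add: T.M.a_assoc a_minus_def T.M.l_neg)
  show "has_weight (of_nat (n + 2)) (t \<ominus>\<^bsub>mid e\<^esub> t')"
    using t t' T.smult_neg[of "dbl _" t'] T.dbl_add_right[of t "\<ominus>\<^bsub>mid e\<^esub> t'"] by (simp add: a_minus_def)
qed

text \<open>\<open>x \<cdot> t\<close> lies in the submodule and has weight \<open>n\<close>, so only its coordinate at \<open>z\<^sub>n\<^sub>,\<^sub>0\<close> can be nonzero.\<close>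

lemma ext_inv_exists: "\<exists>c. ext_inv n e c"
proof -
  obtain t where t: "t \<in> carrier (mid e)" "prj e t = zL (n + 2) 0" "has_weight (of_nat (n + 2)) t"
    by (rule top_vector_exists)
  have xt: "gen Dx \<cdot> t \<in> carrier (mid e)" by (rule T.dbl_closed[OF t(1)])
  have "prj e (gen Dx \<cdot> t) = 0" by (simp only: prj_act[OF t(1)] Lrep.act_gen L_op_Dx)
  moreover have "has_weight (of_nat (n + 2) - 2) (gen Dx \<cdot> t)"
    by (rule weight_shift_smul[OF t(1,3)]) (rule weight_shift)
  ultimately obtain f where f: "f \<in> coord_space n" "gen Dx \<cdot> t = inc e f"
    "\<And>j. (of_nat n - 2 * of_nat j - (of_nat (n + 2) - 2)) * f j = 0" using ker_weight[OF xt] by metis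
  have "f j = sfun (f 0) (zL n 0) j" for j
    using f(3)[of j] by (cases "j = 0") (auto simp: sfun_apply zL_def)
  then have "f = sfun (f 0) (zL n 0)" by blast
  then show ?thesis using t f(2) unfolding ext_inv_def by metis
qed

lemma ext_inv_unique:
  assumes "ext_inv n e c" "ext_inv n e c'" shows "c = c'"
proof -
  obtain t t' where t: "t \<in> carrier (mid e)" "prj e t = zL (n + 2) 0" "has_weight (of_nat (n + 2)) t"
      "gen Dx \<cdot> t = inc e (sfun c (zL n 0))"
    and t': "t' \<in> carrier (mid e)" "prj e t' = zL (n + 2) 0" "has_weight (of_nat (n + 2)) t'"
      "gen Dx \<cdot> t' = inc e (sfun c' (zL n 0))"
    using assms unfolding ext_inv_def by metis
  have "inc e (sfun c (zL n 0)) = inc e (sfun c' (zL n 0))"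
    using top_vector_unique[OF t(1-3) t'(1-3)] t(4) t'(4) by simp
  then have "sfun c (zL n 0) = sfun c' (zL n 0)"
    by (rule inc_inj[rotated 2]) (auto intro: Lrep.V_s zL_coord_space)
  then have "sfun c (zL n 0) 0 = sfun c' (zL n 0) 0" by simp
  then show ?thesis by (simp add: sfun_apply zL_def)
qed

text \<open>\<open>u t\<close>, \<open>v t\<close> and \<open>y\<^sup>n\<^sup>+\<^sup>3 t\<close> have weights that do not occur; \<open>(g - 1) t\<close> has weight \<open>n + 2\<close> and lies in the submodule;
  \<open>x\<^sup>2\<close> and \<open>y\<^sup>n\<^sup>+\<^sup>1 x\<close> send \<open>t\<close> to multiples of \<open>x z\<^sub>n\<^sub>,\<^sub>0\<close> and of \<open>y\<^sup>n\<^sup>+\<^sup>1 z\<^sub>n\<^sub>,\<^sub>0\<close>, which are zero.\<close>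

lemma top_vector_rels:
  assumes t: "t \<in> carrier (mid e)" "prj e t = zL (n + 2) 0" "has_weight (of_nat (n + 2)) t"
    and x: "gen Dx \<cdot> t = inc e (sfun c (zL n 0))"
    and p: "p \<in> {gen Dg - 1, gen Dxi - of_nat (n + 2), gen Du, gen Dv,
     gen Dx ^ 2, gen Dy ^ (n + 3), gen Dy ^ (n + 1) * gen Dx}"
  shows "p \<cdot> t = \<zero>\<^bsub>mid e\<^esub>"
proof -
  have cz: "sfun c (zL n 0) \<in> coord_space n" by (intro Lrep.V_s zL_coord_space)
  have "prj e ((gen Dg - 1) \<cdot> t) = 0"
    unfolding prj_act[OF t(1)] t(2)
    by (auto simp: Lrep.act_diff Lrep.act_gen Lrep.act_one L_op_coords zL_def fun_eq_iff zero_fun_apply)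
  then have g: "(gen Dg - 1) \<cdot> t = \<zero>\<^bsub>mid e\<^esub>"
    by (rule top_weight_ker[OF T.dbl_closed[OF t(1)] _ weight_shift_smul[OF t(1,3) weight_shift(5)]])
  have neq: "of_nat (n + 2) + 2 \<noteq> of_nat n + 2 - 2 * (of_nat k :: 'k)" for k
  proof
    assume "of_nat (n + 2) + 2 = of_nat n + 2 - 2 * (of_nat k :: 'k)"
    then have "of_nat (2 * k + 2) = (0 :: 'k)" by (simp add: algebra_simps)
    then show False by (simp only: of_nat_eq_0_iff)
  qed
  have u: "gen Du \<cdot> t = \<zero>\<^bsub>mid e\<^esub>"
    by (rule weight_vanish[OF T.dbl_closed[OF t(1)] weight_shift_smul[OF t(1,3) weight_shift(2)]]) (rule neq)
  have v: "gen Dv \<cdot> t = \<zero>\<^bsub>mid e\<^esub>"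
    by (rule weight_vanish[OF T.dbl_closed[OF t(1)] weight_shift_smul[OF t(1,3) weight_shift(1)]]) (rule neq)
  have xx: "gen Dx ^ 2 \<cdot> t = \<zero>\<^bsub>mid e\<^esub>"
    using t(1) inc_act[OF cz, of "gen Dx"]
    by (simp add: power2_eq_square T.dbl_mult x Lrep.act_gen L_op_Dx inc_zero)
  have "has_weight (of_nat (n + 2) - of_nat (2 * k)) (gen Dy ^ k \<cdot> t)" for k
  proof (induction k)
    case 0
    then show ?case using t by (simp add: T.dbl_one)
  next
    case (Suc k)
    have "has_weight (of_nat (n + 2) - of_nat (2 * k) - 2) (gen Dy \<cdot> (gen Dy ^ k \<cdot> t))"
      by (rule weight_shift_smul[OF T.dbl_closed[OF t(1)] Suc weight_shift(4)])
    moreover have "of_nat (n + 2) - of_nat (2 * k) - 2 = (of_nat (n + 2) - of_nat (2 * Suc k) :: 'k)" by simp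
    ultimately show ?case by (simp only: power_Suc T.dbl_mult[OF t(1)])
  qed
  from this[of "n + 3"] have y: "gen Dy ^ (n + 3) \<cdot> t = \<zero>\<^bsub>mid e\<^esub>"
  proof (rule weight_vanish[OF T.dbl_closed[OF t(1)]])
    fix k assume "k \<le> n + 2"
    show "of_nat (n + 2) - of_nat (2 * (n + 3)) \<noteq> of_nat n + 2 - 2 * (of_nat k :: 'k)"
    proof
      assume "of_nat (n + 2) - of_nat (2 * (n + 3)) = of_nat n + 2 - 2 * (of_nat k :: 'k)"
      then have "of_nat (2 * k) = (of_nat (2 * (n + 3)) :: 'k)" by (simp add: algebra_simps)
      then have "2 * k = 2 * (n + 3)" by (simp only: of_nat_eq_iff)
      then show False using \<open>k \<le> n + 2\<close> by simp
    qed
  qed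
  have "zL n (n + 1) = (0 :: nat \<Rightarrow> 'k)" by (simp add: zL_def fun_eq_iff zero_fun_apply)
  then have yx: "(gen Dy ^ (n + 1) * gen Dx) \<cdot> t = \<zero>\<^bsub>mid e\<^esub>"
    using inc_act[OF cz, of "gen Dy ^ (n + 1)"]
    by (simp only: T.dbl_mult[OF t(1)] x Lrep.act_v_s act_L_Dy_pow Lrep.s_zero inc_zero)
  show ?thesis using p g t(3) u v xx y yx unfolding scal_of_nat by blast
qed

text \<open>The homomorphism \<open>\<Phi>\<close> from \<open>Xmod n 1 \<cong> T(n,1)\<close> that takes \<open>z\<close> to the top vector restricts to \<open>c\<close> times the
  inclusion on \<open>L n\<close>, where it is zero if \<open>c = 0\<close>. Replacing it by the inclusion itself on
  \<open>L n\<close> and keeping it on the complement \<open>{0} \<times> L (n + 2)\<close> gives a map \<open>\<Psi>\<close> that is a homomorphism for the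
  action with parameter \<open>c\<close>.\<close>

lemma iso_X_ext:
  assumes "ext_inv n e c" shows "LL_iso n (X_ext n c) e"
proof -
  obtain t where t: "t \<in> carrier (mid e)" "prj e t = zL (n + 2) 0" "has_weight (of_nat (n + 2)) t"
      "gen Dx \<cdot> t = inc e (sfun c (zL n 0))"
    using assms unfolding ext_inv_def by metis
  obtain h where h: "h \<in> lmod_hom jordan_double (T1 n) (mid e)" "h (zTgen n) = t"
    using T1_universal[OF E(3) t(1) top_vector_rels[OF t]] by blast
  define G where "G = inv_into (carrier (T1 n)) (T1_map n :: 'k double set \<Rightarrow> _)"
  have G: "G \<in> lmod_hom jordan_double (Xmod n 1) (T1 n)"
    using lmod_iso_inv[OF T1_map_iso[where 'k = 'k] T1_left_module] by (simp add: lmod_iso_def G_def)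
  define \<Phi> where "\<Phi> v = h (G v)" for v
  have \<Phi>: "\<Phi> \<in> lmod_hom jordan_double (Xmod n 1) (mid e)"
    using lmod_hom_comp[OF G h(1)] unfolding \<Phi>_def .
  have \<Phi>_act: "\<Phi> (Xrep.act n 1 p (zX n)) = p \<cdot> t" for p
  proof -
    have "bij_betw (T1_map n) (carrier (T1 n)) (carrier (Xmod n 1 :: ('k double, _) module))"
      using T1_map_iso[where 'k = 'k] by (simp add: lmod_iso_def)
    then have "G (Xrep.act n 1 p (zX n)) = dbl p \<odot>\<^bsub>T1 n\<^esub> zTgen n"
      unfolding G_def T1_map_dbl[symmetric]
      by (rule bij_betw_inv_into_left) (rule T1.dbl_closed[OF zTgen_carrier])
    then show ?thesis
      unfolding \<Phi>_def using lmod_homD(3)[OF h(1) dbl_carrier zTgen_carrier] h(2) by simp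
  qed
  note XV = Lrep.V_zero Lrep.V_add Lrep.V_s zL_coord_space Lrep.act_V
  have \<Phi>_closed: "\<Phi> (f, k) \<in> carrier (mid e)" if "f \<in> coord_space n" "k \<in> coord_space (n + 2)" for f k
    using lmod_homD(1)[OF \<Phi>, of "(f, k)"] that by simp
  have \<Phi>_smul: "\<Phi> (Xrep.act n 1 p (f, k)) = p \<cdot> \<Phi> (f, k)"
    if "f \<in> coord_space n" "k \<in> coord_space (n + 2)" for p f k
    using lmod_homD(3)[OF \<Phi> dbl_carrier, of "(f, k)" p] Xmod_smult[of "(f, k)" n 1 p] that by simp
  have \<Phi>_add: "\<Phi> (f + f', k + k') = \<Phi> (f, k) \<oplus>\<^bsub>mid e\<^esub> \<Phi> (f', k')"
    if "f \<in> coord_space n" "k \<in> coord_space (n + 2)" "f' \<in> coord_space n" "k' \<in> coord_space (n + 2)" for f k f' k'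
    using lmod_homD(2)[OF \<Phi>, of "(f, k)" "(f', k')"] that by simp
  have \<Phi>_prj: "prj e (\<Phi> (f, k)) = k" if "f \<in> coord_space n" "k \<in> coord_space (n + 2)" for f k
  proof -
    have "prj e (\<Phi> (f, k)) = prj e (norm_form n f k \<cdot> t)"
      using \<Phi>_act[of "norm_form n f k"] act_X_norm_form'[OF that] by simp
    also have "\<dots> = Lrep.act (n + 2) (norm_form n f k) (snd (zX n))"
      by (simp only: prj_act[OF t(1)] t(2) zX_def snd_conv)
    also have "\<dots> = snd (Xrep.act n 1 (norm_form n f k) (zX n))" by (simp only: act_X_prj)
    also have "\<dots> = k" unfolding act_X_norm_form'[OF that] by simp
    finally show ?thesis .
  qed
  have \<Phi>_inc: "\<Phi> (f, 0) = inc e (sfun c f)" if "f \<in> coord_space n" for f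
  proof (rule L_hom_eqI[OF _ _ _ that])
    show "(\<lambda>f. \<Phi> (f, 0)) \<in> lmod_hom jordan_double (L n) (mid e)"
    proof (rule lmod_homI_dbl)
      fix p and f :: "nat \<Rightarrow> 'k" assume "f \<in> carrier (L n)"
      then show "\<Phi> (dbl p \<odot>\<^bsub>L n\<^esub> f, 0) = p \<cdot> \<Phi> (f, 0)"
        using \<Phi>_smul[of f 0 p] by (simp add: L_smult act_X_inc XV)
    next
      fix f f' :: "nat \<Rightarrow> 'k" assume "f \<in> carrier (L n)" "f' \<in> carrier (L n)"
      then show "\<Phi> (f \<oplus>\<^bsub>L n\<^esub> f', 0) = \<Phi> (f, 0) \<oplus>\<^bsub>mid e\<^esub> \<Phi> (f', 0)"
        using \<Phi>_add[of f 0 f' 0] by (simp add: XV)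
    qed (simp add: \<Phi>_closed XV)
    show "(\<lambda>f. inc e (sfun c f)) \<in> lmod_hom jordan_double (L n) (mid e)"
      by (rule lmod_homI_dbl) (auto simp: L_smult Lrep.act_v_s[symmetric] inc_act Lrep.s_add inc_add inc_closed XV)
    show "\<Phi> (zL n 0, 0) = inc e (sfun c (zL n 0))"
      using \<Phi>_act[of "gen Dx"] t(4) by (simp add: act_X_Dx Lrep.s_one)
  qed
  define \<Psi> where "\<Psi> v = inc e (fst v) \<oplus>\<^bsub>mid e\<^esub> \<Phi> (0, snd v)" for v
  have "\<Psi> \<in> lmod_hom jordan_double (Xmod n c) (mid e)"
  proof (rule lmod_homI_dbl)
    fix v :: "(nat \<Rightarrow> 'k) \<times> (nat \<Rightarrow> 'k)" assume v: "v \<in> carrier (Xmod n c)"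
    then obtain f k where fk: "v = (f, k)" "f \<in> coord_space n" "k \<in> coord_space (n + 2)" by auto
    then show "\<Psi> v \<in> carrier (mid e)" by (simp add: \<Psi>_def inc_closed \<Phi>_closed XV)
    fix p
    \<comment> \<open>\<open>(d, p k)\<close> is \<open>p \<cdot> (0, k)\<close> for parameter \<open>1\<close>; for parameter \<open>c\<close> the result is \<open>(c d, p k)\<close>, and \<open>\<Phi> (d, 0) = inc e (c d)\<close>.\<close>
    define d where "d = fst (Xrep.act n 1 p (0, k))"
    have d: "d \<in> coord_space n" using Xrep.act_V[of "(0, k)" n 1 p] fk by (auto simp: d_def XV)
    have k': "Lrep.act (n + 2) p k \<in> coord_space (n + 2)" using fk by (intro XV)
    have 1: "Xrep.act n 1 p (0, k) = (d, Lrep.act (n + 2) p k)"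
      using act_X_prj[of n 1 p "(0, k)"] by (simp add: d_def prod_eq_iff)
    have 2: "Xrep.act n c p (0, k) = (sfun c d, Lrep.act (n + 2) p k)"
      using act_X_scale[of n c p 0 k] by (simp add: 1 Lrep.s_zero)
    have "Xrep.act n c p v = Xrep.act n c p (f, 0) + Xrep.act n c p (0, k)"
      unfolding fk(1) Xrep.act_v_add[symmetric] by simp
    then have "dbl p \<odot>\<^bsub>Xmod n c\<^esub> v = (Lrep.act n p f + sfun c d, Lrep.act (n + 2) p k)"
      using v by (simp add: Xmod_smult act_X_inc 2)
    then have "\<Psi> (dbl p \<odot>\<^bsub>Xmod n c\<^esub> v) = inc e (Lrep.act n p f) \<oplus>\<^bsub>mid e\<^esub> \<Phi> (d, 0) \<oplus>\<^bsub>mid e\<^esub> \<Phi> (0, Lrep.act (n + 2) p k)"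
      using fk d by (simp add: \<Psi>_def inc_add XV \<Phi>_inc)
    also have "\<dots> = p \<cdot> inc e f \<oplus>\<^bsub>mid e\<^esub> (\<Phi> (d, 0) \<oplus>\<^bsub>mid e\<^esub> \<Phi> (0, Lrep.act (n + 2) p k))"
      using fk d k' by (simp add: inc_act T.M.a_assoc T.dbl_closed inc_closed \<Phi>_closed XV del: add_2_eq_Suc')
    also have "\<Phi> (d, 0) \<oplus>\<^bsub>mid e\<^esub> \<Phi> (0, Lrep.act (n + 2) p k) = p \<cdot> \<Phi> (0, k)"
      using \<Phi>_add[OF d Lrep.V_zero Lrep.V_zero k'] \<Phi>_smul[OF Lrep.V_zero fk(3), of p] by (simp add: 1)
    finally show "\<Psi> (dbl p \<odot>\<^bsub>Xmod n c\<^esub> v) = p \<cdot> \<Psi> v"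
      using fk by (simp add: \<Psi>_def T.dbl_add_right inc_closed \<Phi>_closed XV)
  next
    fix v w :: "(nat \<Rightarrow> 'k) \<times> (nat \<Rightarrow> 'k)" assume "v \<in> carrier (Xmod n c)" "w \<in> carrier (Xmod n c)"
    then obtain f k f' k' where fk: "v = (f, k)" "f \<in> coord_space n" "k \<in> coord_space (n + 2)"
      "w = (f', k')" "f' \<in> coord_space n" "k' \<in> coord_space (n + 2)" by auto
    have c: "inc e f \<in> carrier (mid e)" "inc e f' \<in> carrier (mid e)"
      "\<Phi> (0, k) \<in> carrier (mid e)" "\<Phi> (0, k') \<in> carrier (mid e)"
      using fk by (auto intro!: inc_closed \<Phi>_closed XV)
    have "\<Psi> (v \<oplus>\<^bsub>Xmod n c\<^esub> w) = (inc e f \<oplus>\<^bsub>mid e\<^esub> inc e f') \<oplus>\<^bsub>mid e\<^esub> (\<Phi> (0, k) \<oplus>\<^bsub>mid e\<^esub> \<Phi> (0, k'))"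
      using fk \<Phi>_add[OF Lrep.V_zero fk(3) Lrep.V_zero fk(6)] by (simp add: \<Psi>_def inc_add)
    also have "\<dots> = \<Psi> v \<oplus>\<^bsub>mid e\<^esub> \<Psi> w"
      using c by (simp add: \<Psi>_def fk(1,4) T.M.a_ac)
    finally show "\<Psi> (v \<oplus>\<^bsub>Xmod n c\<^esub> w) = \<Psi> v \<oplus>\<^bsub>mid e\<^esub> \<Psi> w" .
  qed
  moreover have "\<Psi> (f, 0) = inc e f" if "f \<in> coord_space n" for f
    using that \<Phi>_inc[of 0] by (simp add: \<Psi>_def XV Lrep.s_zero inc_zero inc_closed)
  moreover have "prj e (\<Psi> v) = snd v" if "v \<in> coord_space n \<times> coord_space (n + 2)" for v
    using that by (cases v) (simp add: \<Psi>_def prj_add inc_closed \<Phi>_closed XV prj_inc \<Phi>_prj)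
  ultimately show ?thesis
    by (intro ext_isoI[OF X_ext_extension e, of \<Psi>]) (simp_all add: X_ext_def)
qed

end

lemma LL_extI: "LL_extension n e \<Longrightarrow> LL_ext n e"
  by (simp add: LL_ext_def)

text \<open>An isomorphism of extensions carries the top vector to the top vector.\<close>

lemma ext_inv_iso:
  assumes "LL_iso n e e'" and "ext_inv n e c"
  shows "ext_inv n e' c"
proof -
  obtain \<phi> where e: "LL_extension n e" "LL_extension n e'"
    and \<phi>: "\<phi> \<in> lmod_hom jordan_double (mid e) (mid e')"
      "\<forall>a\<in>coord_space n. \<phi> (inc e a) = inc e' a"
      "\<forall>t\<in>carrier (mid e). prj e' (\<phi> t) = prj e t"
    using assms(1) by (auto simp: ext_iso_def lmod_iso_def)
  obtain t where t: "t \<in> carrier (mid e)" "prj e t = zL (n + 2) 0"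
      "dbl (gen Dxi - scal (of_nat (n + 2))) \<odot>\<^bsub>mid e\<^esub> t = \<zero>\<^bsub>mid e\<^esub>"
      "dbl (gen Dx) \<odot>\<^bsub>mid e\<^esub> t = inc e (sfun c (zL n 0))"
    using assms(2) unfolding ext_inv_def by metis
  have "dbl p \<odot>\<^bsub>mid e'\<^esub> \<phi> t = \<phi> (dbl p \<odot>\<^bsub>mid e\<^esub> t)" for p
    using lmod_homD(3)[OF \<phi>(1) dbl_carrier t(1)] by simp
  moreover have "\<phi> \<zero>\<^bsub>mid e\<^esub> = \<zero>\<^bsub>mid e'\<^esub>"
    using lmod_hom_zero[OF \<phi>(1)] extensionD(3)[OF e(1)] extensionD(3)[OF e(2)] by blast
  moreover have "sfun c (zL n 0) \<in> coord_space n" by (intro Lrep.V_s zL_coord_space)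
  ultimately show ?thesis
    unfolding ext_inv_def using t \<phi> lmod_homD(1)[OF \<phi>(1) t(1)]
    by (intro bexI[of _ "\<phi> t"]) simp_all
qed

lemma ext_iso_if_inv:
  assumes "LL_extension n e" "LL_extension n e'"
    and "ext_inv n e c" "ext_inv n e' c"
  shows "LL_iso n e e'"
  using LL_ext.iso_X_ext[OF LL_extI[OF assms(1)] assms(3)] LL_ext.iso_X_ext[OF LL_extI[OF assms(2)] assms(4)]
  by (meson ext_iso_sym ext_iso_trans)

lemma act_X_top_weight: "Xrep.act n c (gen Dxi - scal (of_nat (n + 2))) (zX n) = 0"
  by (simp add: Xrep.act_simps zX_def X_op_Pair zero_prod_def sprod_Pair Lrep.s_zero)
    (auto simp: L_op_coords D_op_def zL_def sfun_def fun_eq_iff plus_fun_apply zero_fun_apply)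

lemma ext_inv_X: "ext_inv n (X_ext n c) c"
  unfolding ext_inv_def
proof (intro bexI[of _ "zX n"] conjI)
  show "zX n \<in> carrier (mid (X_ext n c))" using zX_carrier by (simp add: X_ext_def)
qed (simp_all add: X_ext_def Xmod_smult[OF zX_carrier] act_X_top_weight act_X_Dx
    del: of_nat_add add_2_eq_Suc', simp add: zX_def)

lemma ext_inv_E:
  fixes b :: "'k::field_char_0"
  assumes "b \<noteq> 0" shows "ext_inv n (E_ext n b) (1 / b)"
  unfolding ext_inv_def
proof (intro bexI[of _ "zTgen n"] conjI)
  show "zTgen n \<in> carrier (mid (E_ext n b))" using zTgen_carrier by (simp add: E_ext_def)
  show "prj (E_ext n b) (zTgen n) = zL (n + 2) 0"
    using T1_map_proj[OF zTgen_carrier] by (simp add: E_ext_def T1_map_gen zX_def)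
  show "dbl (gen Dxi - scal (of_nat (n + 2))) \<odot>\<^bsub>mid (E_ext n b)\<^esub> zTgen n = \<zero>\<^bsub>mid (E_ext n b)\<^esub>"
    using T1_ann_rels(2) unfolding scal_of_nat T1.ann_def E_ext_def by simp
  have c: "sfun (1 / b) (zL n 0) \<in> coord_space n" by (intro Lrep.V_s zL_coord_space)
  have "dbl (gen Dx) \<odot>\<^bsub>T1 n\<^esub> zTgen n = iota n b (sfun (1 / b) (zL n 0))"
    by (rule inj_T1_map[OF T1.dbl_closed[OF zTgen_carrier] T1_map_iota(1)[OF c]])
      (use assms in \<open>simp add: T1_map_dbl act_X_Dx T1_map_iota(2)[OF c] Lrep.s_mult[symmetric]\<close>)
  then show "dbl (gen Dx) \<odot>\<^bsub>mid (E_ext n b)\<^esub> zTgen n = inc (E_ext n b) (sfun (1 / b) (zL n 0))"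
    by (simp add: E_ext_def)
qed

lemma act_L_Dx: "Lrep.act m (gen Dx) f = (0 :: nat \<Rightarrow> 'k::field_char_0)"
  by (simp add: Lrep.act_gen L_op_Dx)

text \<open>A section takes the highest weight vector of \<open>L (n + 2)\<close>, which \<open>x\<close> kills, to the top vector.\<close>

lemma ext_inv_split:
  assumes "ext_split jordan_double (L n) (L (n + 2)) e"
  shows "ext_inv n e 0"
proof -
  obtain s where e: "LL_extension n e"
    and s: "s \<in> lmod_hom jordan_double (L (n + 2)) (mid e)" "\<forall>m\<in>coord_space (n + 2). prj e (s m) = m"
    using assms by (auto simp: ext_split_def simp del: add_2_eq_Suc')
  interpret LL_ext n e by (rule LL_extI[OF e])
  have z: "zL (n + 2) 0 \<in> carrier (L (n + 2))" using zL_coord_space by simp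
  have "p \<cdot> s (zL (n + 2) 0) = s (Lrep.act (n + 2) p (zL (n + 2) 0))" for p
    using lmod_homD(3)[OF s(1) dbl_carrier z, of p] by (simp add: L_smult zL_coord_space del: add_2_eq_Suc')
  moreover have "s 0 = \<zero>\<^bsub>mid e\<^esub>" using lmod_hom_zero[OF s(1) E(2) E(3)] by simp
  ultimately show ?thesis
    unfolding ext_inv_def using lmod_homD(1)[OF s(1) z] s(2)[rule_format, OF zL_coord_space]
    by (intro bexI[of _ "s (zL (n + 2) 0)"])
      (simp_all add: act_L_weight_zL act_L_Dx inc_zero del: add_2_eq_Suc' of_nat_add)
qed

lemma ext_inv_trivial: "ext_inv n (ext_trivial (L n) (L (n + 2))) (0 :: 'k::field_char_0)"
proof -
  interpret N: left_module jordan_double "L n :: ('k double, nat \<Rightarrow> 'k) module" by (rule L_left_module)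
  interpret M: left_module jordan_double "L (n + 2) :: ('k double, nat \<Rightarrow> 'k) module" by (rule L_left_module)
  have "(\<lambda>m. (\<zero>\<^bsub>L n\<^esub>, m)) \<in> lmod_hom jordan_double (L (n + 2)) (lmod_sum (L n) (L (n + 2) :: ('k double, nat \<Rightarrow> 'k) module))"
    by (rule lmod_homI) (auto simp: Lrep.V_zero N.smult_zero[simplified])
  then have "ext_split jordan_double (L n) (L (n + 2)) (ext_trivial (L n) (L (n + 2) :: ('k double, nat \<Rightarrow> 'k) module))"
    unfolding ext_split_def
    using ext_trivial_extension[OF L_left_module L_left_module]
    by (intro conjI bexI[of _ "\<lambda>m. (\<zero>\<^bsub>L n\<^esub>, m)"]) (auto simp: ext_trivial_def)
  then show ?thesis by (rule ext_inv_split)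
qed

lemma ext_split_iff:
  assumes "LL_extension n e"
  shows "ext_split jordan_double (L n) (L (n + 2)) e \<longleftrightarrow> ext_inv n e 0"
  using ext_inv_split
    ext_split_if_iso_trivial[OF ext_iso_if_inv[OF ext_trivial_extension[OF L_left_module L_left_module] assms ext_inv_trivial]]
  by blast

lemma ext_iso_E_iff:
  assumes "LL_extension n e" "ext_inv n e c" "b \<noteq> 0"
  shows "LL_iso n e (E_ext n b) \<longleftrightarrow> c = 1 / b"
  using ext_iso_if_inv[OF assms(1) E_ext_extension[OF assms(3)] assms(2)] ext_inv_E[OF assms(3)]
    ext_inv_iso[OF _ assms(2)] LL_ext.ext_inv_unique[OF LL_extI[OF E_ext_extension[OF assms(3)]]]
  by metis

subsection \<open>Isomorphism type of the middle term\<close>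

text \<open>The property of a middle term that separates \<open>T(n,1)\<close> from the direct sum.\<close>

definition x_trivial :: "('k::field double, 'm) module \<Rightarrow> bool" where
  "x_trivial M \<longleftrightarrow> (\<forall>t\<in>carrier M. dbl (gen Dx) \<odot>\<^bsub>M\<^esub> t = \<zero>\<^bsub>M\<^esub>)"

lemma x_trivial_iso:
  assumes "lmod_isomorphic jordan_double M N" "left_module jordan_double M" "left_module jordan_double N"
  shows "x_trivial M \<longleftrightarrow> x_trivial N"
proof -
  obtain h where h: "h \<in> lmod_hom jordan_double M N" "bij_betw h (carrier M) (carrier N)"
    using assms(1) by (auto simp: lmod_isomorphic_def lmod_iso_def)
  interpret M: left_module jordan_double M by fact
  have 0: "h \<zero>\<^bsub>M\<^esub> = \<zero>\<^bsub>N\<^esub>" using lmod_hom_zero[OF h(1) assms(2,3)] .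
  have "dbl (gen Dx) \<odot>\<^bsub>N\<^esub> h t = \<zero>\<^bsub>N\<^esub> \<longleftrightarrow> dbl (gen Dx) \<odot>\<^bsub>M\<^esub> t = \<zero>\<^bsub>M\<^esub>" if "t \<in> carrier M" for t
    using lmod_homD(3)[OF h(1) dbl_carrier that, of "gen Dx"] 0 h(2) M.smult_closed[OF dbl_carrier that]
    unfolding bij_betw_def by (metis M.M.zero_closed inj_onD)
  then show ?thesis
    unfolding x_trivial_def bij_betw_imp_surj_on[OF h(2), symmetric] by simp
qed

lemma x_trivial_sum: "x_trivial (lmod_sum (L n) (L m) :: ('k::field_char_0 double, _) module)"
  by (auto simp: x_trivial_def L_smult act_L_Dx)

lemma not_x_trivial_T1: "\<not> x_trivial (T1 n :: ('k::field_char_0 double, _) module)"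
proof
  assume "x_trivial (T1 n :: ('k double, _) module)"
  then have "dbl (gen Dx) \<odot>\<^bsub>T1 n\<^esub> zTgen n = (\<zero>\<^bsub>T1 n\<^esub> :: 'k double set)"
    using zTgen_carrier unfolding x_trivial_def by blast
  then have "Xrep.act n (1 :: 'k) (gen Dx) (zX n) = T1_map n \<zero>\<^bsub>T1 n\<^esub>" by (metis T1_map_dbl)
  also have "\<dots> = 0" using lmod_hom_zero[OF T1_map_hom T1_left_module Xmod_left_module] by simp
  finally have "zL n 0 0 = (0 :: 'k)"
    by (simp add: act_X_Dx Lrep.s_one zero_prod_def fun_eq_iff zero_fun_apply)
  then show False by (simp add: zL_def)
qed

text \<open>Split means \<open>c = 0\<close>, and \<open>\<E>(b)\<close> has invariant \<open>1 / b\<close>.\<close>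

lemma classification:
  fixes e :: "('k::field_char_0 double, nat \<Rightarrow> 'k, nat \<Rightarrow> 'k, 't) extn"
  assumes e: "LL_extension n e"
  shows "((ext_split jordan_double (L n) (L (n + 2)) e \<and>
              \<not> (\<exists>b. b \<noteq> 0 \<and> LL_iso n e (E_ext n b))) \<or>
           (\<not> ext_split jordan_double (L n) (L (n + 2)) e \<and>
              (\<exists>!b. b \<noteq> 0 \<and> LL_iso n e (E_ext n b))))" (is ?A)
    and "((lmod_isomorphic jordan_double (mid e) (lmod_sum (L n) (L (n + 2))) \<and>
              \<not> lmod_isomorphic jordan_double (mid e) (T1 n)) \<or>
           (\<not> lmod_isomorphic jordan_double (mid e) (lmod_sum (L n) (L (n + 2))) \<and>
              lmod_isomorphic jordan_double (mid e) (T1 n)))" (is ?B)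
proof -
  interpret LL_ext n e by (rule LL_extI[OF e])
  obtain c where c: "ext_inv n e c" using ext_inv_exists by blast
  have split: "ext_split jordan_double (L n) (L (n + 2)) e \<longleftrightarrow> c = 0"
    using ext_split_iff[OF e] ext_inv_unique[OF c] c by metis
  have isoE: "b \<noteq> 0 \<and> LL_iso n e (E_ext n b) \<longleftrightarrow> b \<noteq> 0 \<and> c = 1 / b" for b
    using ext_iso_E_iff[OF e c] by metis
  show ?A
  proof (cases "c = 0")
    case True
    then show ?thesis unfolding split isoE by simp
  next
    case False
    have "\<exists>!b. b \<noteq> 0 \<and> c = 1 / b"
      using False by (intro ex1I[of _ "1 / c"]) auto
    then show ?thesis using False unfolding split isoE by simp
  qed
  have S: "left_module jordan_double (lmod_sum (L n) (L (n + 2)) :: ('k double, _) module)"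
    by (rule lmod_sum_left_module[OF L_left_module L_left_module])
  have excl: "\<not> (lmod_isomorphic jordan_double (mid e) (lmod_sum (L n) (L (n + 2))) \<and> lmod_isomorphic jordan_double (mid e) (T1 n))"
    using x_trivial_iso[OF _ E(3) S] x_trivial_iso[OF _ E(3) T1_left_module] x_trivial_sum not_x_trivial_T1 by blast
  have "lmod_isomorphic jordan_double (mid e) (lmod_sum (L n) (L (n + 2))) \<or> lmod_isomorphic jordan_double (mid e) (T1 n)"
  proof (cases "c = 0")
    case True
    then have "LL_iso n e (ext_trivial (L n) (L (n + 2)))"
      using ext_iso_if_inv[OF e ext_trivial_extension[OF L_left_module L_left_module] _ ext_inv_trivial] c by simp
    from lmod_isomorphic_if_ext_iso[OF this] show ?thesis by (simp add: ext_trivial_def)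
  next
    case False
    then have "LL_iso n e (E_ext n (1 / c))"
      using ext_iso_E_iff[OF e c, of "1 / c"] by simp
    from lmod_isomorphic_if_ext_iso[OF this] show ?thesis by (simp add: E_ext_def)
  qed
  with excl show ?B by blast
qed

subsection \<open>The operations on extension classes\<close>

text \<open>Pushing out along \<open>h\<close>, the class of \<open>(0, t)\<close> is the new top vector, and the gluing moves
  \<open>x t = inc e0 a\<close> to \<open>h a\<close>.\<close>

lemma ext_inv_pushout:
  fixes e0 :: "('k::field_char_0 double, 'n0, nat \<Rightarrow> 'k, 't) extn"
  assumes P: "pushout_data jordan_double N0 (L (n + 2)) e0 (L n) h"
    and t: "t \<in> carrier (mid e0)" "prj e0 t = zL (n + 2) 0"
      "dbl (gen Dxi - scal (of_nat (n + 2))) \<odot>\<^bsub>mid e0\<^esub> t = \<zero>\<^bsub>mid e0\<^esub>"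
      "dbl (gen Dx) \<odot>\<^bsub>mid e0\<^esub> t = inc e0 a"
    and a: "a \<in> carrier N0" "h a = sfun c (zL n 0)"
  shows "ext_inv n (ext_pushout N0 (L n) h e0) c"
proof -
  interpret pushout_data jordan_double N0 "L (n + 2)" e0 "L n" h by (rule P)
  have c: "(0, t) \<in> carrier dsum" using t(1) by (simp add: in_dsum Lrep.V_zero)
  have sm: "dbl p \<odot>\<^bsub>mid P\<^esub> cls (0, t) = cls (0, dbl p \<odot>\<^bsub>mid e0\<^esub> t)" for p
    unfolding mid_P Q.coset_smult[OF dbl_carrier c] by (simp add: dsum_ops L_smult[OF Lrep.V_zero])
  have "cls (0, inc e0 a) = inc P (sfun c (zL n 0))"
    using cls_eq[of 0 a] a by (simp add: inc_P Lrep.V_zero)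
  then show ?thesis
    unfolding ext_inv_def using t c Q.coset_closed[OF c] prj_P[of 0 t] Q.quot_zero
    by (intro bexI[of _ "cls (0, t)"] conjI)
      (simp_all add: sm Lrep.V_zero dsum_ops mid_P[symmetric] del: add_2_eq_Suc' of_nat_add)
qed

lemma scal_hom: "(\<lambda>a. dbl (scal c) \<odot>\<^bsub>L n\<^esub> a) \<in> lmod_hom jordan_double (L n) (L n :: ('k::field_char_0 double, nat \<Rightarrow> 'k) module)"
  by (rule lmod_homI_dbl)
    (auto simp: L_smult Lrep.act_V Lrep.V_add Lrep.act_scal Lrep.V_s Lrep.s_add Lrep.act_v_s)

lemma ext_scale:
  fixes c :: "'k::field_char_0"
  assumes e: "LL_extension n e" and d: "ext_inv n e d"
  defines "e' \<equiv> ext_pushout (L n) (L n) (\<lambda>a. dbl (scal c) \<odot>\<^bsub>L n\<^esub> a) e"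
  shows "LL_extension n e'" "ext_inv n e' (c * d)"
proof -
  have P: "pushout_data jordan_double (L n) (L (n + 2)) e (L n) (\<lambda>a. dbl (scal c) \<odot>\<^bsub>L n\<^esub> a)"
    using e scal_hom L_left_module unfolding pushout_data_def by blast
  show "LL_extension n e'"
    unfolding e'_def by (rule pushout_data.pushout_extension[OF P])
  obtain t where t: "t \<in> carrier (mid e)" "prj e t = zL (n + 2) 0"
      "dbl (gen Dxi - scal (of_nat (n + 2))) \<odot>\<^bsub>mid e\<^esub> t = \<zero>\<^bsub>mid e\<^esub>"
      "dbl (gen Dx) \<odot>\<^bsub>mid e\<^esub> t = inc e (sfun d (zL n 0))"
    using d unfolding ext_inv_def by metis
  have z: "sfun d (zL n 0) \<in> coord_space n" by (intro Lrep.V_s zL_coord_space)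
  show "ext_inv n e' (c * d)"
    unfolding e'_def
    by (rule ext_inv_pushout[OF P t]) (simp_all add: z L_smult[OF z] Lrep.act_scal Lrep.s_mult)
qed

text \<open>The top vector of the Baer sum is the class of \<open>((t, t'), z\<^sub>n\<^sub>+\<^sub>2\<^sub>,\<^sub>0)\<close>, and the codiagonal adds the two
  values of \<open>x\<close>.\<close>

lemma ext_add:
  assumes e: "LL_extension n e" "LL_extension n e'"
    and inv: "ext_inv n e c" "ext_inv n e' (c' :: 'k::field_char_0)"
  shows "LL_extension n (baer_sum (L n) (L (n + 2)) e e')"
    "ext_inv n (baer_sum (L n) (L (n + 2)) e e') (c + c')"
proof -
  note P = baer_sum_extension[OF e]
  show "LL_extension n (baer_sum (L n) (L (n + 2)) e e')"
    unfolding baer_sum_def by (rule pushout_data.pushout_extension[OF P])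
  obtain t where t: "t \<in> carrier (mid e)" "prj e t = zL (n + 2) 0"
      "dbl (gen Dxi - scal (of_nat (n + 2))) \<odot>\<^bsub>mid e\<^esub> t = \<zero>\<^bsub>mid e\<^esub>"
      "dbl (gen Dx) \<odot>\<^bsub>mid e\<^esub> t = inc e (sfun c (zL n 0))"
    using inv(1) unfolding ext_inv_def by metis
  obtain t' where t': "t' \<in> carrier (mid e')" "prj e' t' = zL (n + 2) 0"
      "dbl (gen Dxi - scal (of_nat (n + 2))) \<odot>\<^bsub>mid e'\<^esub> t' = \<zero>\<^bsub>mid e'\<^esub>"
      "dbl (gen Dx) \<odot>\<^bsub>mid e'\<^esub> t' = inc e' (sfun c' (zL n 0))"
    using inv(2) unfolding ext_inv_def by metis
  show "ext_inv n (baer_sum (L n) (L (n + 2)) e e') (c + c')"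
    unfolding baer_sum_def
  proof (rule ext_inv_pushout[OF P, where t = "((t, t'), zL (n + 2) 0)" and a = "(sfun c (zL n 0), sfun c' (zL n 0))"])
    show "(case (sfun c (zL n 0), sfun c' (zL n 0)) of (a, b) \<Rightarrow> a \<oplus>\<^bsub>L n\<^esub> b) = sfun (c + c') (zL n 0)"
      by (simp add: Lrep.s_add_left)
  qed (use t t' in \<open>simp_all add: ext_pullback_def ext_sum_def zL_coord_space Lrep.V_s
      L_smult[OF zL_coord_space] act_L_weight_zL act_L_Dx del: add_2_eq_Suc' of_nat_add\<close>)
qed

subsection \<open>The Ext group\<close>

text \<open>Via \<open>K\<close>, the module is the field itself, with basis \<open>K 1\<close>.\<close>

lemma one_dim_vectorspace:
  fixes V :: "('k::field, 'v) module" and K :: "'k \<Rightarrow> 'v"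
  assumes K: "inj K" "carrier V = range K" "\<zero>\<^bsub>V\<^esub> = K 0"
    "\<And>a b. K a \<oplus>\<^bsub>V\<^esub> K b = K (a + b)" "\<And>c a. c \<odot>\<^bsub>V\<^esub> K a = K (c * a)"
  shows "vectorspace class_ring V" "vectorspace.fin_dim class_ring V" "vectorspace.dim class_ring V = 1"
proof -
  have "module class_ring V"
  proof (rule moduleI)
    show "cring (class_ring :: 'k ring)" by (rule class_cring.cring_axioms)
    show "abelian_group V"
    proof (rule abelian_groupI)
      show "\<exists>y\<in>carrier V. y \<oplus>\<^bsub>V\<^esub> x = \<zero>\<^bsub>V\<^esub>" if x: "x \<in> carrier V" for x
      proof -
        obtain a where "x = K a" using x K(2) by auto
        then show ?thesis using K by (intro bexI[of _ "K (- a)"]) auto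
      qed
    qed (auto simp: K algebra_simps)
  qed (auto simp: K algebra_simps)
  then show vs: "vectorspace class_ring V"
    by (simp add: vectorspace_def class_field.field_axioms)
  then interpret V: vectorspace class_ring V .
  have lc: "V.lincomb a {K 1} = K (a (K 1))" for a
    by (simp add: V.lincomb_def K)
  have "V.span {K 1} = carrier V"
  proof
    show "V.span {K 1} \<subseteq> carrier V" by (rule V.span_is_subset2) (simp add: K)
    show "carrier V \<subseteq> V.span {K 1}"
    proof
      fix x assume "x \<in> carrier V"
      then obtain a where "x = K a" using K(2) by auto
      then have "x = V.lincomb (\<lambda>_. a) {K 1}" by (simp add: lc)
      then show "x \<in> V.span {K 1}" unfolding V.span_def by auto
    qed
  qed
  moreover have "\<not> V.lin_dep {K 1}"
  proof
    assume "V.lin_dep {K 1}"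
    then obtain A a v where A: "A \<subseteq> {K 1}" "V.lincomb a A = \<zero>\<^bsub>V\<^esub>" "v \<in> A" "a v \<noteq> 0"
      unfolding V.lin_dep_def by auto
    then have "A = {K 1}" "v = K 1" by auto
    then have "K (a (K 1)) = K 0" using A(2) lc K(3) by simp
    then show False using A(4) \<open>v = K 1\<close> K(1) by (auto dest: injD)
  qed
  ultimately have basis: "V.basis {K 1}" by (simp add: V.basis_def K)
  then show "V.fin_dim" unfolding V.fin_dim_def V.basis_def by (intro exI[of _ "{K 1}"]) simp
  show "V.dim = 1" using V.dim_basis[OF _ basis] by simp
qed

text \<open>The extensions of invariant \<open>c\<close>; these are precisely the elements of \<open>Ext\<^sup>1\<close> (\<open>ext_class_eq\<close>, \<open>Ext1_L\<close>).\<close>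

definition inv_class :: "nat \<Rightarrow> 'k::field_char_0 \<Rightarrow>
    ('k double, nat \<Rightarrow> 'k, nat \<Rightarrow> 'k, (nat \<Rightarrow> 'k) \<times> (nat \<Rightarrow> 'k)) extn set" where
  "inv_class n c = {e. LL_extension n e \<and> ext_inv n e c}"

lemma ext_class_eq:
  assumes "LL_extension n e" "ext_inv n e c"
  shows "ext_class jordan_double (L n) (L (n + 2)) e = inv_class n c"
proof -
  have "LL_iso n e e' \<longleftrightarrow> e' \<in> inv_class n c" for e'
  proof
    assume iso: "LL_iso n e e'"
    then have "LL_extension n e'" unfolding ext_iso_def by blast
    with ext_inv_iso[OF iso assms(2)] show "e' \<in> inv_class n c" unfolding inv_class_def by blast
  next
    assume "e' \<in> inv_class n c"
    then show "LL_iso n e e'"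
      using ext_iso_if_inv[OF assms(1) _ assms(2)] unfolding inv_class_def by blast
  qed
  then show ?thesis by (auto simp: ext_class_def)
qed

lemma X_ext_in_inv_class: "X_ext n c \<in> inv_class n c"
  by (simp add: inv_class_def X_ext_extension[simplified] ext_inv_X)

text \<open>The bijection \<open>c \<mapsto> inv_class n c\<close> from the field to \<open>Ext\<^sup>1\<close> is linear.\<close>

lemma Ext1_L:
  fixes n :: nat
  defines "V \<equiv> Ext1 jordan_double (\<lambda>c :: 'k::field_char_0. dbl (scal c)) (L n) (L (n + 2))"
  shows "vectorspace class_ring V" "vectorspace.fin_dim class_ring V" "vectorspace.dim class_ring V = 1"
proof -
  have K1: "inj (inv_class n :: 'k \<Rightarrow> _)"
  proof (rule injI)
    fix c d :: 'k assume "inv_class n c = inv_class n d"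
    then have "X_ext n c \<in> inv_class n d" using X_ext_in_inv_class by blast
    then show "c = d"
      using LL_ext.ext_inv_unique[OF LL_extI[OF X_ext_extension] ext_inv_X] unfolding inv_class_def by blast
  qed
  have K2: "carrier V = range (inv_class n)"
  proof
    show "carrier V \<subseteq> range (inv_class n)"
    proof
      fix C assume "C \<in> carrier V"
      then obtain e :: "('k double, nat \<Rightarrow> 'k, nat \<Rightarrow> 'k, (nat \<Rightarrow> 'k) \<times> (nat \<Rightarrow> 'k)) extn"
        where e: "LL_extension n e"
        "C = ext_class jordan_double (L n) (L (n + 2)) e" by (auto simp: V_def Ext1_def)
      then show "C \<in> range (inv_class n)"
        using ext_class_eq[OF e(1)] LL_ext.ext_inv_exists[OF LL_extI[OF e(1)]] by blast
    qed
    show "range (inv_class n) \<subseteq> carrier V"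
    proof (rule image_subsetI)
      fix c :: 'k
      show "inv_class n c \<in> carrier V"
        unfolding V_def Ext1_def partial_object.simps ext_class_eq[OF X_ext_extension ext_inv_X, symmetric]
        using X_ext_extension by (intro imageI CollectI)
    qed
  qed
  have K3: "\<zero>\<^bsub>V\<^esub> = inv_class n 0"
    unfolding V_def Ext1_def
    using ext_class_eq[OF ext_trivial_extension[OF L_left_module L_left_module] ext_inv_trivial] by simp
  \<comment> \<open>The unions over representatives that define the operations range over equal classes.\<close>
  have K4: "inv_class n a \<oplus>\<^bsub>V\<^esub> inv_class n b = inv_class n (a + b)" for a b
  proof -
    have "ext_class jordan_double (L n) (L (n + 2)) (baer_sum (L n) (L (n + 2)) e e') = inv_class n (a + b)"
      if "e \<in> inv_class n a" "e' \<in> inv_class n b" for e e'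
    proof -
      have *: "LL_extension n e" "LL_extension n e'"
        "ext_inv n e a" "ext_inv n e' b" using that by (simp_all add: inv_class_def)
      show ?thesis by (rule ext_class_eq[OF ext_add(1)[OF *] ext_add(2)[OF *]])
    qed
    then show ?thesis
      unfolding V_def Ext1_def using X_ext_in_inv_class by simp blast
  qed
  have K5: "c \<odot>\<^bsub>V\<^esub> inv_class n a = inv_class n (c * a)" for c a
  proof -
    have "ext_class jordan_double (L n) (L (n + 2)) (ext_pushout (L n) (L n) (\<lambda>a. dbl (scal c) \<odot>\<^bsub>L n\<^esub> a) e)
        = inv_class n (c * a)" if "e \<in> inv_class n a" for e
    proof -
      have *: "LL_extension n e" "ext_inv n e a"
        using that by (simp_all add: inv_class_def)
      show ?thesis by (rule ext_class_eq[OF ext_scale(1)[OF *] ext_scale(2)[OF *]])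
    qed
    then show ?thesis
      unfolding V_def Ext1_def using X_ext_in_inv_class by simp blast
  qed
  show "vectorspace class_ring V" "vectorspace.fin_dim class_ring V" "vectorspace.dim class_ring V = 1"
    using one_dim_vectorspace[OF K1 K2 K3 K4 K5] by simp_all
qed

theorem proposition6p3:
  fixes n :: nat
  shows
    "(\<forall>e :: ('k::{alg_closed_field, field_char_0} double, nat \<Rightarrow> 'k, nat \<Rightarrow> 'k, 't) extn.
        extension jordan_double (L n) (L (n + 2)) e \<longrightarrow>
          ((ext_split jordan_double (L n) (L (n + 2)) e \<and>
              \<not> (\<exists>b. b \<noteq> 0 \<and> ext_iso jordan_double (L n) (L (n + 2)) e (E_ext n b))) \<or>
           (\<not> ext_split jordan_double (L n) (L (n + 2)) e \<and>
              (\<exists>!b. b \<noteq> 0 \<and> ext_iso jordan_double (L n) (L (n + 2)) e (E_ext n b)))) \<and>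
          ((lmod_isomorphic jordan_double (mid e) (lmod_sum (L n) (L (n + 2))) \<and>
              \<not> lmod_isomorphic jordan_double (mid e) (T1 n)) \<or>
           (\<not> lmod_isomorphic jordan_double (mid e) (lmod_sum (L n) (L (n + 2))) \<and>
              lmod_isomorphic jordan_double (mid e) (T1 n)))) \<and>
     vectorspace class_ring
       (Ext1 jordan_double (\<lambda>c :: 'k. dbl (scal c)) (L n) (L (n + 2))) \<and>
     vectorspace.fin_dim class_ring
       (Ext1 jordan_double (\<lambda>c :: 'k. dbl (scal c)) (L n) (L (n + 2))) \<and>
     vectorspace.dim class_ring
       (Ext1 jordan_double (\<lambda>c :: 'k. dbl (scal c)) (L n) (L (n + 2))) = 1"
  by (intro conjI allI impI classification Ext1_L)

end
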